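(* Let $k\ge 1$ be an integer and let $p\in(1,p_{\mathrm S}(2k+2))\cup(p_{\mathrm S}(2k+2),p_{\mathrm{JL}}(2k+2))$. Then $u=0$ is the unique $C^2$ cylindrical solution $u:\mathbb{R}^{2k}\times\mathbb{R}\to\mathbb{R}$ of $$-\Delta_{\mathbb{H}^k}u=|u|^{p-1}u\quad\text{in }\mathbb{R}^{2k}\times\mathbb{R}$$ that is stable outside a compact set.
   Context: Write points of $\mathbb{R}^{2k}\times\mathbb{R}$ as $(x,y)$. For $i=1,\dots,k$ put $$X_i=\frac{\partial}{\partial x_i}+2x_{i+k}\frac{\partial}{\partial y},\qquad X_{i+k}=\frac{\partial}{\partial x_{i+k}}-2x_i\frac{\partial}{\partial y},$$ and define the Heisenberg Laplacian $\Delta_{\mathbb{H}^k}=\sum_{i=1}^{2k}X_i^2$. A function $u(x,y)$ is cylindrical if it is radially symmetric in the variable $x$. A $C^2$ solution $u$ of $-\Delta_{\mathbb{H}^k}u=|u|^{p-1}u$ is stable outside a compact set if there is a compact set $K\subset\mathbb{R}^{2k}\times\mathbb{R}$ such that $$\int_{\mathbb{R}^{2k+1}}\sum_{i=1}^{2k}|X_i\varphi|^2\,dz\ \ge\ \int_{\mathbb{R}^{2k+1}}p|u|^{p-1}\varphi^2\,dz\qquad\text{for all }\varphi\in C_c^1(\mathbb{R}^{2k+1}\setminus K),$$ where $dz$ is Lebesgue measure. For an integer $N\ge 3$: $p_{\mathrm S}(N)=\frac{N+2}{N-2}$; $p_{\mathrm{JL}}(N)=+\infty$ if $N\le 10$,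 and $p_{\mathrm{JL}}(N)=\frac{(N-2)^2-4N+8\sqrt{N-1}}{(N-2)(N-10)}$ if $N\ge 11$. *)

theory Defs
  imports "HOL-Analysis.Analysis"
begin

text \<open>
  A point of \<open>\<real>\<^sup>2\<^sup>k \<times> \<real>\<close> is a pair \<open>(x, y)\<close> with \<open>x :: real^('k + 'k)\<close> and \<open>k = CARD('k)\<close>.
  The coordinate \<open>x\<^sub>i\<close> is \<open>x $ Inl i\<close> and the coordinate \<open>x\<^sub>i\<^sub>+\<^sub>k\<close> is \<open>x $ Inr i\<close>.
\<close>

type_synonym 'k heis = "(real ^ ('k + 'k)) \<times> real"

text \<open>
  On a finite-dimensional space, continuity of all directional derivatives is the same as
  continuity of the derivative as a map into linear forms.
\<close>

fun C_n :: "nat \<Rightarrow> ('a::euclidean_space \<Rightarrow> real) \<Rightarrow> bool" where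
  "C_n 0 f \<longleftrightarrow> continuous_on UNIV f"
| "C_n (Suc n) f \<longleftrightarrow>
     (\<forall>z. f differentiable (at z)) \<and> (\<forall>v. C_n n (\<lambda>z. frechet_derivative f (at z) v))"

text \<open>
  Elements of \<open>C\<^sub>c\<^sup>n(S)\<close> for open \<open>S\<close>, identified with their extensions by zero to the whole space.
\<close>

definition C_n_compact_support :: "nat \<Rightarrow> 'a::euclidean_space set \<Rightarrow> ('a \<Rightarrow> real) set" where
  "C_n_compact_support n S =
     {f. C_n n f \<and> compact (closure {z. f z \<noteq> 0}) \<and> closure {z. f z \<noteq> 0} \<subseteq> S}"

definition partial_x :: "'k + 'k \<Rightarrow> ('k::finite heis \<Rightarrow> real) \<Rightarrow> 'k heis \<Rightarrow> real" where
  "partial_x j f z = frechet_derivative f (at z) (axis j 1, 0)"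

definition partial_y :: "('k::finite heis \<Rightarrow> real) \<Rightarrow> 'k heis \<Rightarrow> real" where
  "partial_y f z = frechet_derivative f (at z) (0, 1)"

fun heis_X :: "'k + 'k \<Rightarrow> ('k::finite heis \<Rightarrow> real) \<Rightarrow> 'k heis \<Rightarrow> real" where
  "heis_X (Inl i) f z = partial_x (Inl i) f z + 2 * (fst z $ Inr i) * partial_y f z"
| "heis_X (Inr i) f z = partial_x (Inr i) f z - 2 * (fst z $ Inl i) * partial_y f z"

definition heis_laplacian :: "('k::finite heis \<Rightarrow> real) \<Rightarrow> 'k heis \<Rightarrow> real" where
  "heis_laplacian f z = (\<Sum>j\<in>UNIV. heis_X j (heis_X j f) z)"

definition cylindrical :: "('k::finite heis \<Rightarrow> real) \<Rightarrow> bool" where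
  "cylindrical u \<longleftrightarrow> (\<forall>x x' y. norm x = norm x' \<longrightarrow> u (x, y) = u (x', y))"

definition C2_solution :: "real \<Rightarrow> ('k::finite heis \<Rightarrow> real) \<Rightarrow> bool" where
  "C2_solution p u \<longleftrightarrow>
     C_n 2 u \<and> (\<forall>z. - heis_laplacian u z = \<bar>u z\<bar> powr (p - 1) * u z)"

definition stable_outside_compact :: "real \<Rightarrow> ('k::finite heis \<Rightarrow> real) \<Rightarrow> bool" where
  "stable_outside_compact p u \<longleftrightarrow>
     (\<exists>K. compact K \<and>
       (\<forall>\<phi> \<in> C_n_compact_support 1 (- K).
          (LINT z|lborel. (\<Sum>j\<in>UNIV. \<bar>heis_X j \<phi> z\<bar>\<^sup>2))
            \<ge> (LINT z|lborel. p * \<bar>u z\<bar> powr (p - 1) * (\<phi> z)\<^sup>2)))"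

definition p_S :: "nat \<Rightarrow> real" where
  "p_S N = (real N + 2) / (real N - 2)"

definition p_JL :: "nat \<Rightarrow> ereal" where
  "p_JL N = (if N \<le> 10 then \<infinity>
     else ereal (((real N - 2)\<^sup>2 - 4 * real N + 8 * sqrt (real N - 1))
                 / ((real N - 2) * (real N - 10))))"

end

theory Submission
  imports Defs
begin

text \<open>
  The Heisenberg Laplacian is homogeneous under the dilations \<open>(x, y) \<mapsto> (\<lambda> x, \<lambda>\<^sup>2 y)\<close>, whose homogeneous
  dimension is \<open>2k + 2\<close>. Let \<open>W = |x|\<^sup>4 + y\<^sup>2\<close> and let \<open>v = W\<^bsup>1/(2(p-1))\<^esup> u\<close>, which is scale invariant.
  Stability outside a compact set, tested as in Farina's work with a power of \<open>u\<close> and a cut-off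
  varying slowly on the logarithmic scale, bounds a power of \<open>v\<close> uniformly on the annuli \<open>T \<le> ln W \<le> 2T\<close>, so that by interpolation the
  energy is \<open>o(T)\<close> there. A plateau whose slopes have length \<open>T\<close> then makes the boundary terms vanish,
  near the origin because \<open>u\<close> is regular there. In the subcritical case they are the boundary terms of the
  Pohozaev identity, which forces \<open>u = 0\<close>. In the supercritical case they are those of an energy that is
  monotone along dilations, hence \<open>u\<close> is homogeneous of negative degree and, being continuous at the
  origin, zero.
\<close>

section \<open>Functions of class \<open>C\<^sup>1\<close> and integration by parts\<close>

text \<open>Instead of passing to a blow-down limit and classifying homogeneous solutions, each
  integral identity is tested once with a cut-off reaching from the origin to infinity. No limit and
  no pointwise decay is needed; only the slopes of the cut-off have to be controlled. The obstacle
  is that the exponent \<open>\<gamma> = k (p - 1) - 1\<close> used for supercritical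
  \<open>p\<close> is the one for which \<open>|u|^(p + \<gamma>)\<close> times Lebesgue measure is
  dilation invariant. Cut-offs between scales of fixed ratio would leave errors of order one. In the
  variable \<open>ln W\<close> a cut-off of width \<open>T\<close> has slope \<open>1/T\<close>,
  while its annulus has invariant measure of order \<open>T\<close>; so the mass stays bounded in
  \<open>T\<close>, which is negligible against \<open>T\<close>. What Farina's test demands of this
  exponent is what \<open>p < p_JL\<close> provides. At \<open>p = p_S\<close> both mechanisms stop:
  the constant in front of the potential in the Pohozaev identity and the exponent
  \<open>\<sigma>\<close> of the monotone energy vanish there. The square in that energy carries the
  weight \<open>xsq / W\<close>, so homogeneity is obtained only off the axis \<open>x = 0\<close>,
  and continuity covers the axis.\<close>

abbreviation D :: "('a::euclidean_space \<Rightarrow> real) \<Rightarrow> 'a \<Rightarrow> 'a \<Rightarrow> real" where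
  "D f z \<equiv> frechet_derivative f (at z)"

abbreviation C1 :: "('a::euclidean_space \<Rightarrow> real) \<Rightarrow> bool" where
  "C1 \<equiv> C_n (Suc 0)"

lemma C1_iff: "C1 f \<longleftrightarrow>
    (\<forall>z. f differentiable (at z)) \<and> (\<forall>v. continuous_on UNIV (\<lambda>z. D f z v))"
  by simp

declare C_n.simps [simp del]

lemma C1_D: "C1 f \<Longrightarrow> (f has_derivative D f z) (at z)"
  by (simp add: C1_iff frechet_derivative_works[symmetric])

lemma C1_continuous: "C1 f \<Longrightarrow> continuous_on S f"
  by (meson C1_D has_derivative_continuous continuous_at_imp_continuous_on)

lemma C1_D_continuous: "C1 f \<Longrightarrow> continuous_on S (\<lambda>z. D f z v)"
  using continuous_on_subset[of UNIV "\<lambda>z. D f z v" S] by (simp add: C1_iff)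

text \<open>\<open>C_n\<close> gives continuity of the derivative only for each fixed direction;
  expanding in \<open>Basis\<close> transfers it to directions that vary with the point, such as the
  fields of the Heisenberg group.\<close>

lemma D_Basis:
  assumes "C1 f"
  shows "D f z v = (\<Sum>b\<in>Basis. (v \<bullet> b) * D f z b)"
proof -
  have "linear (D f z)"
    using assms C1_iff linear_frechet_derivative by blast
  then show ?thesis
    by (subst (1) euclidean_representation[symmetric]) (simp add: linear_sum linear_cmul)
qed

lemma C1_D_continuous':
  assumes "C1 f" "continuous_on UNIV V"
  shows "continuous_on UNIV (\<lambda>z. D f z (V z))"
proof -
  have "D f z (V z) = (\<Sum>b\<in>Basis. (V z \<bullet> b) * D f z b)" for z
    by (rule D_Basis[OF assms(1)])
  then show ?thesis
    using assms by (auto intro!: continuous_intros C1_D_continuous)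
qed

lemma C1I:
  assumes "\<And>z. (f has_derivative f' z) (at z)" "\<And>v. continuous_on UNIV (\<lambda>z. f' z v)"
  shows "C1 f" "D f z v = f' z v"
proof -
  have *: "D f z = f' z" for z
    using frechet_derivative_at[OF assms(1)] by simp
  then show "D f z v = f' z v"
    by simp
  show "C1 f"
    using assms unfolding C1_iff * by (auto simp: differentiable_def)
qed

lemma C1_mult:
  assumes "C1 f" "C1 g"
  shows "C1 (\<lambda>z. f z * g z)" "D (\<lambda>z. f z * g z) z v = f z * D g z v + D f z v * g z"
proof -
  have *: "((\<lambda>z. f z * g z) has_derivative (\<lambda>v. f z * D g z v + D f z v * g z)) (at z)" for z
    by (intro has_derivative_mult C1_D assms)
  have "continuous_on UNIV (\<lambda>z. f z * D g z v + D f z v * g z)" for v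
    by (intro continuous_intros C1_continuous C1_D_continuous assms)
  from C1I[OF * this] show "C1 (\<lambda>z. f z * g z)" 
    "D (\<lambda>z. f z * g z) z v = f z * D g z v + D f z v * g z" by auto
qed

lemma C1_add:
  assumes "C1 f" "C1 g"
  shows "C1 (\<lambda>z. f z + g z)" "D (\<lambda>z. f z + g z) z v = D f z v + D g z v"
proof -
  have *: "((\<lambda>z. f z + g z) has_derivative (\<lambda>v. D f z v + D g z v)) (at z)" for z
    by (intro has_derivative_add C1_D assms)
  have "continuous_on UNIV (\<lambda>z. D f z v + D g z v)" for v
    by (intro continuous_intros C1_D_continuous assms)
  from C1I[OF * this] show "C1 (\<lambda>z. f z + g z)" 
    "D (\<lambda>z. f z + g z) z v = D f z v + D g z v" by auto
qed

lemma C1_linear: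
  assumes "bounded_linear f"
  shows "C1 f" "D f z v = f v"
  using C1I[of f "\<lambda>_. f"] assms by (auto intro: bounded_linear_imp_has_derivative)

lemma C1_const: "C1 (\<lambda>z. c)" "D (\<lambda>z. c) z v = 0"
  by (auto simp: C1_iff)

lemma C1_sum:
  assumes "finite I" "\<And>i. i \<in> I \<Longrightarrow> C1 (f i)"
  shows "C1 (\<lambda>z. \<Sum>i\<in>I. f i z) \<and> D (\<lambda>z. \<Sum>i\<in>I. f i z) z v = (\<Sum>i\<in>I. D (f i) z v)"
  using assms
proof (induction I rule: finite_induct)
  case empty
  then show ?case using C1_const[of 0] by simp
next
  case (insert x F)
  then show ?case using C1_add[of "f x" "\<lambda>z. \<Sum>i\<in>F. f i z"] by simp
qed

lemma C1_chain:
  assumes "C1 f" "\<And>x. (g has_real_derivative g' x) (at x)" "continuous_on UNIV g'"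
  shows "C1 (\<lambda>z. g (f z))" "D (\<lambda>z. g (f z)) z v = g' (f z) * D f z v"
proof -
  have *: "((\<lambda>z. g (f z)) has_derivative (\<lambda>v. g' (f z) * D f z v)) (at z)" for z
    using has_derivative_compose[OF C1_D[OF assms(1)] has_field_derivative_imp_has_derivative[OF assms(2)]]
    by simp
  have "continuous_on UNIV (\<lambda>z. g' (f z) * D f z v)" for v
    by (intro continuous_intros C1_D_continuous assms continuous_on_compose2[OF assms(3)] C1_continuous) auto
  from C1I[OF * this] show "C1 (\<lambda>z. g (f z))" "D (\<lambda>z. g (f z)) z v = g' (f z) * D f z v" by auto
qed

lemma D_linear:
  assumes "C1 f"
  shows "D f z (v + w) = D f z v + D f z w" "D f z (c *\<^sub>R v) = c * D f z v" "D f z 0 = 0"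
  using C1_D[OF assms, of z] has_derivative_bounded_linear
  by (auto simp: linear_simps dest!: has_derivative_bounded_linear)

lemma D_zero_outside:
  assumes "open S" "\<And>z. z \<in> S \<Longrightarrow> f z = 0" "z \<in> S"
  shows "D f z v = 0"
proof -
  have "(f has_derivative (\<lambda>_. 0)) (at z)"
    by (rule has_derivative_transform_within_open[OF has_derivative_const assms(1,3)]) (use assms in auto)
  then show ?thesis by (metis frechet_derivative_at)
qed

lemma DERIV_line:
  assumes "C1 f"
  shows "((\<lambda>t. f (a + t *\<^sub>R v)) has_real_derivative D f (a + t *\<^sub>R v) v) (at t)"
proof -
  have "((\<lambda>t. f (a + t *\<^sub>R v)) has_derivative (\<lambda>h. D f (a + t *\<^sub>R v) (h *\<^sub>R v))) (at t)"
    by (rule has_derivative_compose[OF _ C1_D[OF assms]]) (auto intro!: derivative_eq_intros)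
  then show ?thesis
    by (simp add: has_field_derivative_def D_linear(2)[OF assms] mult.commute[of _ "D f _ v"])
qed

section \<open>Second derivatives\<close>

lemma C2_D: "C_n 2 u \<Longrightarrow> C1 (\<lambda>z. D u z v)"
  by (simp add: numeral_2_eq_2 C_n.simps(2)[of "Suc 0"])

lemma C2_C1:
  assumes "C_n 2 u"
  shows "C1 u"
  using C1_continuous[OF C2_D[OF assms]] assms
  unfolding C1_iff by (simp add: numeral_2_eq_2 C_n.simps(2)[of "Suc 0"])

text \<open>The second difference \<open>\<Delta>\<close> is symmetric in \<open>v\<close> and
  \<open>w\<close>. Two mean value steps write it as \<open>s^2\<close> times a mixed derivative at
  a nearby point, and continuity identifies the limit of the quotient; taking the steps in either
  order gives both mixed derivatives.\<close>

lemma D_symmetric_dir: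
  assumes "C_n 2 u"
  shows "D (\<lambda>z. D u z v) z w = D (\<lambda>z. D u z w) z v"
proof -
  note u1 = C2_D[OF assms]
  define \<Delta> where "\<Delta> s = u (z + s *\<^sub>R v + s *\<^sub>R w) - u (z + s *\<^sub>R v) - u (z + s *\<^sub>R w) + u z" for s
  have key: "\<exists>\<xi> \<eta>. 0 < \<xi> \<and> \<xi> < s \<and> 0 < \<eta> \<and> \<eta> < s \<and>
      u (z + s *\<^sub>R v + s *\<^sub>R w) - u (z + s *\<^sub>R v) - u (z + s *\<^sub>R w) + u z
        = s\<^sup>2 * D (\<lambda>z. D u z v) (z + \<xi> *\<^sub>R v + \<eta> *\<^sub>R w) w" if s: "s > 0" for s v w
  proof -
    define a where "a \<tau> = u (z + s *\<^sub>R w + \<tau> *\<^sub>R v) - u (z + \<tau> *\<^sub>R v)" for \<tau>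
    have "(a has_real_derivative (D u (z + s *\<^sub>R w + \<tau> *\<^sub>R v) v - D u (z + \<tau> *\<^sub>R v) v)) (at \<tau>)" for \<tau>
      unfolding a_def by (intro DERIV_diff DERIV_line C2_C1[OF assms])
    then obtain \<xi> where \<xi>: "0 < \<xi>" "\<xi> < s"
      "a s - a 0 = (s - 0) * (D u (z + s *\<^sub>R w + \<xi> *\<^sub>R v) v - D u (z + \<xi> *\<^sub>R v) v)"
      using MVT2[of 0 s a "\<lambda>\<tau>. D u (z + s *\<^sub>R w + \<tau> *\<^sub>R v) v - D u (z + \<tau> *\<^sub>R v) v"] s by auto
    have "((\<lambda>\<tau>. D u (z + \<xi> *\<^sub>R v + \<tau> *\<^sub>R w) v) has_real_derivative
        (D (\<lambda>z. D u z v) (z + \<xi> *\<^sub>R v + \<tau> *\<^sub>R w) w)) (at \<tau>)" for \<tau>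
      by (rule DERIV_line[OF u1])
    then obtain \<eta> where \<eta>: "0 < \<eta>" "\<eta> < s"
      "D u (z + \<xi> *\<^sub>R v + s *\<^sub>R w) v - D u (z + \<xi> *\<^sub>R v + 0 *\<^sub>R w) v =
        (s - 0) * D (\<lambda>z. D u z v) (z + \<xi> *\<^sub>R v + \<eta> *\<^sub>R w) w"
      using MVT2[of 0 s "\<lambda>\<tau>. D u (z + \<xi> *\<^sub>R v + \<tau> *\<^sub>R w) v" 
         "\<lambda>\<tau>. D (\<lambda>z. D u z v) (z + \<xi> *\<^sub>R v + \<tau> *\<^sub>R w) w"] s by auto
    have "u (z + s *\<^sub>R v + s *\<^sub>R w) - u (z + s *\<^sub>R v) - u (z + s *\<^sub>R w) + u z = a s - a 0"
      by (simp add: a_def algebra_simps)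
    also have "\<dots> = s\<^sup>2 * D (\<lambda>z. D u z v) (z + \<xi> *\<^sub>R v + \<eta> *\<^sub>R w) w"
      using \<xi>(3) \<eta>(3) by (simp add: power2_eq_square add.commute add.left_commute)
    finally show ?thesis using \<xi> \<eta> by blast
  qed
  have lim: "((\<lambda>n. \<Delta> (1 / Suc n) / (1 / Suc n)\<^sup>2) \<longlonglongrightarrow> D (\<lambda>z. D u z v) z w)" 
    if \<Delta>: "\<And>s. \<Delta> s = u (z + s *\<^sub>R v + s *\<^sub>R w) - u (z + s *\<^sub>R v) - u (z + s *\<^sub>R w) + u z" for v w
  proof -
    obtain \<xi> \<eta> where x: "\<And>n::nat. 0 < \<xi> n \<and> \<xi> n < 1 / Suc n \<and> 0 < \<eta> n \<and> \<eta> n < 1 / Suc n \<and>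
       \<Delta> (1 / Suc n) = (1 / Suc n)\<^sup>2 * D (\<lambda>z. D u z v) (z + \<xi> n *\<^sub>R v + \<eta> n *\<^sub>R w) w"
      using key[of "1 / Suc n" v w for n] unfolding \<Delta>[symmetric] by (metis of_nat_0_less_iff zero_less_Suc zero_less_divide_1_iff)
    have z: "(\<lambda>n. 1 / real (Suc n)) \<longlonglongrightarrow> 0" using LIMSEQ_inverse_real_of_nat by (simp add: inverse_eq_divide)
    have "\<xi> \<longlonglongrightarrow> 0" "\<eta> \<longlonglongrightarrow> 0"
      by (rule tendsto_sandwich[OF _ _ tendsto_const z]; use x in \<open>force intro: always_eventually less_imp_le\<close>)+
    then have "(\<lambda>n. z + \<xi> n *\<^sub>R v + \<eta> n *\<^sub>R w) \<longlonglongrightarrow> z + 0 *\<^sub>R v + 0 *\<^sub>R w"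
      by (intro tendsto_intros)
    then have "(\<lambda>n. D (\<lambda>z. D u z v) (z + \<xi> n *\<^sub>R v + \<eta> n *\<^sub>R w) w) \<longlonglongrightarrow> D (\<lambda>z. D u z v) z w"
      using C1_D_continuous[OF u1, of UNIV v w] 
      by (auto simp: continuous_on_eq_continuous_at intro: isCont_tendsto_compose)
    moreover have "D (\<lambda>z. D u z v) (z + \<xi> n *\<^sub>R v + \<eta> n *\<^sub>R w) w = \<Delta> (1 / Suc n) / (1 / Suc n)\<^sup>2" for n
      using x[of n] by simp
    ultimately show ?thesis by simp
  qed
  show ?thesis
    by (rule LIMSEQ_unique[OF lim lim]) (simp_all add: \<Delta>_def algebra_simps)
qed

lemma C1_affine_inner:
  assumes "bounded_linear B"
  shows "C1 (\<lambda>z. (a + B z) \<bullet> b)" "D (\<lambda>z. (a + B z) \<bullet> b) z v = B v \<bullet> b"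
proof -
  have bl: "bounded_linear (\<lambda>z. B z \<bullet> b)"
    using bounded_linear_compose[OF bounded_linear_inner_left assms] by simp
  show "C1 (\<lambda>z. (a + B z) \<bullet> b)" "D (\<lambda>z. (a + B z) \<bullet> b) z v = B v \<bullet> b"
    using C1_add[OF C1_const(1)[of "a \<bullet> b"] C1_linear(1)[OF bl]]
    by (simp_all add: inner_add_left C1_const C1_linear(2)[OF bl])
qed

text \<open>\<open>Xvec j\<close> and \<open>Zvec\<close> are both affine in the point, so one
  product rule serves them: the second derivative acts with the field frozen at \<open>z\<close>,
  and the variation of the field contributes \<open>D u z (B v)\<close>.\<close>

lemma C1_D_affine:
  fixes u :: "'a::euclidean_space \<Rightarrow> real"
  assumes u: "C_n 2 u" and B: "bounded_linear B"
  shows "C1 (\<lambda>z. D u z (a + B z))"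
    and "D (\<lambda>z. D u z (a + B z)) z v = D (\<lambda>z'. D u z' (a + B z)) z v + D u z (B v)"
proof -
  note expand = D_Basis[OF C2_C1[OF u]]
  have *: "C1 (\<lambda>z. D u z (a + B z)) \<and> D (\<lambda>z. D u z (a + B z)) z v
      = (\<Sum>b\<in>Basis. ((a + B z) \<bullet> b) * D (\<lambda>z. D u z b) z v + (B v \<bullet> b) * D u z b)"
    if B: "bounded_linear B" for a z v and B :: "'a \<Rightarrow> 'a"
    unfolding expand[of _ "a + B _"]
    using C1_sum[of Basis "\<lambda>b z. ((a + B z) \<bullet> b) * D u z b" z v]
      C1_mult[OF C1_affine_inner(1)[OF B] C2_D[OF u]]
    by (simp_all add: C1_affine_inner(2)[OF B])
  show "C1 (\<lambda>z. D u z (a + B z))" using *[OF B] by blast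
  show "D (\<lambda>z. D u z (a + B z)) z v = D (\<lambda>z'. D u z' (a + B z)) z v + D u z (B v)"
    using *[OF B] *[OF bounded_linear_zero, of "a + B z" z v]
    by (simp add: expand[of z "B v"] sum.distrib)
qed

section \<open>The divergence theorem for compactly supported functions\<close>

lemma integrable_compact_support:
  fixes f :: "'a::euclidean_space \<Rightarrow> real"
  assumes "continuous_on UNIV f" "compact K" "\<And>z. z \<notin> K \<Longrightarrow> f z = 0"
  shows "integrable lborel f"
proof -
  have "integrable lborel (\<lambda>x. indicator K x *\<^sub>R f x)"
    by (rule borel_integrable_compact) (use assms continuous_on_subset[of UNIV f K] in auto)
  also have "(\<lambda>x. indicator K x *\<^sub>R f x) = f"
  proof
    fix x
    show "indicator K x *\<^sub>R f x = f x" by (cases "x \<in> K") (use assms(3) in auto)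
  qed
  finally show ?thesis .
qed

lemma D_zero_outside_compact:
  assumes "compact K" "\<And>z. z \<notin> K \<Longrightarrow> f z = 0" "z \<notin> K"
  shows "D f z v = 0"
  by (rule D_zero_outside[of "- K"]) (use assms compact_imp_closed in \<open>auto simp: open_Compl\<close>)

lemma integral_translate:
  fixes f :: "'a::euclidean_space \<Rightarrow> real"
  assumes "f \<in> borel_measurable borel"
  shows "(LINT z|lborel. f (a + z)) = (LINT z|lborel. f z)"
proof -
  have "(LINT z|lborel. f z) = (LINT z|distr lborel borel ((+) a). f z)"
    by (simp add: lborel_distr_plus)
  also have "\<dots> = (LINT z|lborel. f (a + z))"
    by (rule integral_distr) (use assms in auto)
  finally show ?thesis by simp
qed

text \<open>Translation invariance of Lebesgue measure makes every difference quotient integrate to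
  zero, and dominated convergence passes this on to the derivative.\<close>

lemma integral_D_eq_0:
  fixes f :: "'a::euclidean_space \<Rightarrow> real"
  assumes f: "C1 f" and K: "compact K" and supp: "\<And>z. z \<notin> K \<Longrightarrow> f z = 0"
  shows "(LINT z|lborel. D f z v) = 0"
proof -
  obtain r where r: "r > 0" "\<And>z. z \<in> K \<Longrightarrow> norm z \<le> r"
    using K compact_imp_bounded bounded_pos by metis
  \<comment> \<open>The increments have length at most \<open>norm v\<close>, so a single ball of
    this radius contains the supports of all quotients \<open>q n\<close>.\<close>
  define R where "R = r + norm v"
  have D0: "D f z v = 0" if "z \<notin> K" for z
    using D_zero_outside_compact[OF K supp that] .
  have "compact ((\<lambda>z. D f z v) ` cball 0 R)"
    by (intro compact_continuous_image C1_D_continuous f) auto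
  then have "bounded ((\<lambda>z. D f z v) ` cball 0 R)"
    by (rule compact_imp_bounded)
  then obtain B where "B > 0" "\<forall>x\<in>(\<lambda>z. D f z v) ` cball 0 R. norm x \<le> B"
    unfolding bounded_pos by blast
  then have B: "B > 0" "\<And>z. z \<in> cball 0 R \<Longrightarrow> \<bar>D f z v\<bar> \<le> B"
    unfolding ball_simps(9) real_norm_def by blast+
  have B': "\<bar>D f z v\<bar> \<le> B" for z
  proof (cases "z \<in> cball 0 R")
    case False
    then have "norm z > r + norm v" by (simp add: R_def)
    then have "norm z > r" using norm_ge_zero[of v] by linarith
    then have "z \<notin> K" using r(2)[of z] by linarith
    then show ?thesis using D0 B by simp
  qed (use B in auto)
  define q where "q n z = (f (z + (1 / Suc n) *\<^sub>R v) - f z) * Suc n" for n :: nat and z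
  have cont: "continuous_on UNIV f" using C1_continuous[OF f] .
  then have meas: "f \<in> borel_measurable borel" by (simp add: borel_measurable_continuous_onI)
  have lim: "(\<lambda>n. q n z) \<longlonglongrightarrow> D f z v" for z
  proof -
    have "((\<lambda>h. (f (z + h *\<^sub>R v) - f z) / h) \<longlongrightarrow> D f z v) (at 0)"
      using DERIV_line[OF f, of z v 0] by (simp add: DERIV_def)
    moreover have "filterlim (\<lambda>n. 1 / real (Suc n)) (at 0) sequentially"
      using LIMSEQ_inverse_real_of_nat by (auto simp: filterlim_at inverse_eq_divide)
    ultimately have "((\<lambda>n. (f (z + (1 / Suc n) *\<^sub>R v) - f z) / (1 / Suc n)) \<longlonglongrightarrow> D f z v)"
      by (rule filterlim_compose)
    then show ?thesis by (simp add: q_def)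
  qed
  have bound: "\<bar>q n z\<bar> \<le> B * indicator (cball 0 R) z" for n z
  proof (cases "z \<in> cball 0 R")
    case True
    obtain \<xi> where "f (z + (1 / Suc n) *\<^sub>R v) - f (z + 0 *\<^sub>R v) = (1 / Suc n - 0) * D f (z + \<xi> *\<^sub>R v) v"
      using MVT2[of 0 "1 / Suc n" "\<lambda>t. f (z + t *\<^sub>R v)" "\<lambda>t. D f (z + t *\<^sub>R v) v"] DERIV_line[OF f] by auto
    then have "q n z = D f (z + \<xi> *\<^sub>R v) v" by (simp add: q_def)
    then show ?thesis using B' True by simp
  next
    case False
    have "norm ((1 / Suc n) *\<^sub>R v) \<le> norm v"
      by (simp add: divide_le_eq mult_le_cancel_left1)
    moreover have "norm z > r + norm v" using False by (simp add: R_def)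
    ultimately have "norm (z + (1 / Suc n) *\<^sub>R v) > r" "norm z > r"
      using norm_diff_ineq[of z "(1 / Suc n) *\<^sub>R v"] norm_ge_zero[of v] by linarith+
    then have "z + (1 / Suc n) *\<^sub>R v \<notin> K" "z \<notin> K"
      using r(2) by (metis not_le)+
    then show ?thesis using False supp by (simp add: q_def)
  qed
  have int_f: "integrable lborel (\<lambda>z. f (a + z))" for a
  proof (rule integrable_compact_support)
    show "compact ((\<lambda>z. z - a) ` K)" using K by (simp add: compact_translation_subtract)
    show "f (a + z) = 0" if "z \<notin> (\<lambda>z. z - a) ` K" for z
      using that supp[of "a + z"] by (metis add_diff_cancel_left' imageI)
  qed (auto intro!: continuous_intros continuous_on_compose2[OF cont])
  have "(\<lambda>n. (LINT z|lborel. q n z)) \<longlonglongrightarrow> (LINT z|lborel. D f z v)"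
  proof (rule integral_dominated_convergence)
    show "integrable lborel (\<lambda>z :: 'a. B * indicator (cball 0 R) z)"
      using emeasure_lborel_cball_finite[of "0 :: 'a" R]
      by (intro integrable_mult_right) (simp add: integrable_indicator_iff less_top)
    show "(\<lambda>z. D f z v) \<in> borel_measurable lborel"
      using borel_measurable_continuous_onI[OF C1_D_continuous[OF f]] by simp
    show "q n \<in> borel_measurable lborel" for n
      unfolding q_def using meas by measurable
  qed (use lim bound in auto)
  moreover have "(LINT z|lborel. q n z) = 0" for n
  proof -
    have "(LINT z|lborel. q n z) = ((LINT z|lborel. f ((1 / Suc n) *\<^sub>R v + z)) - (LINT z|lborel. f z)) * Suc n"
      unfolding q_def add.commute[of _ "(1 / Suc n) *\<^sub>R v"]
      using int_f[of "(1 / Suc n) *\<^sub>R v"] int_f[of 0] by simp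
    then show ?thesis by (simp add: integral_translate[OF meas])
  qed
  ultimately have "(\<lambda>n :: nat. 0) \<longlonglongrightarrow> (LINT z|lborel. D f z v)"
    by simp
  then show ?thesis by (simp add: LIMSEQ_const_iff)
qed

text \<open>The divergence of \<open>z \<mapsto> a + B z\<close> is the trace of \<open>B\<close>.\<close>

lemma integral_D_affine:
  fixes f :: "'a::euclidean_space \<Rightarrow> real"
  assumes f: "C1 f" and K: "compact K" and supp: "\<And>z. z \<notin> K \<Longrightarrow> f z = 0" and B: "bounded_linear B"
  shows "(LINT z|lborel. D f z (a + B z)) = - (\<Sum>b\<in>Basis. B b \<bullet> b) * (LINT z|lborel. f z)"
proof -
  note l = C1_affine_inner[OF B, where a = a]
  have fz: "D f z v = 0" if "z \<notin> K" for z v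
    using D_zero_outside_compact[OF K supp that] .
  have "D f z (a + B z) = (\<Sum>b\<in>Basis. D (\<lambda>z. ((a + B z) \<bullet> b) * f z) z b) - (\<Sum>b\<in>Basis. B b \<bullet> b) * f z" for z
  proof -
    have "D f z (a + B z) = (\<Sum>b\<in>Basis. ((a + B z) \<bullet> b) * D f z b)"
      by (rule D_Basis[OF f])
    then show ?thesis
      using C1_mult(2)[OF l(1) f] by (simp add: l(2) sum.distrib sum_distrib_right)
  qed
  then have "(LINT z|lborel. D f z (a + B z)) =
     (LINT z|lborel. (\<Sum>b\<in>Basis. D (\<lambda>z. ((a + B z) \<bullet> b) * f z) z b) - (\<Sum>b\<in>Basis. B b \<bullet> b) * f z)"
    by simp
  also have "\<dots> = (\<Sum>b\<in>Basis. (LINT z|lborel. D (\<lambda>z. ((a + B z) \<bullet> b) * f z) z b)) - (\<Sum>b\<in>Basis. B b \<bullet> b) * (LINT z|lborel. f z)"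
  proof -
    have i: "integrable lborel (\<lambda>z. D (\<lambda>z. ((a + B z) \<bullet> b) * f z) z b)" for b
      by (rule integrable_compact_support[OF C1_D_continuous[OF C1_mult(1)[OF l(1) f]] K])
         (use C1_mult(2)[OF l(1) f] supp fz in auto)
    have "integrable lborel f"
      by (rule integrable_compact_support[OF _ K supp]) (use f C1_continuous in auto)
    then show ?thesis using i by simp
  qed
  also have "(\<Sum>b\<in>Basis. (LINT z|lborel. D (\<lambda>z. ((a + B z) \<bullet> b) * f z) z b)) = 0"
    by (intro sum.neutral ballI integral_D_eq_0[OF _ K]) (use C1_mult[OF l(1) f] supp in auto)
  finally show ?thesis by simp
qed

section \<open>Vector fields, dilations and the Koranyi gauge\<close>

fun heis_sign :: "'k + 'k \<Rightarrow> real" where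
  "heis_sign (Inl i) = 1"
| "heis_sign (Inr i) = - 1"

fun heis_swap :: "'k + 'k \<Rightarrow> 'k + 'k" where
  "heis_swap (Inl i) = Inr i"
| "heis_swap (Inr i) = Inl i"

lemma heis_swap_swap [simp]: "heis_swap (heis_swap j) = j" by (cases j) auto
lemma heis_sign_swap [simp]: "heis_sign (heis_swap j) = - heis_sign j" by (cases j) auto
lemma heis_sign_sq [simp]: "heis_sign j * heis_sign j = 1" by (cases j) auto

lemma sum_heis_swap: "(\<Sum>j\<in>UNIV. f (heis_swap j)) = (\<Sum>j\<in>UNIV. f (j :: 'k::finite + 'k) :: real)"
  by (rule sum.reindex_bij_witness[of _ heis_swap heis_swap]) auto

text \<open>
  \<open>X\<^sub>j\<close> is differentiation along \<open>Xvec j\<close>; \<open>Zvec\<close> generates the dilations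
  \<open>(x, y) \<mapsto> (\<lambda> x, \<lambda>\<^sup>2 y)\<close>, whose Jacobian \<open>\<lambda>\<^bsup>2k+2\<^esup>\<close> gives the homogeneous dimension.
\<close>

definition Xvec :: "'k + 'k \<Rightarrow> 'k::finite heis \<Rightarrow> 'k heis" where
  "Xvec j z = (axis j 1, 2 * heis_sign j * fst z $ heis_swap j)"

definition Zvec :: "'k::finite heis \<Rightarrow> 'k heis" where
  "Zvec z = (fst z, 2 * snd z)"

definition dil :: "('k::finite heis \<Rightarrow> real) \<Rightarrow> 'k heis \<Rightarrow> real" where
  "dil f z = D f z (Zvec z)"

definition hdot :: "('k::finite heis \<Rightarrow> real) \<Rightarrow> ('k heis \<Rightarrow> real) \<Rightarrow> 'k heis \<Rightarrow> real" where
  "hdot f g z = (\<Sum>j\<in>UNIV. heis_X j f z * heis_X j g z)"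

abbreviation hsq :: "('k::finite heis \<Rightarrow> real) \<Rightarrow> 'k heis \<Rightarrow> real" where
  "hsq f \<equiv> hdot f f"

definition xsq :: "'k::finite heis \<Rightarrow> real" where
  "xsq z = fst z \<bullet> fst z"

text \<open>The fourth power of the Koranyi gauge.\<close>

definition W :: "'k::finite heis \<Rightarrow> real" where
  "W z = (xsq z)\<^sup>2 + (snd z)\<^sup>2"

abbreviation hom_dim :: "'k::finite itself \<Rightarrow> real" where
  "hom_dim k \<equiv> 2 * real CARD('k) + 2"

lemma Xvec_split: "Xvec j z = (axis j 1, 0) + (2 * heis_sign j * (fst z $ heis_swap j)) *\<^sub>R (0, 1)"
  by (simp add: Xvec_def)

lemma heis_X_eq:
  assumes "C1 f"
  shows "heis_X j f z = D f z (Xvec j z)"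
    and "heis_X j f z = D f z (axis j 1, 0) + 2 * heis_sign j * (fst z $ heis_swap j) * D f z (0, 1)"
proof -
  show "heis_X j f z = D f z (axis j 1, 0) + 2 * heis_sign j * (fst z $ heis_swap j) * D f z (0, 1)"
    by (cases j) (auto simp: partial_x_def partial_y_def)
  then show "heis_X j f z = D f z (Xvec j z)"
    unfolding Xvec_split D_linear(1)[OF assms] D_linear(2)[OF assms] by simp
qed

lemma continuous_Zvec: "continuous_on UNIV Zvec"
  unfolding Zvec_def by (intro continuous_intros)

lemma continuous_Xvec: "continuous_on UNIV (Xvec j)"
  unfolding Xvec_def by (intro continuous_intros)

lemma continuous_dil: "C1 f \<Longrightarrow> continuous_on UNIV (dil f)"
  unfolding dil_def by (intro C1_D_continuous' continuous_Zvec)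

lemma continuous_heis_X: "C1 f \<Longrightarrow> continuous_on UNIV (heis_X j f)"
  using C1_D_continuous'[OF _ continuous_Xvec[of j], of f] by (simp add: heis_X_eq(1))

lemma continuous_hdot: "C1 f \<Longrightarrow> C1 g \<Longrightarrow> continuous_on UNIV (hdot f g)"
  unfolding hdot_def by (intro continuous_intros continuous_heis_X)

text \<open>The \<open>x\<close>-component of \<open>Xvec j\<close> is constant and its
  \<open>y\<close>-component depends on \<open>x\<close> alone, so the linear part has trace zero:
  the field is divergence free.\<close>

lemma integral_heis_X:
  assumes f: "C1 f" and K: "compact K" and supp: "\<And>z. z \<notin> K \<Longrightarrow> f z = 0"
  shows "(LINT z|lborel. heis_X j f z) = 0"
proof -
  define B :: "'a heis \<Rightarrow> 'a heis" where "B z = (0, 2 * heis_sign j * (fst z $ heis_swap j))" for z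
  have B: "bounded_linear B"
    unfolding B_def
    by (intro bounded_linear_Pair bounded_linear_const_mult bounded_linear_zero
        bounded_linear_compose[OF bounded_linear_vec_nth bounded_linear_fst])
  have "Xvec j z = (axis j 1, 0) + B z" for z
    by (simp add: Xvec_def B_def)
  then have "(LINT z|lborel. heis_X j f z) = - (\<Sum>b\<in>Basis. B b \<bullet> b) * (LINT z|lborel. f z)"
    using integral_D_affine[OF f K supp B, of "(axis j 1, 0)"] by (simp add: heis_X_eq(1)[OF f])
  also have "(\<Sum>b\<in>Basis. B b \<bullet> b) = 0"
    by (rule sum.neutral) (auto simp: Basis_prod_def B_def)
  finally show ?thesis by simp
qed

lemma integral_dil:
  fixes f :: "'k::finite heis \<Rightarrow> real"
  assumes f: "C1 f" and K: "compact K" and supp: "\<And>z. z \<notin> K \<Longrightarrow> f z = 0"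
  shows "(LINT z|lborel. dil f z) = - hom_dim TYPE('k) * (LINT z|lborel. f z)"
proof -
  have B: "bounded_linear (Zvec :: 'k heis \<Rightarrow> 'k heis)"
    unfolding Zvec_def
    by (intro bounded_linear_Pair bounded_linear_const_mult bounded_linear_fst bounded_linear_snd)
  have "(LINT z|lborel. dil f z) = - (\<Sum>b\<in>Basis. Zvec b \<bullet> (b :: 'k heis)) * (LINT z|lborel. f z)"
    using integral_D_affine[OF f K supp B, of 0] by (simp add: dil_def)
  also have "(\<Sum>b\<in>Basis. Zvec b \<bullet> (b :: 'k heis)) = hom_dim TYPE('k)"
  proof -
    have "(\<Sum>b\<in>Basis. Zvec b \<bullet> (b :: 'k heis)) =
        (\<Sum>b\<in>(\<lambda>u. (u, 0)) ` (Basis :: (real ^ ('k + 'k)) set). Zvec b \<bullet> (b :: 'k heis)) +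
        (\<Sum>b\<in>(\<lambda>u. (0, u)) ` (Basis :: real set). Zvec b \<bullet> (b :: 'k heis))"
      unfolding Basis_prod_def by (rule sum.union_disjoint) auto
    also have "(\<Sum>b\<in>(\<lambda>u. (u, 0)) ` (Basis :: (real ^ ('k + 'k)) set). Zvec b \<bullet> (b :: 'k heis)) = 
        (\<Sum>b\<in>(Basis :: (real ^ ('k + 'k)) set). 1)"
      by (subst sum.reindex) (auto simp: inj_on_def Zvec_def)
    also have "\<dots> = 2 * real CARD('k)"
      using DIM_cart[where 'a=real and 'b="'k + 'k"] by (simp add: card_UNIV_sum)
    finally show ?thesis by (simp add: Zvec_def)
  qed
  finally show ?thesis by simp
qed

lemma heis_X_mult:
  "C1 f \<Longrightarrow> C1 g \<Longrightarrow> heis_X j (\<lambda>z. f z * g z) z = f z * heis_X j g z + heis_X j f z * g z"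
  by (simp add: heis_X_eq(1) C1_mult)

lemma dil_mult:
  "C1 f \<Longrightarrow> C1 g \<Longrightarrow> dil (\<lambda>z. f z * g z) z = f z * dil g z + dil f z * g z"
  by (simp add: dil_def C1_mult)

lemma hdot_mult_right:
  assumes "C1 f" "C1 g"
  shows "hdot u (\<lambda>z. f z * g z) z = f z * hdot u g z + hdot u f z * g z"
  using assms by (simp add: hdot_def heis_X_mult sum.distrib sum_distrib_left sum_distrib_right algebra_simps)

section \<open>Explicit derivatives of the gauge\<close>

lemma C1_xsq:
  fixes z v :: "'a::finite heis"
  shows "C1 (xsq :: 'a heis \<Rightarrow> real)" and "D xsq z v = 2 * (fst z \<bullet> fst v)"
proof -
  have "(xsq has_derivative (\<lambda>v. 2 * (fst z \<bullet> fst v))) (at z)" for z :: "'a heis"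
    unfolding xsq_def by (auto intro!: derivative_eq_intros simp: inner_commute)
  from C1I[OF this] show "C1 (xsq :: 'a heis \<Rightarrow> real)" "D xsq z v = 2 * (fst z \<bullet> fst v)"
    by (simp_all add: continuous_intros)
qed

lemma C1_W:
  fixes z v :: "'a::finite heis"
  shows "C1 (W :: 'a heis \<Rightarrow> real)" and "D W z v = 4 * xsq z * (fst z \<bullet> fst v) + 2 * snd z * snd v"
proof -
  have "(W has_derivative (\<lambda>v. 4 * xsq z * (fst z \<bullet> fst v) + 2 * snd z * snd v)) (at z)" for z :: "'a heis"
    unfolding W_def xsq_def by (auto intro!: derivative_eq_intros simp: inner_commute algebra_simps)
  from C1I[OF this] show "C1 (W :: 'a heis \<Rightarrow> real)" "D W z v = 4 * xsq z * (fst z \<bullet> fst v) + 2 * snd z * snd v"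
    by (simp_all add: continuous_intros xsq_def)
qed

lemma dil_W: "dil W z = 4 * W z"
  by (simp add: dil_def C1_W Zvec_def W_def xsq_def power2_eq_square)

lemma dil_xsq: "dil xsq z = 2 * xsq z"
  by (simp add: dil_def C1_xsq Zvec_def xsq_def)

lemma xsq_nonneg [simp]: "xsq z \<ge> 0" by (simp add: xsq_def)
lemma W_nonneg [simp]: "W z \<ge> 0" by (simp add: W_def)

lemma W_eq_0_iff [simp]: "W z = 0 \<longleftrightarrow> z = 0"
  by (cases z) (simp add: W_def xsq_def sum_power2_eq_zero_iff zero_prod_def)

lemma xsq_le: "xsq z \<le> sqrt (W z)"
  by (rule real_le_rsqrt) (simp add: W_def)

lemma xsq_sum: "xsq z = (\<Sum>j\<in>UNIV. (fst z $ j)\<^sup>2)"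
  by (simp add: xsq_def inner_vec_def power2_eq_square)

lemma heis_X_W: "heis_X j W z = 4 * xsq z * (fst z $ j) + 4 * snd z * heis_sign j * (fst z $ heis_swap j)"
  by (simp add: heis_X_eq(1) C1_W Xvec_def inner_axis)

text \<open>Swapping the two halves of the coordinates flips the sign of every term, so the sum is
  its own negative. This removes the mixed terms between the \<open>x\<close> part and the
  \<open>y\<close> part of the gradient of \<open>W\<close>.\<close>

lemma sum_cross: "(\<Sum>j\<in>UNIV. heis_sign j * (x $ j) * (x $ heis_swap j)) = (0 :: real)" for x :: "real ^ ('k::finite + 'k)"
  using sum_heis_swap[of "\<lambda>j. heis_sign j * (x $ j) * (x $ heis_swap j)"]
  by (simp add: sum_negf mult.commute mult.left_commute)

lemma hsq_W: "hsq W z = 16 * xsq z * W z"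
proof -
  have "hsq W z = (\<Sum>j\<in>UNIV. 16 * (xsq z)\<^sup>2 * (fst z $ j)\<^sup>2 + 16 * (snd z)\<^sup>2 * (fst z $ heis_swap j)\<^sup>2
       + 32 * xsq z * snd z * (heis_sign j * (fst z $ j) * (fst z $ heis_swap j)))"
    unfolding hdot_def heis_X_W
  proof (rule sum.cong[OF refl])
    fix j :: "'a + 'a"
    have "heis_sign j * (heis_sign j * a) = a" for a by (metis mult.assoc mult_1 heis_sign_sq)
    then show "(4 * xsq z * fst z $ j + 4 * snd z * heis_sign j * fst z $ heis_swap j) *
         (4 * xsq z * fst z $ j + 4 * snd z * heis_sign j * fst z $ heis_swap j) =
         16 * (xsq z)\<^sup>2 * (fst z $ j)\<^sup>2 + 16 * (snd z)\<^sup>2 * (fst z $ heis_swap j)\<^sup>2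
         + 32 * xsq z * snd z * (heis_sign j * (fst z $ j) * (fst z $ heis_swap j))"
      by (simp add: algebra_simps power2_eq_square)
  qed
  also have "\<dots> = 16 * (xsq z)\<^sup>2 * xsq z + 16 * (snd z)\<^sup>2 * xsq z"
    using sum_heis_swap[of "\<lambda>j. (fst z $ j)\<^sup>2"]
    by (simp add: sum.distrib sum_distrib_left[symmetric] sum_cross xsq_sum)
  finally show ?thesis by (simp add: W_def algebra_simps)
qed

text \<open>Rotating \<open>x\<close> towards an orthogonal \<open>w\<close> of equal length keeps
  the norm, so the derivative along \<open>w\<close> vanishes; rescaling reaches every orthogonal
  \<open>w\<close>, and a general \<open>w\<close> differs from such a vector by its radial
  component. The factor \<open>x \<bullet> x\<close> avoids a division and covers
  \<open>x = 0\<close>.\<close>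

lemma cylindrical_D:
  fixes u :: "'k::finite heis \<Rightarrow> real"
  assumes u: "C1 u" "cylindrical u"
  shows "(x \<bullet> x) * D u (x, y) (w, 0) = (x \<bullet> w) * D u (x, y) (x, 0)"
proof (cases "x = 0")
  case True
  then show ?thesis by simp
next
  case x: False
  have orth: "D u (x, y) (w, 0) = 0" if w: "x \<bullet> w = 0" "norm w = norm x" for w
  proof -
    have "((\<lambda>t. (cos t *\<^sub>R x + sin t *\<^sub>R w, y)) has_derivative (\<lambda>h. (h *\<^sub>R w, 0))) (at 0)"
      by (auto intro!: derivative_eq_intros)
    from has_derivative_compose[OF this C1_D[OF u(1)]]
    have "((\<lambda>t. u (cos t *\<^sub>R x + sin t *\<^sub>R w, y)) has_derivative (\<lambda>h. D u (x, y) (h *\<^sub>R w, 0))) (at 0)"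
      by simp
    moreover have "u (cos t *\<^sub>R x + sin t *\<^sub>R w, y) = u (x, y)" for t
    proof -
      have "(norm (cos t *\<^sub>R x + sin t *\<^sub>R w))\<^sup>2 = (cos t)\<^sup>2 * (x \<bullet> x) + (sin t)\<^sup>2 * (w \<bullet> w)"
        using w(1) unfolding power2_norm_eq_inner
        by (simp add: inner_add_left inner_add_right inner_commute[of w x] power2_eq_square)
      also have "\<dots> = ((cos t)\<^sup>2 + (sin t)\<^sup>2) * (norm x)\<^sup>2"
        using w(2) by (simp only: dot_square_norm distrib_right)
      finally have "(norm (cos t *\<^sub>R x + sin t *\<^sub>R w))\<^sup>2 = (norm x)\<^sup>2"
        by simp
      then have "norm (cos t *\<^sub>R x + sin t *\<^sub>R w) = norm x"
        by (simp only: power2_eq_iff_nonneg norm_ge_zero)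
      then show ?thesis using u(2) unfolding cylindrical_def by blast
    qed
    ultimately have "((\<lambda>t::real. u (x, y)) has_derivative (\<lambda>h. D u (x, y) (h *\<^sub>R w, 0))) (at 0)"
      by simp
    then have "(\<lambda>h::real. D u (x, y) (h *\<^sub>R w, 0)) = (\<lambda>h. 0)"
      using has_derivative_const has_derivative_unique by blast
    then show ?thesis by (metis scaleR_one)
  qed
  have orth': "D u (x, y) (w, 0) = 0" if w: "x \<bullet> w = 0" for w
  proof (cases "w = 0")
    case True
    then show ?thesis using D_linear(3)[OF u(1)] by (simp add: zero_prod_def)
  next
    case False
    define c where "c = norm x / norm w"
    have "c * D u (x, y) (w, 0) = D u (x, y) (c *\<^sub>R w, 0)"
      using D_linear(2)[OF u(1), of "(x, y)" c "(w, 0)"] by simp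
    also have "\<dots> = 0"
      by (rule orth) (use w False in \<open>auto simp: c_def\<close>)
    finally show ?thesis using False x by (auto simp: c_def)
  qed
  define w' where "w' = (x \<bullet> x) *\<^sub>R w - (x \<bullet> w) *\<^sub>R x"
  have "x \<bullet> w' = 0" by (simp add: w'_def inner_diff_right inner_commute)
  then have "D u (x, y) (w', 0) = 0" by (rule orth')
  moreover have "((x \<bullet> x) *\<^sub>R (w, 0) :: 'k heis) = (w', 0) + (x \<bullet> w) *\<^sub>R (x, 0)"
    by (simp add: w'_def)
  ultimately show ?thesis
    using D_linear[OF u(1)] by (metis (no_types, lifting) add_0)
qed

text \<open>
  Cylindrical symmetry enters the proof only here: the horizontal gradient of \<open>u\<close> sees \<open>W\<close> through
  the dilation derivative alone.
\<close>

lemma hdot_W: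
  fixes u :: "'k::finite heis \<Rightarrow> real"
  assumes u: "C1 u" "cylindrical u"
  shows "hdot u W z = 4 * xsq z * dil u z"
proof (cases "xsq z = 0")
  case True
  then have "fst z = 0" by (simp add: xsq_def)
  then show ?thesis using True by (simp add: hdot_def heis_X_W)
next
  case False
  define uR where "uR = D u z (fst z, 0)"
  define uy where "uy = D u z (0, 1)"
  have Xj: "xsq z * heis_X j u z = fst z $ j * uR + 2 * xsq z * heis_sign j * (fst z $ heis_swap j) * uy" for j
    using cylindrical_D[OF u, of "fst z" "snd z" "axis j 1"]
    by (simp add: heis_X_eq(2)[OF u(1)] uR_def uy_def xsq_def inner_axis algebra_simps)
  have "Zvec z = (fst z, 0) + (2 * snd z) *\<^sub>R (0, 1)"
    by (simp add: Zvec_def)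
  then have Z: "dil u z = uR + 2 * snd z * uy"
    unfolding dil_def uR_def uy_def by (simp only: D_linear(1)[OF u(1)] D_linear(2)[OF u(1)])
  have "xsq z * hdot u W z = (\<Sum>j\<in>UNIV. (xsq z * heis_X j u z) * heis_X j W z)"
    by (simp add: hdot_def sum_distrib_left mult.assoc)
  also have "\<dots> = (\<Sum>j\<in>UNIV. 4 * xsq z * uR * (fst z $ j)\<^sup>2 + 8 * xsq z * snd z * uy * (fst z $ heis_swap j)\<^sup>2
       + (4 * snd z * uR + 8 * (xsq z)\<^sup>2 * uy) * (heis_sign j * (fst z $ j) * (fst z $ heis_swap j)))"
    unfolding Xj heis_X_W
  proof (rule sum.cong[OF refl])
    fix j :: "'k + 'k"
    have "heis_sign j * (heis_sign j * a) = a" for a by (metis mult.assoc mult_1 heis_sign_sq)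
    then show "(fst z $ j * uR + 2 * xsq z * heis_sign j * fst z $ heis_swap j * uy) *
         (4 * xsq z * fst z $ j + 4 * snd z * heis_sign j * fst z $ heis_swap j) =
         4 * xsq z * uR * (fst z $ j)\<^sup>2 + 8 * xsq z * snd z * uy * (fst z $ heis_swap j)\<^sup>2
       + (4 * snd z * uR + 8 * (xsq z)\<^sup>2 * uy) * (heis_sign j * (fst z $ j) * (fst z $ heis_swap j))"
      by (simp add: algebra_simps power2_eq_square)
  qed
  also have "\<dots> = 4 * xsq z * uR * xsq z + 8 * xsq z * snd z * uy * xsq z"
    using sum_heis_swap[of "\<lambda>j. (fst z $ j)\<^sup>2"]
    by (simp add: sum.distrib sum_distrib_left[symmetric] sum_cross xsq_sum)
  also have "\<dots> = xsq z * (4 * xsq z * dil u z)"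
    by (simp add: Z algebra_simps)
  finally show ?thesis using False by simp
qed

text \<open>Cauchy-Schwarz for \<open>hdot u W\<close>, where \<open>hdot u W\<close> and
  \<open>hsq W\<close> are known explicitly. It plays the role of bounding the radial derivative by
  the gradient; the factor \<open>xsq\<close> reflects that the gauge degenerates on the axis
  \<open>x = 0\<close>.\<close>

lemma xsq_dil_le:
  fixes u :: "'k::finite heis \<Rightarrow> real"
  assumes u: "C1 u" "cylindrical u"
  shows "xsq z * (dil u z)\<^sup>2 \<le> W z * hsq u z"
proof (cases "xsq z = 0")
  case False
  have "(hdot u W z)\<^sup>2 \<le> hsq u z * hsq W z"
    using Cauchy_Schwarz_ineq_sum[of "\<lambda>j. heis_X j u z" "\<lambda>j. heis_X j W z" UNIV]
    by (simp add: hdot_def power2_eq_square)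
  then have "16 * xsq z * (xsq z * (dil u z)\<^sup>2) \<le> 16 * xsq z * (W z * hsq u z)"
    unfolding hdot_W[OF u] hsq_W by (simp add: power_mult_distrib power2_eq_square algebra_simps)
  then show ?thesis
    using False by (simp add: mult_le_cancel_left order_less_le)
next
  case True
  have "hsq u z \<ge> 0" unfolding hdot_def by (intro sum_nonneg) auto
  then show ?thesis using True by simp
qed

lemma hsq_nonneg [simp]: "hsq u z \<ge> 0"
  unfolding hdot_def by (intro sum_nonneg) auto

section \<open>Commuting horizontal derivatives with the dilation generator\<close>

lemma C1_heis_X:
  assumes u: "C_n 2 u"
  shows "C1 (heis_X j u)"
    and "D (heis_X j u) z v = D (\<lambda>z'. D u z' (Xvec j z)) z v + D u z (0, 2 * heis_sign j * (fst v $ heis_swap j))"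
proof -
  define B :: "'a heis \<Rightarrow> 'a heis" where "B z = (0, 2 * heis_sign j * (fst z $ heis_swap j))" for z
  have B: "bounded_linear B"
    unfolding B_def
    by (intro bounded_linear_Pair bounded_linear_const_mult bounded_linear_zero
        bounded_linear_compose[OF bounded_linear_vec_nth bounded_linear_fst])
  have X: "Xvec j z = (axis j 1, 0) + B z" for z
    by (simp add: Xvec_def B_def)
  have hX: "heis_X j u = (\<lambda>z. D u z ((axis j 1, 0) + B z))"
    by (simp add: fun_eq_iff heis_X_eq(1)[OF C2_C1[OF u]] X)
  show "C1 (heis_X j u)"
    "D (heis_X j u) z v = D (\<lambda>z'. D u z' (Xvec j z)) z v + D u z (0, 2 * heis_sign j * (fst v $ heis_swap j))"
    unfolding hX X using C1_D_affine[OF u B] by (simp_all only: B_def)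
qed

lemma C1_dil:
  assumes u: "C_n 2 u"
  shows "C1 (dil u)" and "D (dil u) z v = D (\<lambda>z'. D u z' (Zvec z)) z v + D u z (Zvec v)"
proof -
  have B: "bounded_linear (Zvec :: 'a heis \<Rightarrow> 'a heis)"
    unfolding Zvec_def
    by (intro bounded_linear_Pair bounded_linear_const_mult bounded_linear_fst bounded_linear_snd)
  show "C1 (dil u)" "D (dil u) z v = D (\<lambda>z'. D u z' (Zvec z)) z v + D u z (Zvec v)"
    unfolding dil_def using C1_D_affine[OF u B, of 0] by simp_all
qed

lemma C1_hsq:
  assumes u: "C_n 2 u"
  shows "C1 (hsq u)" and "dil (hsq u) z = (\<Sum>j\<in>UNIV. 2 * heis_X j u z * dil (heis_X j u) z)"
  unfolding hdot_def dil_def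
  using C1_sum[of UNIV "\<lambda>j z. heis_X j u z * heis_X j u z" z "Zvec z"] 
    C1_mult[OF C1_heis_X(1)[OF u] C1_heis_X(1)[OF u]]
  by (simp_all add: algebra_simps)

text \<open>The fields \<open>X_j\<close> are homogeneous of degree one, that is
  \<open>X_j Z = Z X_j + X_j\<close> for the dilation generator \<open>Z\<close>. The symmetry of
  second derivatives is used here.\<close>

lemma hdot_dil:
  assumes u: "C_n 2 u"
  shows "hdot u (dil u) z = dil (hsq u) z / 2 + hsq u z"
proof -
  have "heis_X j (dil u) z = dil (heis_X j u) z + heis_X j u z" for j
  proof -
    have "Zvec (Xvec j z) = (0, 2 * heis_sign j * (fst (Zvec z) $ heis_swap j)) + Xvec j z"
      by (simp add: Zvec_def Xvec_def)
    then show ?thesis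
      unfolding heis_X_eq(1)[OF C1_dil(1)[OF u]] C1_dil(2)[OF u]
        dil_def[of "heis_X j u"] C1_heis_X(2)[OF u] heis_X_eq(1)[OF C2_C1[OF u]]
      using D_symmetric_dir[OF u, of "Zvec z" z "Xvec j z"] D_linear(1)[OF C2_C1[OF u]]
      by simp
  qed
  then show ?thesis
    unfolding C1_hsq(2)[OF u] unfolding hdot_def
    by (simp add: sum.distrib algebra_simps sum_divide_distrib)
qed

section \<open>Powers and functions of the gauge\<close>

text \<open>The case distinction is needed because \<open>0 powr 0 = 0\<close>.\<close>

definition apow :: "real \<Rightarrow> real \<Rightarrow> real" where
  "apow a x = (if a = 0 then 1 else \<bar>x\<bar> powr a)"

text \<open>The odd power; \<open>spow p (u z)\<close> is the nonlinearity of the equation.\<close>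

definition spow :: "real \<Rightarrow> real \<Rightarrow> real" where
  "spow a x = sgn x * \<bar>x\<bar> powr a"

lemma continuous_abs_powr:
  assumes "a > 0"
  shows "continuous_on S (\<lambda>x :: real. \<bar>x\<bar> powr a)"
  by (intro continuous_on_powr' continuous_intros) (use assms in auto)

lemma continuous_apow: "a \<ge> 0 \<Longrightarrow> continuous_on S (apow a)"
  unfolding apow_def using continuous_abs_powr[of a S] by (cases "a = 0") auto

lemma DERIV_abs_sgn:
  fixes x :: real
  assumes "x \<noteq> 0"
  shows "(abs has_real_derivative sgn x) (at x)"
proof (cases "x > 0")
  case True
  have "(abs has_real_derivative 1) (at x)"
    by (rule has_field_derivative_transform_within_open[OF DERIV_ident, of "{0<..}"]) (use True in auto)
  then show ?thesis using True by simp
next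
  case False
  have "(abs has_real_derivative - 1) (at x)"
    by (rule has_field_derivative_transform_within_open[OF DERIV_minus[OF DERIV_ident], of "{..<0}"])
       (use False assms in auto)
  then show ?thesis using False assms by (simp add: sgn_if)
qed

lemma DERIV_spow_aux:
  assumes "x \<noteq> 0"
  shows "((\<lambda>x. \<bar>x\<bar> powr a) has_real_derivative a * spow (a - 1) x) (at x)"
    and "(spow a has_real_derivative a * \<bar>x\<bar> powr (a - 1)) (at x)"
proof -
  have "((\<lambda>x. \<bar>x\<bar> powr a) has_real_derivative a * \<bar>x\<bar> powr (a - 1) * sgn x) (at x)"
    using DERIV_chain2[OF has_real_derivative_powr[of "\<bar>x\<bar>" a] DERIV_abs_sgn[OF assms]] assms by simp
  then show 1: "((\<lambda>x. \<bar>x\<bar> powr a) has_real_derivative a * spow (a - 1) x) (at x)"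
    by (simp add: spow_def mult.commute mult.left_commute)
  have "((\<lambda>y. sgn x * \<bar>y\<bar> powr a) has_real_derivative sgn x * (a * spow (a - 1) x)) (at x)"
    by (intro DERIV_cmult 1)
  then have "((\<lambda>y. sgn x * \<bar>y\<bar> powr a) has_real_derivative a * \<bar>x\<bar> powr (a - 1)) (at x)"
    by (rule back_subst[where P = "\<lambda>d. (_ has_real_derivative d) (at x)"])
       (use assms in \<open>simp add: spow_def sgn_if\<close>)
  then show "(spow a has_real_derivative a * \<bar>x\<bar> powr (a - 1)) (at x)"
  proof (rule has_field_derivative_transform_within_open)
    show "open (if x > 0 then {0<..} else {..<0 :: real})" by auto
  qed (use assms in \<open>auto simp: spow_def sgn_if split: if_splits\<close>)
qed

lemma powr_div_tendsto_0:
  assumes "a > 1"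
  shows "((\<lambda>h. \<bar>h\<bar> powr a / h) \<longlongrightarrow> 0) (at (0 :: real))"
proof (rule tendsto_rabs_zero_cancel)
  have "isCont (\<lambda>h :: real. \<bar>h\<bar> powr (a - 1)) 0"
    using continuous_abs_powr[of "a - 1" UNIV] assms by (simp add: continuous_on_eq_continuous_at)
  then have "((\<lambda>h :: real. \<bar>h\<bar> powr (a - 1)) \<longlongrightarrow> 0) (at 0)"
    using assms by (simp add: isCont_def)
  then show "((\<lambda>h. \<bar>\<bar>h\<bar> powr a / h\<bar>) \<longlongrightarrow> 0) (at (0 :: real))"
    by (rule Lim_transform_within[where d = 1]) (auto simp: powr_diff abs_mult)
qed

lemma DERIV_abs_powr:
  assumes "a > 1"
  shows "((\<lambda>x. \<bar>x\<bar> powr a) has_real_derivative a * spow (a - 1) x) (at x)"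
proof (cases "x = 0")
  case True
  then show ?thesis
    using powr_div_tendsto_0[OF assms] assms by (simp add: DERIV_def spow_def)
qed (rule DERIV_spow_aux(1))

lemma DERIV_spow:
  assumes "a \<ge> 1"
  shows "(spow a has_real_derivative a * apow (a - 1) x) (at x)"
proof (cases "a = 1")
  case True
  have "spow 1 = (\<lambda>x. x)"
    by (auto simp: spow_def fun_eq_iff sgn_if)
  then show ?thesis using True by (simp add: apow_def)
next
  case a: False
  show ?thesis
  proof (cases "x = 0")
    case True
    have "((\<lambda>h. sgn h * \<bar>h\<bar> powr a / h) \<longlongrightarrow> 0) (at (0 :: real))"
    proof (rule tendsto_rabs_zero_cancel)
      show "((\<lambda>h. \<bar>sgn h * \<bar>h\<bar> powr a / h\<bar>) \<longlongrightarrow> 0) (at (0 :: real))"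
        using tendsto_rabs_zero[OF powr_div_tendsto_0[of a]] a assms
        by (rule_tac Lim_transform_within[where d = 1]) (auto simp: abs_mult abs_sgn_eq)
    qed
    then show ?thesis
      using True a assms by (simp add: DERIV_def spow_def apow_def)
  next
    case False
    then show ?thesis using DERIV_spow_aux(2)[of x a] a by (simp add: apow_def)
  qed
qed

lemma spow_mult: "spow a x * spow b x = \<bar>x\<bar> powr (a + b)"
  by (cases "x = 0") (auto simp: spow_def powr_add sgn_if)

lemma apow_mult: "a \<ge> 0 \<Longrightarrow> b \<ge> 0 \<Longrightarrow> apow a x * apow b x = apow (a + b) x"
  by (cases "x = 0") (auto simp: apow_def powr_add)

lemma spow_apow: "a > 0 \<Longrightarrow> b \<ge> 0 \<Longrightarrow> spow a x * apow b x = spow (a + b) x"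
  by (cases "x = 0") (auto simp: spow_def apow_def powr_add)

lemma abs_powr_mult: "\<bar>x :: real\<bar> powr a * \<bar>x\<bar> powr b = \<bar>x\<bar> powr (a + b)"
  by (simp add: powr_add)

lemma spow_1: "spow 1 x = x"
  by (auto simp: spow_def sgn_if)

lemma abs_powr_mult_spow: "\<bar>x :: real\<bar> powr a * spow b x = spow (a + b) x"
  by (simp add: spow_def powr_add)

lemma C1_spow:
  assumes "a \<ge> 1" "C1 u"
  shows "C1 (\<lambda>z. spow a (u z))" "D (\<lambda>z. spow a (u z)) z v = a * apow (a - 1) (u z) * D u z v"
proof -
  have c: "continuous_on UNIV (\<lambda>x. a * apow (a - 1) x)"
    using assms(1) by (intro continuous_on_mult_left continuous_apow) simp
  note * = C1_chain[OF assms(2) DERIV_spow[OF assms(1)] c]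
  show "C1 (\<lambda>z. spow a (u z))" "D (\<lambda>z. spow a (u z)) z v = a * apow (a - 1) (u z) * D u z v"
    using * by auto
qed

lemma continuous_spow: "a \<ge> 1 \<Longrightarrow> continuous_on S (spow a)"
  by (meson DERIV_spow DERIV_isCont continuous_at_imp_continuous_on)

lemma C1_abs_powr:
  assumes "a \<ge> 2" "C1 u"
  shows "C1 (\<lambda>z. \<bar>u z\<bar> powr a)" "D (\<lambda>z. \<bar>u z\<bar> powr a) z v = a * spow (a - 1) (u z) * D u z v"
proof -
  have c: "continuous_on UNIV (\<lambda>x. a * spow (a - 1) x)"
    using assms(1) by (intro continuous_on_mult_left continuous_spow) simp
  have a: "a > 1" using assms(1) by simp
  note * = C1_chain[OF assms(2) DERIV_abs_powr[OF a] c]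
  show "C1 (\<lambda>z. \<bar>u z\<bar> powr a)" "D (\<lambda>z. \<bar>u z\<bar> powr a) z v = a * spow (a - 1) (u z) * D u z v"
    using * by auto
qed

text \<open>
  All cut-offs are functions of \<open>ln W\<close>, in which dilations act as translations.
\<close>

definition rad :: "(real \<Rightarrow> real) \<Rightarrow> 'k::finite heis \<Rightarrow> real" where
  "rad g z = (if z = 0 then 0 else g (ln (W z)))"

text \<open>With the gauge \<open>\<rho> = W^(1/4)\<close> this is
  \<open>hsq \<rho> / \<rho>^2\<close>, the weight that appears when a horizontal derivative hits a
  function of \<open>ln W\<close>. It has degree -2 under dilations.\<close>

definition qS :: "'k::finite heis \<Rightarrow> real" where
  "qS z = xsq z / W z"

definition ann :: "real \<Rightarrow> real \<Rightarrow> 'k::finite heis set" where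
  "ann a b = {z. exp a \<le> W z \<and> W z \<le> exp b}"

definition cutoff :: "real \<Rightarrow> real \<Rightarrow> (real \<Rightarrow> real) \<Rightarrow> bool" where
  "cutoff a b g \<longleftrightarrow> continuous_on UNIV g \<and> (\<forall>t. t \<notin> {a..b} \<longrightarrow> g t = 0)"

text \<open>The derivative is an explicit argument because the error terms are phrased in it; the
  support condition on \<open>g\<close> forces the same condition on \<open>g'\<close>.\<close>

definition bump :: "real \<Rightarrow> real \<Rightarrow> (real \<Rightarrow> real) \<Rightarrow> (real \<Rightarrow> real) \<Rightarrow> bool" where
  "bump a b g g' \<longleftrightarrow> (\<forall>t. (g has_real_derivative g' t) (at t)) \<and> continuous_on UNIV g' \<and>
     (\<forall>t. t \<notin> {a..b} \<longrightarrow> g t = 0)"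

section \<open>Calculus of radial cut-offs\<close>

lemma W_0 [simp]: "W 0 = 0"
  by simp

lemma W_pos: "z \<noteq> 0 \<Longrightarrow> W z > 0"
  using W_nonneg[of z] W_eq_0_iff[of z] by linarith

lemma continuous_W: "continuous_on S W"
  using C1_continuous[OF C1_W(1)] .

lemma continuous_xsq: "continuous_on S xsq"
  using C1_continuous[OF C1_xsq(1)] .

lemma compact_W_le: "compact {z :: 'k::finite heis. W z \<le> R}"
proof -
  have "closed {z :: 'k heis. W z \<le> R}"
    by (intro closed_Collect_le continuous_W continuous_on_const)
  moreover have "bounded {z :: 'k heis. W z \<le> R}"
  proof (rule boundedI)
    fix z :: "'k heis"
    assume "z \<in> {z. W z \<le> R}"
    then have w: "W z \<le> R" by simp
    have "(norm (fst z))\<^sup>2 = xsq z" by (simp add: xsq_def dot_square_norm)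
    also have "\<dots> \<le> sqrt R" using xsq_le[of z] w by (meson order_trans real_sqrt_le_mono)
    finally have 1: "norm (fst z) \<le> sqrt (sqrt R)" by (rule real_le_rsqrt)
    have "(snd z)\<^sup>2 \<le> R" using w zero_le_power2[of "xsq z"] unfolding W_def by linarith
    then have 2: "\<bar>snd z\<bar> \<le> sqrt R" by (metis real_sqrt_abs real_sqrt_le_mono)
    have "norm z \<le> norm (fst z) + norm (snd z)"
      by (metis norm_Pair_le prod.collapse)
    then show "norm z \<le> sqrt (sqrt R) + sqrt R" using 1 2 by simp
  qed
  ultimately show ?thesis by (simp add: compact_eq_bounded_closed)
qed

lemma compact_ann: "compact (ann a b :: 'k::finite heis set)"
proof -
  have "ann a b = {z :: 'k heis. W z \<le> exp b} \<inter> {z. exp a \<le> W z}"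
    by (auto simp: ann_def)
  then show ?thesis
    by (simp only:) (intro compact_Int_closed compact_W_le closed_Collect_le continuous_W continuous_on_const)
qed

lemma ann_iff: "z \<in> ann a b \<longleftrightarrow> z \<noteq> 0 \<and> a \<le> ln (W z) \<and> ln (W z) \<le> b"
proof (cases "z = 0")
  case True
  then show ?thesis by (simp add: ann_def W_eq_0_iff[THEN iffD2])
next
  case False
  then show ?thesis using W_pos[of z] by (simp add: ann_def ln_ge_iff) (metis exp_le_cancel_iff exp_ln)
qed

lemma rad_outside: "cutoff a b g \<Longrightarrow> z \<notin> ann a b \<Longrightarrow> rad g z = 0"
  by (auto simp: rad_def ann_iff cutoff_def)

lemma cutoff_bump:
  assumes "bump a b g g'"
  shows "cutoff a b g" "cutoff a b g'"
proof -
  have d: "(g has_real_derivative g' t) (at t)" for t using assms by (simp add: bump_def)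
  show "cutoff a b g"
    using assms d unfolding bump_def cutoff_def by (meson DERIV_continuous_on has_field_derivative_at_within)
  have "g' t = 0" if "t \<notin> {a..b}" for t
  proof -
    have "((\<lambda>_. 0) has_real_derivative g' t) (at t)"
      by (rule has_field_derivative_transform_within_open[OF d, of "- {a..b}"])
         (use assms that in \<open>auto simp: bump_def open_Compl\<close>)
    then show ?thesis using DERIV_const DERIV_unique by blast
  qed
  then show "cutoff a b g'" using assms by (simp add: bump_def cutoff_def)
qed

text \<open>Since \<open>g\<close> vanishes below \<open>a\<close>, the function is zero on the open
  half-line below \<open>exp a\<close>, which together with the positive half-line covers the reals.
  Hence the singularity of \<open>ln\<close> at zero is never seen.\<close>

lemma continuous_cut_ln:
  assumes "cutoff a b g"
  shows "continuous_on UNIV (\<lambda>w. if w \<le> 0 then 0 else g (ln w))"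
proof -
  have "continuous_on {0<..} (\<lambda>w. if w \<le> 0 then 0 else g (ln w))"
  proof (rule continuous_on_eq)
    show "continuous_on {0<..} (\<lambda>w. g (ln w))"
      by (rule continuous_on_compose2[of UNIV g]) (use assms in \<open>auto intro!: continuous_intros simp: cutoff_def\<close>)
  qed auto
  moreover have "continuous_on {..<exp a} (\<lambda>w. if w \<le> 0 then 0 else g (ln w))"
  proof (rule continuous_on_eq[OF continuous_on_const[of _ 0]])
    fix w assume w: "w \<in> {..<exp a}"
    then have "w > 0 \<Longrightarrow> ln w < a" by (metis exp_less_cancel_iff exp_ln lessThan_iff)
    then show "0 = (if w \<le> 0 then 0 else g (ln w))"
      using assms by (auto simp: cutoff_def)
  qed
  ultimately have "continuous_on ({0<..} \<union> {..<exp a}) (\<lambda>w. if w \<le> 0 then 0 else g (ln w))"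
    by (intro continuous_on_open_Un) auto
  moreover have "{0<..} \<union> {..<exp a} = (UNIV :: real set)"
    using exp_gt_zero[of a] by (auto simp del: exp_gt_zero)
  ultimately show ?thesis by simp
qed

lemma rad_eq: "rad g z = (if W z \<le> 0 then 0 else g (ln (W z)))"
  using W_pos[of z] by (cases "z = 0") (auto simp: rad_def)

lemma continuous_rad:
  assumes "cutoff a b g"
  shows "continuous_on UNIV (rad g)"
  unfolding rad_eq[abs_def]
  by (rule continuous_on_compose2[OF continuous_cut_ln[OF assms] continuous_W]) auto

lemma C1_rad:
  assumes "bump a b g g'"
  shows "C1 (rad g)" "D (rad g) z v = rad g' z * (D W z v / W z)"
proof -
  let ?G = "\<lambda>w. if w \<le> 0 then 0 else g (ln w)"
  let ?G' = "\<lambda>w. if w \<le> 0 then 0 else (g' (ln w) * exp (- ln w))"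
  have c: "cutoff a b g" "cutoff a b g'" using cutoff_bump[OF assms] .
  have "cutoff a b (\<lambda>t. g' t * exp (- t))"
    using c(2) by (auto simp: cutoff_def intro!: continuous_intros)
  from continuous_cut_ln[OF this] have cont: "continuous_on UNIV ?G'" .
  have der: "(?G has_real_derivative ?G' w) (at w)" for w
  proof (cases "w > 0")
    case True
    have d: "(g has_real_derivative g' (ln w)) (at (ln w))" using assms by (simp add: bump_def)
    have "((\<lambda>w. g (ln w)) has_real_derivative g' (ln w) * (1 / w)) (at w)"
      by (rule DERIV_chain2[where f = g and g = ln, OF d DERIV_ln_divide[OF True]])
    then have "(?G has_real_derivative g' (ln w) * (1 / w)) (at w)"
      by (rule has_field_derivative_transform_within_open[where S = "{0<..}"]) (use True in auto)
    then show ?thesis using True by (simp add: exp_minus field_simps)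
  next
    case False
    have "(?G has_real_derivative 0) (at w)"
    proof (rule has_field_derivative_transform_within_open[OF DERIV_const[of 0], where S = "{..<exp a}"])
      fix x assume w: "x \<in> {..<exp a}"
      then have "x > 0 \<Longrightarrow> ln x < a" by (metis exp_less_cancel_iff exp_ln lessThan_iff)
      then show "0 = ?G x"
        using c by (auto simp: cutoff_def)
    qed (use False exp_gt_zero[of a] in \<open>auto simp del: exp_gt_zero\<close>)
    then show ?thesis using False by simp
  qed
  note r = C1_chain[OF C1_W(1) der cont]
  show "C1 (rad g)" unfolding rad_eq[abs_def] by (rule r(1))
  show "D (rad g) z v = rad g' z * (D W z v / W z)"
    unfolding rad_eq[abs_def] r(2) using W_pos[of z] by (auto simp: exp_minus field_simps)
qed

lemma dil_rad: "bump a b g g' \<Longrightarrow> dil (rad g) z = 4 * rad g' z"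
  using dil_W[of z] W_pos[of z] by (cases "z = 0") (auto simp: dil_def C1_rad rad_def)

lemma hdot_rad:
  assumes "C1 u" "cylindrical u" "bump a b g g'"
  shows "hdot u (rad g) z = 4 * qS z * dil u z * rad g' z"
proof -
  have "hdot u (rad g) z = (rad g' z / W z) * hdot u W z"
    unfolding hdot_def heis_X_eq(1)[OF C1_rad(1)[OF assms(3)]] C1_rad(2)[OF assms(3)] heis_X_eq(1)[OF C1_W(1)]
    by (simp add: sum_distrib_left mult_ac)
  then show ?thesis by (simp add: hdot_W[OF assms(1,2)] qS_def)
qed

lemma hsq_rad:
  assumes "bump a b g g'"
  shows "hsq (rad g) z = 16 * qS z * (rad g' z)\<^sup>2"
proof -
  have "hsq (rad g) z = (rad g' z / W z)\<^sup>2 * hsq W z"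
    unfolding hdot_def heis_X_eq(1)[OF C1_rad(1)[OF assms]] C1_rad(2)[OF assms] heis_X_eq(1)[OF C1_W(1)]
    by (simp add: sum_distrib_left power2_eq_square mult_ac)
  then show ?thesis by (simp add: hsq_W qS_def power2_eq_square)
qed

lemma rad_mult: "rad f z * rad g z = rad (\<lambda>t. f t * g t) z"
  and rad_add: "rad f z + rad g z = rad (\<lambda>t. f t + g t) z"
  and rad_cmult: "c * rad g z = rad (\<lambda>t. c * g t) z"
  by (auto simp: rad_def)

text \<open>On the support the factor \<open>1 / W\<close> is \<open>exp (- t)\<close> with
  \<open>t = ln W\<close>, so the singular weight turns into the polynomial \<open>xsq\<close> times
  another radial cut-off.\<close>

lemma qS_rad: "qS z * rad g z = xsq z * rad (\<lambda>t. exp (- t) * g t) z"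
  using W_pos[of z] by (auto simp: rad_def qS_def exp_minus field_simps)

lemma qS_nonneg [simp]: "qS z \<ge> 0"
  by (simp add: qS_def)

lemma qS_le:
  assumes "z \<noteq> 0"
  shows "qS z \<le> exp (- ln (W z) / 2)"
proof -
  from assms have w: "W z > 0" by (rule W_pos)
  have "qS z \<le> sqrt (W z) / W z"
    unfolding qS_def by (intro divide_right_mono xsq_le) (use w in auto)
  also have "\<dots> = exp (ln (W z) / 2 - ln (W z))"
  proof -
    have "sqrt (W z) = exp (ln (W z) / 2)"
      by (rule real_sqrt_unique) (use w in \<open>simp_all add: power2_eq_square flip: exp_add\<close>)
    then show ?thesis using w unfolding exp_diff by simp
  qed
  finally show ?thesis by simp
qed

lemma qS_dil_le:
  assumes "C1 u" "cylindrical u"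
  shows "qS z * (dil u z)\<^sup>2 \<le> hsq u z"
proof (cases "z = 0")
  case False
  then show ?thesis using xsq_dil_le[OF assms, of z] W_pos[of z]
    by (simp add: qS_def field_simps)
qed (simp add: qS_def W_eq_0_iff[THEN iffD2])

lemma cutoff_exp: "cutoff a b g \<Longrightarrow> cutoff a b (\<lambda>t. exp (c * t) * g t)"
  by (auto simp: cutoff_def intro!: continuous_intros)

lemma bump_exp: "bump a b g g' \<Longrightarrow> bump a b (\<lambda>t. exp (c * t) * g t) (\<lambda>t. exp (c * t) * (c * g t + g' t))"
  using cutoff_bump[of a b g g']
  by (auto simp: bump_def cutoff_def algebra_simps intro!: continuous_intros derivative_eq_intros)

lemma bump_mult: "bump a b f f' \<Longrightarrow> bump a b g g' \<Longrightarrow> bump a b (\<lambda>t. f t * g t) (\<lambda>t. f t * g' t + f' t * g t)"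
  using cutoff_bump[of a b f f'] cutoff_bump[of a b g g']
  by (auto simp: bump_def cutoff_def algebra_simps intro!: continuous_intros derivative_eq_intros)

lemma integrable_rad:
  assumes "continuous_on UNIV f" "cutoff a b g"
  shows "integrable lborel (\<lambda>z. f z * rad g z)"
proof (rule integrable_compact_support[OF _ compact_ann[of a b]])
  show "continuous_on UNIV (\<lambda>z. f z * rad g z)"
    by (intro continuous_on_mult assms continuous_rad[OF assms(2)])
qed (simp add: rad_outside[OF assms(2)])

lemma integrable_qS_rad:
  assumes "continuous_on UNIV f" "cutoff a b g"
  shows "integrable lborel (\<lambda>z. f z * (qS z * rad g z))"
proof -
  have "integrable lborel (\<lambda>z. (f z * xsq z) * rad (\<lambda>t. exp (- 1 * t) * g t) z)"
    by (intro integrable_rad[OF _ cutoff_exp[OF assms(2)]] continuous_on_mult assms continuous_xsq)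
  then show ?thesis unfolding qS_rad by (simp add: mult_ac)
qed

text \<open>Because \<open>dil W = 4 * W\<close>, the dilation generator acts on functions of
  \<open>t = ln W\<close> as \<open>4 d/dt\<close>; the other term is the divergence of
  \<open>Zvec\<close>.\<close>

lemma integral_dil_rad:
  fixes f :: "'k::finite heis \<Rightarrow> real"
  assumes f: "C1 f" and g: "bump a b g g'"
  shows "(LINT z|lborel. dil f z * rad g z) = - (LINT z|lborel. f z * (4 * rad g' z + hom_dim TYPE('k) * rad g z))"
proof -
  note c = cutoff_bump[OF g]
  have i: "integrable lborel (\<lambda>z. dil f z * rad g z)" "integrable lborel (\<lambda>z. f z * rad g z)"
     "integrable lborel (\<lambda>z. f z * rad g' z)"
    by (rule integrable_rad[OF _ c(1)] integrable_rad[OF _ c(2)], simp add: continuous_dil f C1_continuous)+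
  have "(LINT z|lborel. dil (\<lambda>z. f z * rad g z) z) = - hom_dim TYPE('k) * (LINT z|lborel. f z * rad g z)"
    by (rule integral_dil[OF C1_mult(1)[OF f C1_rad(1)[OF g]] compact_ann[of a b]]) (simp add: rad_outside[OF c(1)])
  moreover have "(LINT z|lborel. dil (\<lambda>z. f z * rad g z) z) = 
      (LINT z|lborel. 4 * (f z * rad g' z) + dil f z * rad g z)"
    by (simp add: dil_mult[OF f C1_rad(1)[OF g]] dil_rad[OF g] mult_ac)
  ultimately have "4 * (LINT z|lborel. f z * rad g' z) + (LINT z|lborel. dil f z * rad g z)
     = - hom_dim TYPE('k) * (LINT z|lborel. f z * rad g z)"
    using i by simp
  moreover have "(LINT z|lborel. f z * (4 * rad g' z + hom_dim TYPE('k) * rad g z)) =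
     (LINT z|lborel. 4 * (f z * rad g' z) + hom_dim TYPE('k) * (f z * rad g z))"
    by (rule Bochner_Integration.integral_cong) (simp_all add: algebra_simps)
  moreover have "\<dots> = 4 * (LINT z|lborel. f z * rad g' z) + hom_dim TYPE('k) * (LINT z|lborel. f z * rad g z)"
    using i by simp
  ultimately show ?thesis by linarith
qed

text \<open>The weight \<open>qS\<close> of degree -2 lowers the homogeneous dimension
  \<open>2 k + 2\<close> to \<open>2 k\<close>.\<close>

lemma integral_dil_qS_rad:
  fixes f :: "'k::finite heis \<Rightarrow> real"
  assumes f: "C1 f" and g: "bump a b g g'"
  shows "(LINT z|lborel. dil f z * (qS z * rad g z)) =
    - (LINT z|lborel. f z * (qS z * rad (\<lambda>t. 4 * g' t + 2 * real CARD('k) * g t) z))"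
proof -
  define h where "h t = exp (- 1 * t) * g t" for t
  define h' where "h' t = exp (- 1 * t) * (- 1 * g t + g' t)" for t
  have h: "bump a b h h'" unfolding h_def[abs_def] h'_def[abs_def] by (rule bump_exp[OF g])
  note c = cutoff_bump[OF h]
  have S: "C1 (\<lambda>z. f z * xsq z)" by (intro C1_mult f C1_xsq)
  have i: "integrable lborel (\<lambda>z. (f z * dil xsq z) * rad h z)" "integrable lborel (\<lambda>z. (dil f z * xsq z) * rad h z)"
    by (intro integrable_rad[OF _ c(1)] continuous_on_mult continuous_dil f C1_xsq(1) C1_continuous[OF f] continuous_xsq)+
  have "(LINT z|lborel. (f z * dil xsq z) * rad h z) + (LINT z|lborel. (dil f z * xsq z) * rad h z)
      = (LINT z|lborel. dil (\<lambda>z. f z * xsq z) z * rad h z)"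
    using i by (simp add: dil_mult[OF f C1_xsq(1)] distrib_right)
  also have "\<dots> = - (LINT z|lborel. (f z * xsq z) * (4 * rad h' z + hom_dim TYPE('k) * rad h z))"
    by (rule integral_dil_rad[OF S h])
  finally have "(LINT z|lborel. (dil f z * xsq z) * rad h z) =
     - ((LINT z|lborel. (f z * xsq z) * (4 * rad h' z + hom_dim TYPE('k) * rad h z)) + (LINT z|lborel. (f z * dil xsq z) * rad h z))"
    by simp
  also have "\<dots> = - (LINT z|lborel. (f z * xsq z) * (4 * rad h' z + hom_dim TYPE('k) * rad h z) + (f z * dil xsq z) * rad h z)"
  proof (subst Bochner_Integration.integral_add)
    have "integrable lborel (\<lambda>z. (f z * xsq z) * rad (\<lambda>t. 4 * h' t + hom_dim TYPE('k) * h t) z)"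
      by (rule integrable_rad[OF C1_continuous[OF S], of a b])
         (use c in \<open>auto simp: cutoff_def intro!: continuous_intros\<close>)
    then show "integrable lborel (\<lambda>z. (f z * xsq z) * (4 * rad h' z + hom_dim TYPE('k) * rad h z))"
      by (simp add: rad_cmult rad_add)
  qed (use i in auto)
  also have "(\<lambda>z. (f z * xsq z) * (4 * rad h' z + hom_dim TYPE('k) * rad h z) + (f z * dil xsq z) * rad h z) =
    (\<lambda>z. f z * (qS z * rad (\<lambda>t. 4 * g' t + 2 * real CARD('k) * g t) z))"
    unfolding qS_rad dil_xsq by (rule ext) (simp add: rad_def h_def h'_def algebra_simps)
  finally show ?thesis
    unfolding qS_rad h_def by (simp add: mult_ac)
qed

section \<open>Energy, Pohozaev and Farina identities\<close>

lemma integral_heis_laplacian: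
  assumes u: "C_n 2 u" and \<phi>: "C1 \<phi>" "compact K" "\<And>z. z \<notin> K \<Longrightarrow> \<phi> z = 0"
  shows "(LINT z|lborel. hdot u \<phi> z) = (LINT z|lborel. - heis_laplacian u z * \<phi> z)"
proof -
  have X0: "heis_X j \<phi> z = 0" if "z \<notin> K" for j z
    using D_zero_outside_compact[OF \<phi>(2,3) that] by (simp add: heis_X_eq(1)[OF \<phi>(1)])
  note X1 = C1_heis_X(1)[OF u]
  have i: "integrable lborel (\<lambda>z. heis_X j u z * heis_X j \<phi> z)" for j
    by (rule integrable_compact_support[OF _ \<phi>(2)])
       (auto simp: X0 intro!: continuous_on_mult C1_continuous[OF X1] continuous_heis_X[OF \<phi>(1)])
  have i': "integrable lborel (\<lambda>z. heis_X j (heis_X j u) z * \<phi> z)" for j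
    by (rule integrable_compact_support[OF _ \<phi>(2)])
       (auto simp: \<phi>(3) intro!: continuous_on_mult continuous_heis_X[OF X1] C1_continuous[OF \<phi>(1)])
  have "(LINT z|lborel. heis_X j u z * heis_X j \<phi> z) = - (LINT z|lborel. heis_X j (heis_X j u) z * \<phi> z)" for j
  proof -
    have "0 = (LINT z|lborel. heis_X j (\<lambda>z. heis_X j u z * \<phi> z) z)"
      by (rule integral_heis_X[symmetric, OF C1_mult(1)[OF X1 \<phi>(1)] \<phi>(2)]) (simp add: \<phi>(3))
    also have "\<dots> = (LINT z|lborel. heis_X j u z * heis_X j \<phi> z + heis_X j (heis_X j u) z * \<phi> z)"
      by (simp add: heis_X_mult[OF X1 \<phi>(1)])
    finally show ?thesis using i i' by simp
  qed
  then show ?thesis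
    using i i' by (simp add: hdot_def heis_laplacian_def sum_distrib_right sum_negf)
qed

locale cylindrical_solution =
  fixes u :: "'k::finite heis \<Rightarrow> real" and p :: real
  assumes p: "p > 1" and sol: "C2_solution p u" and cyl: "cylindrical u"
begin

lemma C2: "C_n 2 u" using sol by (simp add: C2_solution_def)
lemma C1u: "C1 u" using C2_C1[OF C2] .
lemma C1dil: "C1 (dil u)" using C1_dil(1)[OF C2] .

lemmas continuous_u = C1_continuous[OF C1u]

lemma weak_form:
  assumes "C1 \<phi>" "compact K" "\<And>z. z \<notin> K \<Longrightarrow> \<phi> z = 0"
  shows "(LINT z|lborel. hdot u \<phi> z) = (LINT z|lborel. spow p (u z) * \<phi> z)"
proof -
  have "spow p (u z) = - heis_laplacian u z" for z
  proof -
    have "spow p (u z) = \<bar>u z\<bar> powr (p - 1) * u z"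
      using abs_powr_mult_spow[of "u z" "p - 1" 1] by (simp add: spow_1)
    moreover have "- heis_laplacian u z = \<bar>u z\<bar> powr (p - 1) * u z"
      using sol unfolding C2_solution_def by blast
    ultimately show ?thesis by simp
  qed
  then show ?thesis using integral_heis_laplacian[OF C2 assms] by simp
qed

lemma weak_form_rad:
  assumes f: "C1 f" and g: "bump a b g g'"
  shows "(LINT z|lborel. hdot u f z * rad g z + f z * (4 * qS z * dil u z * rad g' z)) 
    = (LINT z|lborel. spow p (u z) * f z * rad g z)"
proof -
  note g1 = C1_rad(1)[OF g]
  have "(LINT z|lborel. hdot u (\<lambda>z. f z * rad g z) z) = (LINT z|lborel. spow p (u z) * (f z * rad g z))"
    by (rule weak_form[OF C1_mult(1)[OF f g1] compact_ann[of a b]]) (simp add: rad_outside[OF cutoff_bump(1)[OF g]])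
  then show ?thesis
    by (simp add: hdot_mult_right[OF f g1] hdot_rad[OF C1u cyl g] mult_ac add.commute)
qed

lemma dil_chain:
  assumes "a \<ge> 1"
  shows "dil (\<lambda>z. \<bar>u z\<bar> powr (a + 1)) z = (a + 1) * spow a (u z) * dil u z"
  using C1_abs_powr(2)[of "a + 1" u z] assms C1u by (simp add: dil_def)

lemma C1_potential: "a \<ge> 1 \<Longrightarrow> C1 (\<lambda>z. \<bar>u z\<bar> powr (a + 1))"
  using C1_abs_powr(1)[of "a + 1" u] C1u by simp

text \<open>The weak form tested with \<open>u * rad g\<close>.\<close>

lemma energy_identity:
  assumes g: "bump a b g g'"
  shows "(LINT z|lborel. hsq u z * rad g z + 4 * (u z * dil u z * (qS z * rad g' z))) 
    = (LINT z|lborel. \<bar>u z\<bar> powr (p + 1) * rad g z)"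
proof -
  have "spow p (u z) * u z = \<bar>u z\<bar> powr (p + 1)" for z
    using spow_mult[of p "u z" 1] by (simp add: spow_1)
  moreover have "u z * (4 * qS z * dil u z * rad g' z) = 4 * (u z * dil u z * (qS z * rad g' z))" for z
    by simp
  ultimately show ?thesis
    using weak_form_rad[OF C1u g] by (simp only:)
qed

text \<open>The weak form tested with \<open>dil u * rad g\<close>. Gradient and potential terms are
  then dilation derivatives, so integration by parts removes all second derivatives. The coefficient
  \<open>k\<close> is half the homogeneous dimension minus the one that \<open>hdot_dil\<close>
  contributes.\<close>

lemma pohozaev:
  assumes g: "bump a b g g'"
  shows "(LINT z|lborel. hsq u z * rad (\<lambda>t. real CARD('k) * g t + 2 * g' t) z - 4 * ((dil u z)\<^sup>2 * (qS z * rad g' z))) =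
    (LINT z|lborel. \<bar>u z\<bar> powr (p + 1) / (p + 1) * rad (\<lambda>t. 4 * g' t + hom_dim TYPE('k) * g t) z)"
proof -
  let ?f = "\<lambda>t. real CARD('k) * g t + 2 * g' t"
  let ?h = "\<lambda>t. 4 * g' t + hom_dim TYPE('k) * g t"
  note c = cutoff_bump[OF g]
  have r: "4 * rad g' z + hom_dim TYPE('k) * rad g z = rad ?h z" for z :: "'k heis"
    by (simp add: rad_def)
  have c2: "cutoff a b ?h"
    using c by (auto simp: cutoff_def intro!: continuous_intros)
  have i: "integrable lborel (\<lambda>z. dil (hsq u) z * rad g z)" "integrable lborel (\<lambda>z. hsq u z * rad g z)"
    by (intro integrable_rad[OF _ c(1)] continuous_dil C1_hsq(1)[OF C2] C1_continuous)+
  have i2: "integrable lborel (\<lambda>z. (dil u z)\<^sup>2 * (qS z * rad g' z))"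
    by (intro integrable_qS_rad[OF _ c(2)] continuous_on_power continuous_dil C1u)
  have i3: "integrable lborel (\<lambda>z. hsq u z * rad ?h z)"
    by (intro integrable_rad[OF _ c2] C1_continuous C1_hsq(1)[OF C2])
  have e: "(LINT z|lborel. dil (hsq u) z * rad g z) = - (LINT z|lborel. hsq u z * rad ?h z)"
    using integral_dil_rad[OF C1_hsq(1)[OF C2] g] unfolding r .
  have "(LINT z|lborel. spow p (u z) * dil u z * rad g z) =
     (LINT z|lborel. dil (\<lambda>z. \<bar>u z\<bar> powr (p + 1)) z * rad g z / (p + 1))"
    using p by (intro Bochner_Integration.integral_cong refl) (simp add: dil_chain)
  also have "\<dots> = - (LINT z|lborel. \<bar>u z\<bar> powr (p + 1) / (p + 1) * rad ?h z)"
    using integral_dil_rad[OF C1_potential g, of p] p unfolding r by simp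
  finally have F: "(LINT z|lborel. spow p (u z) * dil u z * rad g z) =
    - (LINT z|lborel. \<bar>u z\<bar> powr (p + 1) / (p + 1) * rad ?h z)" .
  have "- (LINT z|lborel. \<bar>u z\<bar> powr (p + 1) / (p + 1) * rad ?h z) = 
    (LINT z|lborel. dil (hsq u) z * rad g z / 2 + hsq u z * rad g z + 4 * ((dil u z)\<^sup>2 * (qS z * rad g' z)))"
  proof -
    have "hdot u (dil u) z * rad g z + dil u z * (4 * qS z * dil u z * rad g' z) =
        dil (hsq u) z * rad g z / 2 + hsq u z * rad g z + 4 * ((dil u z)\<^sup>2 * (qS z * rad g' z))" for z
      by (simp add: hdot_dil[OF C2] distrib_right power2_eq_square)
    then show ?thesis
      using weak_form_rad[OF C1dil g] F by (simp only:)
  qed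
  also have "\<dots> = (LINT z|lborel. dil (hsq u) z * rad g z) / 2 + (LINT z|lborel. hsq u z * rad g z) 
      + 4 * (LINT z|lborel. (dil u z)\<^sup>2 * (qS z * rad g' z))"
    using i i2 by simp
  also have "\<dots> = (LINT z|lborel. - (hsq u z * rad ?h z / 2) + hsq u z * rad g z
      + 4 * ((dil u z)\<^sup>2 * (qS z * rad g' z)))"
    using i i2 i3 unfolding e by simp
  also have "\<dots> = (LINT z|lborel. - (hsq u z * rad ?f z - 4 * ((dil u z)\<^sup>2 * (qS z * rad g' z))))"
    by (rule Bochner_Integration.integral_cong) (simp_all add: rad_def algebra_simps)
  also have "\<dots> = - (LINT z|lborel. hsq u z * rad ?f z - 4 * ((dil u z)\<^sup>2 * (qS z * rad g' z)))"
    by (rule Bochner_Integration.integral_minus)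
  finally show ?thesis by (simp only: neg_equal_iff_equal)
qed

text \<open>Testing stability with \<open>|u|\<^bsup>(\<gamma>-1)/2\<^esup> u g\<close> and the equation with \<open>|u|\<^bsup>\<gamma>-1\<^esup> u g\<^sup>2\<close>; the gradient terms cancel.\<close>

lemma farina_estimate:
  assumes st: "\<And>\<phi>. C1 \<phi> \<Longrightarrow> (\<And>z. z \<notin> ann a b \<Longrightarrow> \<phi> z = 0) \<Longrightarrow> 
      (LINT z|lborel. p * \<bar>u z\<bar> powr (p - 1) * (\<phi> z)\<^sup>2) \<le> (LINT z|lborel. hsq \<phi> z)"
    and \<gamma>: "\<gamma> \<ge> 1" and g: "bump a b g g'" and gg: "bump a b (\<lambda>t. g t * g' t) h'"
  shows "(p - (\<gamma> + 1)\<^sup>2 / (4 * \<gamma>)) * (LINT z|lborel. \<bar>u z\<bar> powr (p + \<gamma>) * rad (\<lambda>t. (g t)\<^sup>2) z) \<le>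
    (LINT z|lborel. \<bar>u z\<bar> powr (\<gamma> + 1) * (qS z * rad (\<lambda>t. 16 * (g' t)\<^sup>2 
       - (\<gamma> - 1) / (2 * \<gamma>) * (16 * h' t + 8 * real CARD('k) * (g t * g' t))) z))"
proof -
  let ?gg = "\<lambda>t. g t * g' t"
  let ?g'2 = "\<lambda>t. (g' t)\<^sup>2"
  let ?g2 = "\<lambda>t. (g t)\<^sup>2"
  define M where "M z = \<bar>u z\<bar> powr (\<gamma> + 1)" for z
  define \<Phi> where "\<Phi> = (\<lambda>z. spow ((\<gamma> + 1) / 2) (u z))"
  define \<Psi> where "\<Psi> = (\<lambda>z. spow \<gamma> (u z))"
  define A where "A z = apow (\<gamma> - 1) (u z)" for z
  note c = cutoff_bump[OF g]
  have c2: "cutoff a b ?g2" "cutoff a b ?g'2" "cutoff a b ?gg" "cutoff a b h'"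
    using c cutoff_bump[OF gg] by (auto simp: cutoff_def intro!: continuous_intros)
  have g2: "bump a b ?g2 (\<lambda>t. 2 * (g t * g' t))"
    using bump_mult[OF g g] by (simp add: power2_eq_square mult_ac)
  have M1: "C1 M" unfolding M_def by (rule C1_potential[OF \<gamma>])
  have \<Phi>1: "C1 \<Phi>" "D \<Phi> z v = (\<gamma> + 1) / 2 * apow ((\<gamma> - 1) / 2) (u z) * D u z v" for z v
    unfolding \<Phi>_def using C1_spow[of "(\<gamma> + 1) / 2" u] \<gamma> C1u by (simp_all add: field_simps)
  have \<Psi>1: "C1 \<Psi>" "D \<Psi> z v = \<gamma> * A z * D u z v" for z v
    unfolding \<Psi>_def A_def using C1_spow[of \<gamma> u] \<gamma> C1u by simp_all
  have cA: "continuous_on UNIV A"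
    unfolding A_def by (rule continuous_on_compose2[OF continuous_apow[of "\<gamma> - 1" UNIV] continuous_u]) (use \<gamma> in auto)
  have cN: "continuous_on UNIV (\<lambda>z. \<bar>u z\<bar> powr (p + \<gamma>))"
    by (rule continuous_on_compose2[OF continuous_abs_powr[of "p + \<gamma>" UNIV] continuous_u]) (use \<gamma> p in auto)
  have dM: "dil M z = (\<gamma> + 1) * \<Psi> z * dil u z" for z
    unfolding M_def \<Psi>_def by (rule dil_chain[OF \<gamma>])
  have hM: "\<Phi> z * ((\<gamma> + 1) / 2 * apow ((\<gamma> - 1) / 2) (u z)) = (\<gamma> + 1) / 2 * \<Psi> z" for z
    using spow_apow[of "(\<gamma> + 1) / 2" "(\<gamma> - 1) / 2" "u z"] \<gamma> by (simp add: \<Phi>_def \<Psi>_def field_simps)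
  have hA: "((\<gamma> + 1) / 2 * apow ((\<gamma> - 1) / 2) (u z))\<^sup>2 = (\<gamma> + 1)\<^sup>2 / 4 * A z" for z
  proof -
    have "apow ((\<gamma> - 1) / 2) (u z) * apow ((\<gamma> - 1) / 2) (u z) = A z"
      using apow_mult[of "(\<gamma> - 1) / 2" "(\<gamma> - 1) / 2" "u z"] \<gamma> unfolding A_def field_sum_of_halves by simp
    then show ?thesis by (simp add: power2_eq_square mult_ac)
  qed
  have \<Phi>2: "(\<Phi> z)\<^sup>2 = M z" for z
    using spow_mult[of "(\<gamma> + 1) / 2" "u z" "(\<gamma> + 1) / 2"] unfolding field_sum_of_halves
    by (simp add: \<Phi>_def M_def power2_eq_square)
  have hX\<Phi>: "heis_X j \<Phi> z = (\<gamma> + 1) / 2 * apow ((\<gamma> - 1) / 2) (u z) * heis_X j u z" for j z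
    unfolding heis_X_eq(1)[OF \<Phi>1(1)] \<Phi>1(2) heis_X_eq(1)[OF C1u] by simp
  have h\<Psi>: "hdot u \<Psi> z = \<gamma> * A z * hsq u z" for z
    unfolding hdot_def heis_X_eq(1)[OF \<Psi>1(1)] \<Psi>1(2) heis_X_eq(1)[OF C1u] by (simp add: sum_distrib_left mult_ac)
  define N where "N = (LINT z|lborel. \<bar>u z\<bar> powr (p + \<gamma>) * rad ?g2 z)"
  define D1 where "D1 = (LINT z|lborel. A z * hsq u z * rad ?g2 z)"
  define T where "T = (LINT z|lborel. dil M z * (qS z * rad ?gg z))"
  define R where "R = (LINT z|lborel. M z * (qS z * rad ?g'2 z))"
  have iD: "integrable lborel (\<lambda>z. A z * hsq u z * rad ?g2 z)"
    by (intro integrable_rad[OF _ c2(1)] continuous_on_mult cA continuous_hdot C1u)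
  have iT: "integrable lborel (\<lambda>z. dil M z * (qS z * rad ?gg z))"
    by (intro integrable_qS_rad[OF _ c2(3)] continuous_dil M1)
  have iR: "integrable lborel (\<lambda>z. M z * (qS z * rad ?g'2 z))"
    by (intro integrable_qS_rad[OF _ c2(2)] C1_continuous M1)
  have "spow p x * spow \<gamma> x = \<bar>x\<bar> powr (p + \<gamma>)" for x by (rule spow_mult)
  then have "N = (LINT z|lborel. hdot u \<Psi> z * rad ?g2 z + \<Psi> z * (4 * qS z * dil u z * rad (\<lambda>t. 2 * (g t * g' t)) z))"
    using weak_form_rad[OF \<Psi>1(1) g2] by (simp add: N_def \<Psi>_def)
  also have "\<dots> = (LINT z|lborel. \<gamma> * (A z * hsq u z * rad ?g2 z) 
      + 8 / (\<gamma> + 1) * (dil M z * (qS z * rad ?gg z)))"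
    using \<gamma> by (intro Bochner_Integration.integral_cong refl) (simp add: h\<Psi> dM rad_def field_simps)
  also have "\<dots> = \<gamma> * D1 + 8 / (\<gamma> + 1) * T"
    using iD iT by (simp add: D1_def T_def)
  finally have eq1: "N = \<gamma> * D1 + 8 / (\<gamma> + 1) * T" .
  have g1: "C1 (rad g :: 'k heis \<Rightarrow> real)" by (rule C1_rad(1)[OF g])
  have "p * N = (LINT z|lborel. p * \<bar>u z\<bar> powr (p - 1) * (\<Phi> z * rad g z)\<^sup>2)"
  proof -
    have "\<bar>u z\<bar> powr (p - 1) * M z = \<bar>u z\<bar> powr (p + \<gamma>)" for z
      unfolding M_def by (subst abs_powr_mult) simp
    then have e: "p * \<bar>u z\<bar> powr (p - 1) * (\<Phi> z * rad g z)\<^sup>2 = p * (\<bar>u z\<bar> powr (p + \<gamma>) * rad ?g2 z)" for z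
      by (simp add: power_mult_distrib \<Phi>2 power2_eq_square[of "rad g z"] rad_mult power2_eq_square[of "g _"] mult.assoc[symmetric])
    show ?thesis unfolding N_def by (simp only: e Bochner_Integration.integral_mult_right_zero)
  qed
  also have "\<dots> \<le> (LINT z|lborel. hsq (\<lambda>z. \<Phi> z * rad g z) z)"
    by (rule st[OF C1_mult(1)[OF \<Phi>1(1) g1]]) (simp add: rad_outside[OF c(1)])
  also have "\<dots> = (LINT z|lborel. (\<gamma> + 1)\<^sup>2 / 4 * (A z * hsq u z * rad ?g2 z) 
      + 4 * (dil M z * (qS z * rad ?gg z)) + 16 * (M z * (qS z * rad ?g'2 z)))"
  proof (intro Bochner_Integration.integral_cong refl)
    fix z :: "'k heis"
    let ?s = "(\<gamma> + 1) / 2 * apow ((\<gamma> - 1) / 2) (u z)"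
    have "hsq (\<lambda>z. \<Phi> z * rad g z) z = 
      (\<Sum>j\<in>UNIV. ?s\<^sup>2 * (rad g z)\<^sup>2 * (heis_X j u z * heis_X j u z) + 2 * (\<Phi> z * ?s) * rad g z * (heis_X j u z * heis_X j (rad g) z)
        + (\<Phi> z)\<^sup>2 * (heis_X j (rad g) z * heis_X j (rad g) z))"
      unfolding hdot_def heis_X_mult[OF \<Phi>1(1) g1] hX\<Phi>
      by (intro sum.cong refl) (simp add: power2_eq_square algebra_simps)
    also have "\<dots> = ?s\<^sup>2 * (rad g z)\<^sup>2 * hsq u z + 2 * (\<Phi> z * ?s) * rad g z * hdot u (rad g) z + (\<Phi> z)\<^sup>2 * hsq (rad g) z"
      by (simp add: sum.distrib sum_distrib_left hdot_def)
    also have "\<dots> = (\<gamma> + 1)\<^sup>2 / 4 * A z * (rad g z)\<^sup>2 * hsq u z + (\<gamma> + 1) * \<Psi> z * rad g z * (4 * qS z * dil u z * rad g' z) 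
        + M z * (16 * qS z * (rad g' z)\<^sup>2)"
      unfolding hA hM \<Phi>2 hdot_rad[OF C1u cyl g] hsq_rad[OF g] by simp
    also have "\<dots> = (\<gamma> + 1)\<^sup>2 / 4 * (A z * hsq u z * rad ?g2 z) 
      + 4 * (dil M z * (qS z * rad ?gg z)) + 16 * (M z * (qS z * rad ?g'2 z))"
      unfolding dM by (simp add: rad_def power2_eq_square algebra_simps)
    finally show "hsq (\<lambda>z. \<Phi> z * rad g z) z = \<dots>" .
  qed
  also have "\<dots> = (\<gamma> + 1)\<^sup>2 / 4 * D1 + 4 * T + 16 * R"
    using iD iT iR by (simp add: D1_def T_def R_def)
  finally have eq2: "p * N \<le> (\<gamma> + 1)\<^sup>2 / 4 * D1 + 4 * T + 16 * R" .
  \<comment> \<open>\<open>T\<close> still contains a derivative of \<open>u\<close>. As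
    \<open>M\<close> is a function of \<open>u\<close> alone, this derivative can be moved onto the
    cut-off, which is why \<open>g * g'\<close> has to be a bump as well.\<close>
  have eq3: "T = - (LINT z|lborel. M z * (qS z * rad (\<lambda>t. 4 * h' t + 2 * real CARD('k) * (g t * g' t)) z))"
    unfolding T_def by (rule integral_dil_qS_rad[OF M1 gg])
  have "D1 = (N - 8 / (\<gamma> + 1) * T) / \<gamma>" unfolding eq1 using \<gamma> by simp
  moreover have "s\<^sup>2 / 4 * ((N - 8 / s * T) / \<gamma>) = s\<^sup>2 / (4 * \<gamma>) * N - 2 * s / \<gamma> * T" if "s > 0" for s
    using \<gamma> that by (simp add: field_simps power2_eq_square)
  ultimately have "(\<gamma> + 1)\<^sup>2 / 4 * D1 = (\<gamma> + 1)\<^sup>2 / (4 * \<gamma>) * N - 2 * (\<gamma> + 1) / \<gamma> * T"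
    using \<gamma> by simp
  then have "(p - (\<gamma> + 1)\<^sup>2 / (4 * \<gamma>)) * N \<le> (4 - 2 * (\<gamma> + 1) / \<gamma>) * T + 16 * R"
    using eq2 by (simp add: algebra_simps)
  also have "(4 - 2 * (\<gamma> + 1) / \<gamma>) = 2 * (\<gamma> - 1) / \<gamma>"
    using \<gamma> by (simp add: field_simps)
  also have "2 * (\<gamma> - 1) / \<gamma> * T + 16 * R = 
     (LINT z|lborel. 16 * (M z * (qS z * rad ?g'2 z)) -
         2 * (\<gamma> - 1) / \<gamma> * (M z * (qS z * rad (\<lambda>t. 4 * h' t + 2 * real CARD('k) * (g t * g' t)) z)))"
  proof -
    have "integrable lborel (\<lambda>z. M z * (qS z * rad (\<lambda>t. 4 * h' t + 2 * real CARD('k) * (g t * g' t)) z))"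
      by (rule integrable_qS_rad[OF C1_continuous[OF M1], of a b])
         (use c2 in \<open>auto simp: cutoff_def intro!: continuous_intros\<close>)
    then show ?thesis using iR unfolding eq3 R_def by simp
  qed
  also have "\<dots> = (LINT z|lborel. M z * (qS z * rad (\<lambda>t. 16 * (g' t)\<^sup>2 
       - (\<gamma> - 1) / (2 * \<gamma>) * (16 * h' t + 8 * real CARD('k) * (g t * g' t))) z))"
    using \<gamma> by (intro Bochner_Integration.integral_cong refl) (simp add: rad_def field_simps)
  finally show ?thesis unfolding N_def M_def .
qed

end

section \<open>Interpolation and the invariant measure of annuli\<close>

text \<open>Below the threshold \<open>\<epsilon>^(1/a)\<close> the constant dominates; above it the
  factor \<open>v^(a - b)\<close> is largest at the threshold.\<close>

lemma powr_interpolate: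
  fixes a b \<epsilon> :: real
  assumes "0 < a" "a \<le> b" "\<epsilon> > 0"
  obtains C where "C \<ge> 0" "\<And>v. v \<ge> 0 \<Longrightarrow> v powr a \<le> \<epsilon> + C * v powr b"
proof
  define d where "d = \<epsilon> powr (1 / a)"
  have d: "d > 0" "d powr a = \<epsilon>" using assms by (simp_all add: d_def powr_powr)
  show "d powr (a - b) \<ge> 0" by simp
  fix v :: real
  assume v: "v \<ge> 0"
  show "v powr a \<le> \<epsilon> + d powr (a - b) * v powr b"
  proof (cases "v \<le> d")
    case True
    then have "v powr a \<le> d powr a" using v assms by (intro powr_mono2) auto
    then show ?thesis using d by (simp add: add_increasing2)
  next
    case False
    then have "v powr (a - b) \<le> d powr (a - b)"
      using assms d by (intro powr_mono2') auto
    then have "v powr (a - b) * v powr b \<le> d powr (a - b) * v powr b"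
      by (rule mult_right_mono) simp
    then show ?thesis using False d assms by (simp add: powr_diff)
  qed
qed

text \<open>The plain interpolation is applied to \<open>v * X^(2 m / b)\<close>. The last
  hypothesis says \<open>2 m a / b \<le> 2 m - 2\<close>, so for \<open>X \<le> 1\<close> the two
  factors of \<open>X\<close> lost by differentiating a cut-off do no harm.\<close>

lemma powr_interpolate_cutoff:
  fixes a b \<epsilon> :: real and m :: nat
  assumes "0 < a" "a \<le> b" "\<epsilon> > 0" "m \<ge> 2" "real m * a \<le> (real m - 1) * b"
  obtains C where "C \<ge> 0"
    "\<And>v X. v \<ge> 0 \<Longrightarrow> 0 \<le> X \<Longrightarrow> X \<le> 1 \<Longrightarrow> v powr a * X ^ (2 * m - 2) \<le> \<epsilon> + C * (v powr b * X ^ (2 * m))"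
proof -
  obtain C where C: "C \<ge> 0" "\<And>v. v \<ge> 0 \<Longrightarrow> v powr a \<le> \<epsilon> + C * v powr b"
    using powr_interpolate[OF assms(1-3)] by blast
  have "v powr a * X ^ (2 * m - 2) \<le> \<epsilon> + C * (v powr b * X ^ (2 * m))"
    if v: "v \<ge> 0" and X: "0 \<le> X" "X \<le> 1" for v X
  proof (cases "X = 0")
    case True
    then show ?thesis using assms by (simp add: power_0_left)
  next
    case False
    then have X0: "X > 0" using X by simp
    define V where "V = v * X powr (2 * real m / b)"
    have Vb: "V powr b = v powr b * X ^ (2 * m)"
      using v X0 assms unfolding V_def by (simp add: powr_mult powr_powr powr_realpow[symmetric])
    have "X ^ (2 * m - 2) = X powr (2 * real m - 2)"
      using X0 assms(4) by (simp add: powr_realpow[symmetric] of_nat_diff)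
    also have "\<dots> \<le> X powr (2 * real m / b * a)"
    proof (rule powr_mono')
      show "2 * real m / b * a \<le> 2 * real m - 2"
        using assms by (simp add: field_simps)
    qed (use X X0 in auto)
    finally have "v powr a * X ^ (2 * m - 2) \<le> v powr a * X powr (2 * real m / b * a)"
      by (intro mult_left_mono) auto
    also have "\<dots> = V powr a"
      using v X0 unfolding V_def by (simp add: powr_mult powr_powr)
    also have "\<dots> \<le> \<epsilon> + C * V powr b" using C(2) v X unfolding V_def by simp
    finally show ?thesis unfolding Vb .
  qed
  then show thesis using C(1) that by blast
qed

lemma DERIV_pos_part_power:
  "((\<lambda>x :: real. max 0 x ^ Suc (Suc n)) has_real_derivative real (Suc (Suc n)) * max 0 x ^ Suc n) (at x)"
proof (cases "x = 0")
  case True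
  have "((\<lambda>h :: real. max 0 h ^ Suc (Suc n) / h) \<longlongrightarrow> 0) (at 0)"
  proof (rule tendsto_rabs_zero_cancel, rule tendsto_sandwich[where f = "\<lambda>_. 0" and h = "\<lambda>h. max 0 h ^ Suc n"])
    have "isCont (\<lambda>h :: real. max 0 h ^ Suc n) 0" by (intro continuous_intros)
    then show "((\<lambda>h :: real. max 0 h ^ Suc n) \<longlongrightarrow> 0) (at 0)" by (simp add: isCont_def)
    show "eventually (\<lambda>h :: real. \<bar>max 0 h ^ Suc (Suc n) / h\<bar> \<le> max 0 h ^ Suc n) (at 0)"
    proof (intro always_eventually allI)
      fix h :: real
      show "\<bar>max 0 h ^ Suc (Suc n) / h\<bar> \<le> max 0 h ^ Suc n"
        by (cases "h > 0") (auto simp: max_def)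
    qed
  qed auto
  then show ?thesis using True by (simp add: DERIV_def)
next
  case False
  show ?thesis
  proof (cases "x > 0")
    case True
    have "((\<lambda>x. x ^ Suc (Suc n)) has_real_derivative real (Suc (Suc n)) * max 0 x ^ Suc n) (at x)"
      using True DERIV_pow[of "Suc (Suc n)" x UNIV] by (simp add: max_def)
    then show ?thesis
      by (rule has_field_derivative_transform_within_open[where S = "{0<..}"]) (use True in \<open>auto simp: max_def\<close>)
  next
    case f: False
    have "((\<lambda>x. 0) has_real_derivative real (Suc (Suc n)) * max 0 x ^ Suc n) (at x)"
      using f by (simp add: max_def)
    then show ?thesis
      by (rule has_field_derivative_transform_within_open[where S = "{..<0}"]) (use False f in \<open>auto simp: max_def\<close>)
  qed
qed

text \<open>The gauge ball lies in a box with half-sides \<open>R^(1/4)\<close> in the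
  \<open>x\<close> directions and \<open>R^(1/2)\<close> in \<open>y\<close>. The exponent is a
  quarter of the homogeneous dimension because \<open>W\<close> is the fourth power of the
  gauge.\<close>

lemma measure_W_le:
  assumes "R > 0"
  shows "measure lborel {z :: 'k::finite heis. W z \<le> R} \<le> 2 ^ (2 * CARD('k) + 1) * R powr ((real CARD('k) + 1) / 2)"
proof -
  define r where "r = R powr (1 / 4)"
  define d where "d = R powr (1 / 2)"
  have r: "r > 0" "d > 0" "r * r = d" "d * d = R" using assms by (simp_all add: r_def d_def flip: powr_add)
  let ?B = "cbox (- r *\<^sub>R One, - d) (r *\<^sub>R One, d) :: 'k heis set"
  have sub: "{z. W z \<le> R} \<subseteq> ?B"
  proof
    fix z :: "'k heis"
    assume "z \<in> {z. W z \<le> R}"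
    then have w: "(xsq z)\<^sup>2 + (snd z)\<^sup>2 \<le> R" by (simp add: W_def)
    moreover have d2: "d\<^sup>2 = R" using r(4) by (simp add: power2_eq_square)
    ultimately have "(snd z)\<^sup>2 \<le> d\<^sup>2" using zero_le_power2[of "xsq z"] by linarith
    then have y: "\<bar>snd z\<bar> \<le> d" using r by (simp add: abs_le_square_iff[symmetric])
    have "(xsq z)\<^sup>2 \<le> d\<^sup>2" using w d2 zero_le_power2[of "snd z"] by linarith
    then have "xsq z \<le> d" using r by (simp add: power2_le_iff_abs_le)
    then have "(norm (fst z))\<^sup>2 \<le> r\<^sup>2" using r by (simp add: xsq_def dot_square_norm power2_eq_square)
    then have "norm (fst z) \<le> r" using r by (simp add: power2_le_iff_abs_le)
    then have "\<bar>fst z \<bullet> i\<bar> \<le> r" if "i \<in> Basis" for i using Basis_le_norm[OF that] order_trans by blast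
    then have "fst z \<in> cbox (- r *\<^sub>R One) (r *\<^sub>R One)"
      by (auto simp: mem_box abs_le_iff) (metis minus_le_iff)
    then show "z \<in> ?B" using y by (cases z) (auto simp: cbox_Pair_eq abs_le_iff)
  qed
  have "measure lborel {z :: 'k heis. W z \<le> R} \<le> measure lborel ?B"
  proof (rule measure_mono_fmeasurable[OF sub])
    show "{z :: 'k heis. W z \<le> R} \<in> sets lborel"
      using borel_closed[OF closed_Collect_le[OF continuous_W continuous_on_const]] by simp
  qed simp
  also have "\<dots> = measure lborel (cbox (- r *\<^sub>R One) (r *\<^sub>R One) :: (real ^ ('k + 'k)) set) * measure lborel (cbox (- d) d)"
    by (rule content_Pair[of "- r *\<^sub>R One" "- d" "r *\<^sub>R One :: real ^ ('k + 'k)" d])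
  also have "measure lborel (cbox (- r *\<^sub>R One) (r *\<^sub>R One) :: (real ^ ('k + 'k)) set) = (\<Prod>b\<in>(Basis :: (real ^ ('k + 'k)) set). 2 * r)"
    using r by (subst content_cbox) (auto intro!: prod.cong)
  also have "\<dots> = (2 * r) ^ (2 * CARD('k))"
  proof -
    have "DIM(real ^ ('k + 'k)) = 2 * CARD('k)" by (simp add: card_UNIV_sum)
    then show ?thesis by (simp only: prod_constant)
  qed
  also have "\<dots> = ((2 * r)\<^sup>2) ^ CARD('k)" by (rule power_mult)
  also have "(2 * r)\<^sup>2 = 2\<^sup>2 * d" using r(3) by (simp add: power2_eq_square)
  also have "(2\<^sup>2 * d) ^ CARD('k) = 2 ^ (2 * CARD('k)) * d ^ CARD('k)"
    by (simp only: power_mult_distrib power_mult)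
  also have "measure lborel (cbox (- d) d) = 2 * d" using r by simp
  also have "2 ^ (2 * CARD('k)) * d ^ CARD('k) * (2 * d) = 2 ^ (2 * CARD('k) + 1) * d ^ Suc (CARD('k))"
    by simp
  also have "d ^ Suc (CARD('k)) = R powr ((real CARD('k) + 1) / 2)"
    using r by (subst powr_realpow[symmetric]) (simp_all add: d_def powr_powr add.commute)
  finally show ?thesis .
qed

text \<open>The density with respect to Lebesgue measure of the dilation invariant measure.\<close>

abbreviation ann_weight :: "'k::finite heis \<Rightarrow> real" where
  "ann_weight z \<equiv> exp (- ((real CARD('k) + 1) / 2) * ln (W z))"

abbreviation ann_const :: "'k::finite itself \<Rightarrow> real" where
  "ann_const k \<equiv> 2 ^ (2 * CARD('k) + 1) * exp ((real CARD('k) + 1) / 2)"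

lemma integrable_ann_weight:
  "integrable lborel (\<lambda>z :: 'k::finite heis. indicator (ann a b) z * ann_weight z)"
proof -
  have "continuous_on (ann a b) (ann_weight :: 'k heis \<Rightarrow> real)"
    by (intro continuous_intros continuous_W) (auto simp: ann_iff)
  from borel_integrable_compact[OF compact_ann this] show ?thesis by simp
qed

text \<open>The bound is independent of \<open>a\<close>: the value of the weight at the inner
  boundary cancels the growth of the volume.\<close>

lemma integral_ann_weight_unit:
  "(LINT z|lborel. indicator (ann a (a + 1)) z * ann_weight (z :: 'k::finite heis)) \<le> ann_const TYPE('k)"
proof -
  let ?k = "(real CARD('k) + 1) / 2"
  have m: "ann a (a + 1) \<in> sets (lborel :: 'k heis measure)" by (simp add: borel_closed compact_imp_closed compact_ann)
  have fin: "emeasure lborel (ann a (a + 1) :: 'k heis set) < \<infinity>"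
    using emeasure_compact_finite[OF compact_ann] by simp
  have "(LINT z|lborel. indicator (ann a (a + 1)) z * ann_weight (z :: 'k heis)) \<le> 
     (LINT z|lborel. indicator (ann a (a + 1)) (z :: 'k heis) * exp (- ?k * a))"
  proof (rule integral_mono[OF integrable_ann_weight])
    show "integrable lborel (\<lambda>z :: 'k heis. indicator (ann a (a + 1)) z * exp (- ?k * a))"
      using m fin by (intro integrable_mult_left) (simp add: integrable_indicator_iff)
    fix z :: "'k heis"
    show "indicator (ann a (a + 1)) z * ann_weight z \<le> indicator (ann a (a + 1)) z * exp (- ?k * a)"
      by (auto simp: indicator_def ann_iff intro!: mult_left_mono)
  qed
  also have "\<dots> = measure lborel (ann a (a + 1) :: 'k heis set) * exp (- ?k * a)"
    using m by simp
  also have "measure lborel (ann a (a + 1) :: 'k heis set) \<le> measure lborel {z :: 'k heis. W z \<le> exp (a + 1)}"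
  proof (rule measure_mono_fmeasurable)
    show "{z :: 'k heis. W z \<le> exp (a + 1)} \<in> fmeasurable lborel"
      by (rule fmeasurable_compact[OF compact_W_le])
  qed (use m in \<open>auto simp: ann_def\<close>)
  also have "\<dots> \<le> 2 ^ (2 * CARD('k) + 1) * exp (a + 1) powr ?k"
    by (rule measure_W_le) simp
  finally have "(LINT z|lborel. indicator (ann a (a + 1)) z * ann_weight (z :: 'k heis)) \<le>
      2 ^ (2 * CARD('k) + 1) * exp (a + 1) powr ?k * exp (- ?k * a)" by (simp add: mult_right_mono)
  also have "\<dots> = ann_const TYPE('k)"
    by (simp add: powr_def algebra_simps flip: exp_add)
  finally show ?thesis .
qed

lemma integral_ann_weight_mono:
  assumes "a' \<le> a" "b \<le> b'"
  shows "(LINT z|lborel. indicator (ann a b) z * ann_weight (z :: 'k::finite heis)) \<le> (LINT z|lborel. indicator (ann a' b') z * ann_weight (z :: 'k heis))"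
  by (rule integral_mono[OF integrable_ann_weight integrable_ann_weight]) (use assms in \<open>auto simp: indicator_def ann_iff\<close>)

lemma integral_ann_weight_le:
  assumes "a \<le> b"
  shows "(LINT z|lborel. indicator (ann a b) z * ann_weight (z :: 'k::finite heis)) \<le> ann_const TYPE('k) * (b - a + 1)"
proof -
  have step: "(LINT z|lborel. indicator (ann a (a + real (Suc n))) z * ann_weight (z :: 'k heis)) \<le> ann_const TYPE('k) * real (Suc n)" for n
  proof (induction n)
    case 0
    then show ?case using integral_ann_weight_unit[of a] by simp
  next
    case (Suc n)
    let ?c = "a + real (Suc n)"
    have "(LINT z|lborel. indicator (ann a (a + real (Suc (Suc n)))) z * ann_weight (z :: 'k heis)) \<le> 
      (LINT z|lborel. indicator (ann a ?c) z * ann_weight (z :: 'k heis) + indicator (ann ?c (?c + 1)) z * ann_weight (z :: 'k heis))"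
      by (rule integral_mono[OF integrable_ann_weight Bochner_Integration.integrable_add[OF integrable_ann_weight integrable_ann_weight]])
         (auto simp: indicator_def ann_iff)
    also have "\<dots> \<le> ann_const TYPE('k) * real (Suc n) + ann_const TYPE('k)"
      using Suc integral_ann_weight_unit[of ?c, where 'k = 'k] integrable_ann_weight[where 'k = 'k]
      by (subst Bochner_Integration.integral_add) (auto intro: add_mono)
    also have "\<dots> = ann_const TYPE('k) * real (Suc (Suc n))" by (simp add: algebra_simps)
    finally show ?case .
  qed
  \<comment> \<open>The annulus is covered by \<open>Suc n\<close> annuli of unit length; the
    partial last one accounts for the \<open>+ 1\<close> in the bound.\<close>
  define n where "n = nat \<lfloor>b - a\<rfloor>"
  have n: "b \<le> a + real (Suc n)" "real (Suc n) \<le> b - a + 1"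
    using assms by (auto simp: n_def) linarith+
  have "(LINT z|lborel. indicator (ann a b) z * ann_weight (z :: 'k heis)) \<le> ann_const TYPE('k) * real (Suc n)"
    by (rule order_trans[OF integral_ann_weight_mono step]) (use n in auto)
  also have "\<dots> \<le> ann_const TYPE('k) * (b - a + 1)"
    using n by (intro mult_left_mono) auto
  finally show ?thesis .
qed

section \<open>Decay of stable solutions\<close>

text \<open>A parabolic cap of height 1 on the interval from \<open>3/2 T\<close> to
  \<open>7/2 T\<close>. It is at least \<open>3/4\<close> between \<open>2 T\<close> and
  \<open>3 T\<close>, where the outer slope of the plateau used later is located.\<close>

definition hat :: "real \<Rightarrow> real \<Rightarrow> real" where
  "hat T t = max 0 (1 - ((t - 5 / 2 * T) / T)\<^sup>2)"

lemma hat_range: "0 \<le> hat T t" "hat T t \<le> 1"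
  by (auto simp: hat_def)

lemma hat_pos:
  assumes "T > 0" "hat T t > 0"
  shows "\<bar>(t - 5 / 2 * T) / T\<bar> \<le> 1"
  using assms abs_le_square_iff[of "(t - 5 / 2 * T) / T" 1] by (auto simp: hat_def max_def split: if_splits)

lemma hat_outside:
  assumes "T > 0" "t \<notin> {3 / 2 * T..7 / 2 * T}"
  shows "hat T t = 0"
proof (rule ccontr)
  assume "hat T t \<noteq> 0"
  then have "\<bar>(t - 5 / 2 * T) / T\<bar> \<le> 1"
    using hat_pos[OF assms(1)] hat_range(1)[of T t] by auto
  then show False using assms by (auto simp: abs_le_iff field_simps)
qed

lemma continuous_hat: "T > 0 \<Longrightarrow> continuous_on S (hat T)"
  unfolding hat_def[abs_def] by (intro continuous_intros) auto

lemma cutoff_hat_power: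
  assumes "T > 0" "r \<ge> 1" "continuous_on UNIV f"
  shows "cutoff (3 / 2 * T) (7 / 2 * T) (\<lambda>t. f t * hat T t ^ r)"
  using assms hat_outside[of T] unfolding cutoff_def
  by (auto intro!: continuous_intros continuous_hat simp: power_0_left)

lemma hat_ge:
  assumes "T > 0" "t \<in> {2 * T..3 * T}"
  shows "hat T t \<ge> 3 / 4"
proof -
  have "\<bar>(t - 5 / 2 * T) / T\<bar> \<le> 1 / 2"
    using assms by (auto simp: abs_le_iff field_simps)
  then have "((t - 5 / 2 * T) / T)\<^sup>2 \<le> (1 / 2)\<^sup>2"
    by (simp add: abs_le_square_iff[symmetric])
  moreover have "(1 / 2 :: real)\<^sup>2 = 1 / 4" by (simp add: power2_eq_square)
  ultimately have "3 / 4 \<le> 1 - ((t - 5 / 2 * T) / T)\<^sup>2" by linarith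
  then show ?thesis unfolding hat_def by (rule max.coboundedI2)
qed

lemma DERIV_hat_power:
  assumes "T > 0"
  shows "((\<lambda>t. hat T t ^ Suc (Suc n)) has_real_derivative
     real (Suc (Suc n)) * hat T t ^ Suc n * (- 2 * ((t - 5 / 2 * T) / T) / T)) (at t)"
proof -
  have "((\<lambda>t. 1 - ((t - 5 / 2 * T) / T)\<^sup>2) has_real_derivative (- 2 * ((t - 5 / 2 * T) / T) / T)) (at t)"
  proof -
    have "((\<lambda>t. (t - 5 / 2 * T) / T) has_real_derivative 1 / T) (at t)"
      using assms by (auto intro!: derivative_eq_intros)
    then show ?thesis
      by (rule DERIV_cong[OF DERIV_diff[OF DERIV_const DERIV_power[of _ _ _ _ 2]]])
         (use assms in \<open>simp add: field_simps\<close>)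
  qed
  from DERIV_chain2[OF DERIV_pos_part_power this, of n] show ?thesis unfolding hat_def .
qed

context
  fixes n :: nat and T :: real
  assumes T: "T \<ge> 1"
begin

text \<open>A power of at least three makes \<open>eta\<close> twice continuously differentiable, as
  Farina's estimate needs for the derivative of \<open>eta * eta'\<close>.\<close>

abbreviation eta :: "real \<Rightarrow> real" where "eta \<equiv> \<lambda>t. hat T t ^ (n + 3)"
definition eta' :: "real \<Rightarrow> real" where 
  "eta' t = real (n + 3) * hat T t ^ (n + 2) * (- 2 * ((t - 5 / 2 * T) / T) / T)"
definition eta'' :: "real \<Rightarrow> real" where 
  "eta'' t = real (n + 3) * (hat T t ^ (n + 2) * (- 2 / T\<^sup>2) +
      real (n + 2) * hat T t ^ (n + 1) * (- 2 * ((t - 5 / 2 * T) / T) / T) * (- 2 * ((t - 5 / 2 * T) / T) / T))"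

lemma bump_eta: "bump (3 / 2 * T) (7 / 2 * T) eta eta'" "bump (3 / 2 * T) (7 / 2 * T) eta' eta''"
proof -
  have T0: "T > 0" using T by simp
  have o: "hat T t = 0" if "t \<notin> {3 / 2 * T..7 / 2 * T}" for t using hat_outside[OF T0 that] .
  have "(eta has_real_derivative eta' t) (at t)" for t
    using DERIV_hat_power[OF T0, of "Suc n" t] by (simp add: eta'_def numeral_3_eq_3)
  moreover have "continuous_on UNIV eta'"
    unfolding eta'_def[abs_def] using T0 by (intro continuous_intros continuous_hat) auto
  ultimately show "bump (3 / 2 * T) (7 / 2 * T) eta eta'"
    using o by (auto simp: bump_def)
  have "((\<lambda>t. hat T t ^ (n + 2)) has_real_derivative real (n + 2) * hat T t ^ (n + 1) * (- 2 * ((t - 5 / 2 * T) / T) / T)) (at t)" for t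
    using DERIV_hat_power[OF T0, of n t] by (simp add: numeral_2_eq_2)
  moreover have "((\<lambda>t. - 2 * ((t - 5 / 2 * T) / T) / T) has_real_derivative - 2 / T\<^sup>2) (at t)" for t
    using T0 by (auto intro!: derivative_eq_intros simp: power2_eq_square)
  ultimately have "((\<lambda>t. real (n + 3) * (hat T t ^ (n + 2) * (- 2 * ((t - 5 / 2 * T) / T) / T))) has_real_derivative eta'' t) (at t)" for t
    unfolding eta''_def by (intro DERIV_cmult DERIV_mult')
  then have "(eta' has_real_derivative eta'' t) (at t)" for t
    unfolding eta'_def[abs_def] by (simp only: mult.assoc)
  moreover have "continuous_on UNIV eta''"
    unfolding eta''_def[abs_def] using T0 by (intro continuous_intros continuous_hat) auto
  ultimately show "bump (3 / 2 * T) (7 / 2 * T) eta' eta''"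
    using o by (auto simp: bump_def eta'_def)
qed

text \<open>Two derivatives cost at most two factors of \<open>hat\<close>, which leaves the
  exponent \<open>2 m - 2\<close> for \<open>m = n + 3\<close>. Only one power of
  \<open>1 / T\<close> is kept, because it already balances the invariant measure of the
  annulus.\<close>

lemma eta_bounds:
  defines "B \<equiv> 6 * (real (n + 3))\<^sup>2"
  shows "\<bar>eta t * eta' t\<bar> \<le> B / T * hat T t ^ (2 * (n + 3) - 2)" (is ?A)
    and "(eta' t)\<^sup>2 \<le> B / T * hat T t ^ (2 * (n + 3) - 2)" (is ?B)
    and "\<bar>eta t * eta'' t\<bar> \<le> B / T * hat T t ^ (2 * (n + 3) - 2)" (is ?C)
proof -
  define d where "d = (t - 5 / 2 * T) / T"
  define h where "h = hat T t"
  define m where "m = real (n + 3)"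
  have m: "m \<ge> 3" "real (n + 2) = m - 1" by (simp_all add: m_def)
  have T1: "1 / T \<le> 1" "0 < T" using T by auto
  have h01: "0 \<le> h" "h \<le> 1" using hat_range by (simp_all add: h_def)
  have "?A \<and> ?B \<and> ?C"
  proof (cases "h = 0")
    case True
    then show ?thesis using T by (simp add: h_def eta'_def power_0_left B_def)
  next
    case False
    then have d: "\<bar>d\<bar> \<le> 1" using hat_pos[of T t] h01 T by (simp add: h_def d_def)
    then have d2: "d\<^sup>2 \<le> 1" by (simp add: abs_square_le_1)
    define P where "P = h ^ (2 * n + 4)"
    have P: "P \<ge> 0" "h * P \<le> P" using h01 by (auto simp: P_def mult_left_le_one_le)
    have e: "2 * (n + 3) - 2 = 2 * n + 4" by simp
    have "h ^ (n + 3) * h ^ (n + 2) = h ^ Suc (2 * n + 4)"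
      unfolding power_add[symmetric] by (rule arg_cong[of _ _ "power h"]) simp
    then have P1: "h ^ (n + 3) * h ^ (n + 2) = h * P" by (simp only: P_def power_Suc)
    have P3: "h ^ (n + 3) * h ^ (n + 1) = P"
      unfolding power_add[symmetric] P_def by (rule arg_cong[of _ _ "power h"]) simp
    have P2: "(h ^ (n + 2))\<^sup>2 = P"
      unfolding power_mult[symmetric] P_def by (rule arg_cong[of _ _ "power h"]) simp
    note u = eta'_def eta''_def h_def[symmetric] d_def[symmetric] m_def[symmetric] m(2)
    have A: "eta t * eta' t = (h * P) * (- 2 * m * d / T)"
    proof -
      have "x * (m * y * (- 2 * d / T)) = (x * y) * (- 2 * m * d / T)" for x y by simp
      then show ?thesis unfolding u P1[symmetric] .
    qed
    have B: "(eta' t)\<^sup>2 = P * (4 * m\<^sup>2 * d\<^sup>2 / T\<^sup>2)"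
    proof -
      have "(m * y * (- 2 * d / T))\<^sup>2 = y\<^sup>2 * (4 * m\<^sup>2 * d\<^sup>2 / T\<^sup>2)" for y by (simp add: power2_eq_square)
      then show ?thesis unfolding u P2[symmetric] .
    qed
    have C: "eta t * eta'' t = m * ((h * P) * (- 2 / T\<^sup>2) + (m - 1) * P * (4 * d\<^sup>2 / T\<^sup>2))"
    proof -
      have "x * (m * (y * (- 2 / T\<^sup>2) + (m - 1) * w * (- 2 * d / T) * (- 2 * d / T))) =
        m * ((x * y) * (- 2 / T\<^sup>2) + (m - 1) * (x * w) * (4 * d\<^sup>2 / T\<^sup>2))" for x y w
      proof -
        have "(- 2 * d / T) * (- 2 * d / T) = 4 * d\<^sup>2 / T\<^sup>2" by (simp add: power2_eq_square)
        moreover have "x * (m * (y * s + (m - 1) * w * b * b)) = m * ((x * y) * s + (m - 1) * (x * w) * (b * b))" for s b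
          by (simp add: algebra_simps)
        ultimately show ?thesis by metis
      qed
      from this[of "h ^ (n + 3)" "h ^ (n + 2)" "h ^ (n + 1)"] show ?thesis unfolding u P1 P3 .
    qed
    have iT: "1 / T\<^sup>2 \<le> 1 / T" using T by (simp add: power2_eq_square field_simps)
    have m2: "m \<le> m\<^sup>2" using m by (simp add: power2_eq_square)
    have "\<bar>eta t * eta' t\<bar> = (h * P) * (2 * m * \<bar>d\<bar> / T)"
      unfolding A using h01 P m T1 by (simp add: abs_mult)
    also have "\<dots> \<le> P * (6 * m\<^sup>2 / T)"
    proof (rule mult_mono)
      have "2 * m * \<bar>d\<bar> \<le> 2 * m * 1" using d m by (intro mult_left_mono) auto
      then have "2 * m * \<bar>d\<bar> \<le> 6 * m\<^sup>2" using m2 m by linarith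
      then show "2 * m * \<bar>d\<bar> / T \<le> 6 * m\<^sup>2 / T" using T1 by (intro divide_right_mono) auto
    qed (use P m T1 in auto)
    finally have 1: ?A unfolding e P_def[symmetric, unfolded h_def] B_def m_def[symmetric]
      by (simp add: P_def h_def mult_ac)
    have "4 * m\<^sup>2 * d\<^sup>2 / T\<^sup>2 = 4 * m\<^sup>2 * d\<^sup>2 * (1 / T\<^sup>2)" by simp
    also have "\<dots> \<le> 6 * m\<^sup>2 * 1 * (1 / T)"
      using iT d2 m T1 by (intro mult_mono) auto
    finally have "P * (4 * m\<^sup>2 * d\<^sup>2 / T\<^sup>2) \<le> P * (6 * m\<^sup>2 * 1 * (1 / T))" using P by (intro mult_left_mono) auto
    then have 2: ?B unfolding B e B_def m_def[symmetric]
      by (simp add: P_def h_def mult_ac)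
    have "\<bar>eta t * eta'' t\<bar> \<le> m * ((h * P) * (2 / T\<^sup>2) + (m - 1) * P * (4 * d\<^sup>2 / T\<^sup>2))"
      unfolding C abs_mult using m h01 P
      by (intro mult_mono order_trans[OF abs_triangle_ineq] add_mono) (auto simp: abs_mult)
    also have "\<dots> \<le> m * (P * (2 / T\<^sup>2) + (m - 1) * P * (4 * 1 / T\<^sup>2))"
      using m h01 P d2 by (intro mult_left_mono add_mono mult_right_mono divide_right_mono) auto
    also have "\<dots> = P * (m * (4 * m - 2) * (1 / T\<^sup>2))" by (simp add: divide_inverse algebra_simps)
    also have "\<dots> \<le> P * (6 * m\<^sup>2 * (1 / T))"
    proof (rule mult_left_mono[OF mult_mono[OF _ iT]])
      show "m * (4 * m - 2) \<le> 6 * m\<^sup>2"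
      proof -
        have "m * (4 * m - 2) = 4 * m\<^sup>2 - 2 * m" by (simp add: power2_eq_square algebra_simps)
        then show ?thesis using m(1) zero_le_power2[of m] by linarith
      qed
    qed (use P T1 in auto)
    finally have 3: ?C unfolding e B_def m_def[symmetric]
      by (simp add: P_def h_def mult_ac)
    show ?thesis using 1 2 3 by blast
  qed
  then show ?A ?B ?C by blast+
qed

end

text \<open>
  Farina's exponent \<open>\<gamma>\<close> will be \<open>1\<close> for subcritical and \<open>k (p - 1) - 1\<close> for supercritical \<open>p\<close>. With these
  choices the test function needs no power weight in the gauge. The condition on \<open>n\<close> lets the
  derivatives of the cut-off \<open>hat T t ^ (n + 3)\<close> be absorbed by Young's inequality.
\<close>

locale stable_tail = cylindrical_solution u p for u :: "'k::finite heis \<Rightarrow> real" and p +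
  fixes \<gamma> a0 :: real and n :: nat
  assumes \<gamma>: "\<gamma> \<ge> 1" and \<Gamma>: "(\<gamma> + 1)\<^sup>2 / (4 * \<gamma>) < p"
    and dimension: "(\<gamma> - 1) / (p - 1) < real CARD('k)" "real CARD('k) \<le> (\<gamma> + 1) / (p - 1)"
    and n: "real (n + 3) * (\<gamma> + 1) \<le> (real (n + 3) - 1) * (p + \<gamma>)"
    and stable: "\<And>\<phi> a b. a0 \<le> a \<Longrightarrow> C1 \<phi> \<Longrightarrow> (\<And>z. z \<notin> ann a b \<Longrightarrow> \<phi> z = 0) \<Longrightarrow>
      (LINT z|lborel. p * \<bar>u z\<bar> powr (p - 1) * (\<phi> z)\<^sup>2) \<le> (LINT z|lborel. hsq \<phi> z)"
begin

text \<open>The equation is invariant when \<open>u\<close> scales with degree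
  \<open>- 2 * \<alpha>\<close> under dilations. For the chosen values of \<open>\<gamma>\<close>,
  \<open>\<beta>\<close> vanishes in the supercritical range and \<open>\<sigma>\<close> in the
  subcritical one.\<close>

definition \<alpha> where "\<alpha> = 1 / (p - 1)"
definition \<beta> where "\<beta> = (real CARD('k) - (\<gamma> + 1) / (p - 1)) / 2"
definition \<sigma> where "\<sigma> = \<beta> + \<alpha> - real CARD('k) / 2"
definition \<omega> where "\<omega> = \<beta> - (real CARD('k) + 1) / 2"

lemma \<alpha>: "\<alpha> > 0" "\<alpha> * (p - 1) = 1" using p by (auto simp: \<alpha>_def)

text \<open>The two halves of \<open>dimension\<close>. The first puts \<open>W^\<omega>\<close>
  below the invariant density far out; the second leaves a positive power of \<open>W\<close> to
  spare over that density near the origin.\<close>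

lemma \<beta>: "\<beta> \<le> 0" "\<beta> + \<alpha> > 0"
proof -
  have "(\<gamma> + 1) / (p - 1) = (\<gamma> - 1) / (p - 1) + 2 * \<alpha>"
    by (simp add: \<alpha>_def diff_divide_distrib add_divide_distrib)
  moreover have "(k - x) / 2 \<le> 0 \<and> 0 < (k - x) / 2 + a" if "x = y + 2 * a" "y < k" "k \<le> x" for k x y a :: real
    using that by (simp add: field_simps)
  ultimately show "\<beta> \<le> 0" "\<beta> + \<alpha> > 0"
    using dimension unfolding \<beta>_def by blast+
qed

text \<open>
  In terms of the scale invariant \<open>v = W\<^bsup>\<alpha>/2\<^esup> \<bar>u\<bar>\<close>, each weighted power of \<open>u\<close> below is a power of \<open>v\<close> times \<open>W\<^bsup>\<omega>\<^esup>\<close>.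
\<close>

lemma weights: "\<omega> + \<alpha> * (p + \<gamma>) / 2 = 0" "\<omega> + \<alpha> * (\<gamma> + 1) / 2 = - (1 / 2)"
  "\<omega> + \<alpha> * (p + 1) / 2 = \<sigma>" "\<omega> + \<alpha> * 2 / 2 = \<sigma> - 1 / 2"
proof -
  have "2 * \<beta> = real CARD('k) - \<alpha> * (\<gamma> + 1)" by (simp add: \<beta>_def \<alpha>_def)
  moreover have "\<alpha> * (p + \<gamma>) = \<alpha> * (\<gamma> + 1) + 1" using \<alpha>(2) by (simp add: algebra_simps)
  moreover have "\<alpha> * (p + 1) = 2 * \<alpha> + 1" using \<alpha>(2) by (simp add: algebra_simps)
  ultimately show "\<omega> + \<alpha> * (p + \<gamma>) / 2 = 0" "\<omega> + \<alpha> * (\<gamma> + 1) / 2 = - (1 / 2)"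
    "\<omega> + \<alpha> * (p + 1) / 2 = \<sigma>" "\<omega> + \<alpha> * 2 / 2 = \<sigma> - 1 / 2"
    by (simp_all add: \<omega>_def \<sigma>_def field_simps)
qed

lemma continuous_u_powr: "a > 0 \<Longrightarrow> continuous_on UNIV (\<lambda>z. \<bar>u z\<bar> powr a)"
  by (rule continuous_on_compose2[OF continuous_abs_powr[of a UNIV] continuous_u]) auto

text \<open>No power of the gauge appears because the exponents cancel in
  \<open>weights(1)\<close>.\<close>

definition tail_mass where
  "tail_mass T = (LINT z|lborel. \<bar>u z\<bar> powr (p + \<gamma>) * rad (\<lambda>t. hat T t ^ (2 * (n + 3))) z)"

lemma integrable_u_hat:
  "T > 0 \<Longrightarrow> r \<ge> 1 \<Longrightarrow> a > 0 \<Longrightarrow> integrable lborel (\<lambda>z. \<bar>u z\<bar> powr a * rad (\<lambda>t. exp (w * t) * hat T t ^ r) z)"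
  by (intro integrable_rad[OF continuous_u_powr cutoff_hat_power]) (auto intro!: continuous_intros)

lemma tail_mass_nonneg: "tail_mass T \<ge> 0"
  unfolding tail_mass_def by (intro Bochner_Integration.integral_nonneg) (auto simp: rad_def hat_range)

text \<open>The exponential weight is the one that turns the integrand into
  \<open>v^a * W^\<omega>\<close>, so a pointwise inequality between powers of \<open>v\<close> can
  be integrated. Its constant part is charged to the invariant measure of the annulus, of order
  \<open>T\<close>.\<close>

lemma interp_integral:
  assumes T: "T \<ge> 1" and r: "r \<ge> 1" and a: "a > 0" and C: "C \<ge> 0" "\<epsilon> \<ge> 0"
    and i: "\<And>v X. v \<ge> 0 \<Longrightarrow> 0 \<le> X \<Longrightarrow> X \<le> 1 \<Longrightarrow> v powr a * X ^ r \<le> \<epsilon> + C * (v powr (p + \<gamma>) * X ^ (2 * (n + 3)))"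
  shows "(LINT z|lborel. \<bar>u z\<bar> powr a * rad (\<lambda>t. exp ((\<omega> + \<alpha> * a / 2) * t) * hat T t ^ r) z) 
    \<le> \<epsilon> * ann_const TYPE('k) * (3 * T) + C * tail_mass T"
proof -
  let ?w = "\<lambda>t. exp ((\<omega> + \<alpha> * a / 2) * t) * hat T t ^ r"
  let ?m = "\<lambda>t. hat T t ^ (2 * (n + 3))"
  let ?A = "ann (3 / 2 * T) (7 / 2 * T) :: 'k heis set"
  have T0: "T > 0" using T by simp
  have b: "p + \<gamma> > 0" using p \<gamma> by simp
  have iY: "integrable lborel (\<lambda>z. \<bar>u z\<bar> powr (p + \<gamma>) * rad ?m z)"
    using integrable_u_hat[of T "2 * (n + 3)" "p + \<gamma>" 0] T0 b by simp
  have "(LINT z|lborel. \<bar>u z\<bar> powr a * rad ?w z) \<le>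
     (LINT z|lborel. \<epsilon> * (indicator ?A z * ann_weight z) 
        + C * (\<bar>u z\<bar> powr (p + \<gamma>) * rad ?m z))"
  proof (rule integral_mono)
    show "integrable lborel (\<lambda>z. \<bar>u z\<bar> powr a * rad ?w z)"
      by (rule integrable_u_hat) (use T0 r a in auto)
    show "integrable lborel (\<lambda>z. \<epsilon> * (indicator ?A z * ann_weight z) 
        + C * (\<bar>u z\<bar> powr (p + \<gamma>) * rad ?m z))"
      by (intro Bochner_Integration.integrable_add integrable_mult_right integrable_ann_weight iY)
    fix z :: "'k heis"
    show "\<bar>u z\<bar> powr a * rad ?w z \<le> \<epsilon> * (indicator ?A z * ann_weight z) 
        + C * (\<bar>u z\<bar> powr (p + \<gamma>) * rad ?m z)"
    proof (cases "z \<in> ?A")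
      case False
      have "rad ?w z = 0"
        by (rule rad_outside[OF cutoff_hat_power False]) (use T0 r in \<open>auto intro!: continuous_intros\<close>)
      moreover have "rad ?m z = 0"
        using rad_outside[OF cutoff_hat_power[of T "2 * (n + 3)" "\<lambda>_. 1"] False] T0 by simp
      ultimately show ?thesis using False by simp
    next
      case True
      define t where "t = ln (W z)"
      have z: "z \<noteq> 0" "t \<ge> 0" using True T by (auto simp: ann_iff t_def)
      define v where "v = \<bar>u z\<bar> * exp (\<alpha> * t / 2)"
      have v: "v powr s * exp (\<omega> * t) = \<bar>u z\<bar> powr s * exp ((\<omega> + \<alpha> * s / 2) * t)" for s
        by (simp add: v_def powr_mult powr_def[of "exp _"] distrib_right flip: exp_add)
      have "\<bar>u z\<bar> powr a * rad ?w z = (v powr a * hat T t ^ r) * exp (\<omega> * t)"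
        using z v[of a] by (simp add: rad_def t_def[symmetric] mult_ac)
      also have "\<dots> \<le> (\<epsilon> + C * (v powr (p + \<gamma>) * hat T t ^ (2 * (n + 3)))) * exp (\<omega> * t)"
        by (intro mult_right_mono i hat_range) (auto simp: v_def)
      also have "\<dots> = \<epsilon> * exp (\<omega> * t) + C * ((v powr (p + \<gamma>) * exp (\<omega> * t)) * hat T t ^ (2 * (n + 3)))"
        by (simp add: algebra_simps)
      also have "(v powr (p + \<gamma>) * exp (\<omega> * t)) * hat T t ^ (2 * (n + 3)) = 
          \<bar>u z\<bar> powr (p + \<gamma>) * rad ?m z"
        using z unfolding v weights(1) by (simp add: rad_def t_def)
      \<comment> \<open>Uses \<open>\<beta> \<le> 0\<close> together with \<open>t \<ge> 0\<close>
        on the annulus.\<close>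
      also have "exp (\<omega> * t) \<le> ann_weight z"
        using z \<beta> by (simp add: \<omega>_def t_def[symmetric] algebra_simps mult_nonneg_nonpos)
      finally show ?thesis using True C by (simp add: mult_left_mono)
    qed
  qed
  also have "\<dots> = \<epsilon> * (LINT z|lborel. indicator ?A z * ann_weight z) + C * tail_mass T"
    using iY integrable_ann_weight[where 'k = 'k] by (simp add: tail_mass_def)
  also have "(LINT z|lborel. indicator ?A z * ann_weight z) \<le> ann_const TYPE('k) * (3 * T)"
    using integral_ann_weight_le[of "3 / 2 * T" "7 / 2 * T", where 'k = 'k] T
    by (rule_tac order_trans) (auto intro!: mult_left_mono)
  finally show ?thesis using C by (simp add: mult_left_mono mult.assoc)
qed

abbreviation mm :: nat where "mm \<equiv> n + 3"
abbreviation BB :: real where "BB \<equiv> 6 * (real (n + 3))\<^sup>2"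

text \<open>The sign of the bracket is unknown, so it is bounded by absolute values; its factor lies
  between 0 and 1. The constant collects \<open>16 + 32\<close> and \<open>8 k\<close>.\<close>

lemma farina_weight_le:
  fixes e e1 e2 N :: real
  assumes "\<bar>e * e1\<bar> \<le> N" "e1\<^sup>2 \<le> N" "\<bar>e * e2\<bar> \<le> N"
  shows "16 * e1\<^sup>2 - (\<gamma> - 1) / (2 * \<gamma>) * (16 * (e * e2 + e1 * e1) + 8 * real CARD('k) * (e * e1))
      \<le> (48 + 8 * real CARD('k)) * N"
proof -
  define \<theta> where "\<theta> = (\<gamma> - 1) / (2 * \<gamma>)"
  have \<theta>: "0 \<le> \<theta>" "\<theta> \<le> 1" using \<gamma> by (auto simp: \<theta>_def divide_le_eq)
  let ?r = "16 * (e * e2 + e1 * e1) + 8 * real CARD('k) * (e * e1)"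
  let ?R = "32 * N + 8 * real CARD('k) * N"
  have N: "N \<ge> 0" using assms(2) zero_le_power2[of e1] by linarith
  have "real CARD('k) * - (e * e1) \<le> real CARD('k) * N"
    using assms(1) by (intro mult_left_mono) auto
  moreover have "- (e * e2) \<le> N" using assms(3) by linarith
  moreover have "- ?r = 16 * - (e * e2) - 16 * e1\<^sup>2 + 8 * (real CARD('k) * - (e * e1))"
    by (simp add: power2_eq_square)
  moreover have "?R = 32 * N + 8 * (real CARD('k) * N)" by simp
  ultimately have r: "- ?r \<le> ?R"
    using N zero_le_power2[of e1] by linarith
  have "\<theta> * (- ?r) \<le> \<theta> * ?R" using \<theta> r by (intro mult_left_mono) auto
  also have "\<dots> \<le> 1 * ?R" using \<theta> N by (intro mult_right_mono) auto
  finally have "- (\<theta> * ?r) \<le> 1 * ?R" by (simp only: mult_minus_right)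
  moreover have "16 * e1\<^sup>2 \<le> 16 * N" using assms(2) by simp
  ultimately have "16 * e1\<^sup>2 + - (\<theta> * ?r) \<le> 16 * N + 1 * ?R" by (rule add_mono[rotated])
  then show ?thesis unfolding \<theta>_def[symmetric] by (simp add: distrib_right)
qed

text \<open>In Farina's estimate the cut-off costs a factor \<open>1 / T\<close>. Interpolating its
  right-hand side yields a constant part of order \<open>T\<close>, hence a bounded contribution,
  and a multiple of the mass itself with a factor \<open>1 / T\<close>, which is absorbed for large
  \<open>T\<close>.\<close>

lemma tail_bound: "\<exists>C T0. C \<ge> 0 \<and> (\<forall>T\<ge>T0. tail_mass T \<le> C)"
proof -
  have a: "0 < \<gamma> + 1" "\<gamma> + 1 \<le> p + \<gamma>" "(0::real) < 1" "2 \<le> mm" "real mm * (\<gamma> + 1) \<le> (real mm - 1) * (p + \<gamma>)"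
    using \<gamma> p n by auto
  obtain C3 where C3: "C3 \<ge> 0" "\<And>v X. v \<ge> 0 \<Longrightarrow> 0 \<le> X \<Longrightarrow> X \<le> 1 \<Longrightarrow>
      v powr (\<gamma> + 1) * X ^ (2 * mm - 2) \<le> 1 + C3 * (v powr (p + \<gamma>) * X ^ (2 * mm))"
    using powr_interpolate_cutoff[OF a] by blast
  define C2 where "C2 = (48 + 8 * real CARD('k)) * BB"
  have C2: "C2 \<ge> 0" by (simp add: C2_def)
  define G where "G = p - (\<gamma> + 1)\<^sup>2 / (4 * \<gamma>)"
  have G: "G > 0" using \<Gamma> by (simp add: G_def)
  \<comment> \<open>The entry \<open>a0\<close> keeps the test functions where stability is
    available; the last entry lets the left-hand side absorb the mass term, with half of
    \<open>G\<close> to spare.\<close>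
  define T0 where "T0 = max (max 1 a0) (2 * C2 * C3 / G)"
  have "tail_mass T \<le> 2 * C2 * 3 * ann_const TYPE('k) / G" if T: "T \<ge> T0" for T
  proof -
    let ?w = "\<lambda>t. exp ((\<omega> + \<alpha> * (\<gamma> + 1) / 2) * t) * hat T t ^ (2 * mm - 2)"
    have T1: "T \<ge> 1" "a0 \<le> 3 / 2 * T" "C2 * C3 / T \<le> G / 2"
      using T G by (auto simp: T0_def field_simps)
    note b = bump_eta[OF T1(1), of n]
    note bb = bump_mult[OF b]
    let ?h' = "\<lambda>t. eta n T t * eta'' n T t + eta' n T t * eta' n T t"
    define \<theta> where "\<theta> = (\<lambda>t. 16 * (eta' n T t)\<^sup>2 - (\<gamma> - 1) / (2 * \<gamma>) * (16 * ?h' t + 8 * real CARD('k) * (eta n T t * eta' n T t)))"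
    have \<theta>: "\<theta> t \<le> C2 / T * hat T t ^ (2 * mm - 2)" for t
      using farina_weight_le[OF eta_bounds[OF T1(1), where n = n and t = t]] by (simp add: \<theta>_def C2_def mult_ac)
    have cut: "cutoff (3 / 2 * T) (7 / 2 * T) \<theta>"
    proof -
      have c: "cutoff a b (\<lambda>t. 16 * (f t)\<^sup>2 - x * (16 * g t + y * h t))"
        if "cutoff a b f" "cutoff a b g" "cutoff a b h" for a b f g h x y
        using that by (auto simp: cutoff_def intro!: continuous_intros)
      show ?thesis unfolding \<theta>_def
        by (intro c cutoff_bump(2)[OF b(1)] cutoff_bump[OF bb])
    qed
    have cM: "continuous_on UNIV (\<lambda>z. \<bar>u z\<bar> powr (\<gamma> + 1))" using \<gamma> by (intro continuous_u_powr) auto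
    have "G * tail_mass T = (p - (\<gamma> + 1)\<^sup>2 / (4 * \<gamma>)) * (LINT z|lborel. \<bar>u z\<bar> powr (p + \<gamma>) * rad (\<lambda>t. (eta n T t)\<^sup>2) z)"
      unfolding tail_mass_def G_def power_mult[symmetric] mult.commute[of mm 2] ..
    also have "\<dots> \<le> (LINT z|lborel. \<bar>u z\<bar> powr (\<gamma> + 1) * (qS z * rad \<theta> z))"
      unfolding \<theta>_def
      by (rule farina_estimate[OF stable[OF T1(2)] \<gamma> b(1) bb])
    also have "\<dots> \<le> (LINT z|lborel. C2 / T * (\<bar>u z\<bar> powr (\<gamma> + 1) * rad ?w z))"
    proof (rule integral_mono)
      show "integrable lborel (\<lambda>z. \<bar>u z\<bar> powr (\<gamma> + 1) * (qS z * rad \<theta> z))"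
        by (rule integrable_qS_rad[OF cM cut])
      show "integrable lborel (\<lambda>z. C2 / T * (\<bar>u z\<bar> powr (\<gamma> + 1) * rad ?w z))"
        by (intro integrable_mult_right integrable_u_hat) (use T1 \<gamma> in auto)
      fix z :: "'k heis"
      have "qS z * rad \<theta> z \<le> C2 / T * rad (\<lambda>t. exp (- (1 / 2) * t) * hat T t ^ (2 * mm - 2)) z"
      proof (cases "z = 0")
        case False
        define t where "t = ln (W z)"
        have r: "rad f z = f t" for f using False by (simp add: rad_def t_def)
        have "qS z * \<theta> t \<le> qS z * (C2 / T * hat T t ^ (2 * mm - 2))"
          by (intro mult_left_mono \<theta>) auto
        also have "\<dots> \<le> exp (- (1 / 2) * t) * (C2 / T * hat T t ^ (2 * mm - 2))"
          using qS_le[OF False] C2 T1 hat_range by (intro mult_right_mono) (auto simp: t_def)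
        finally show ?thesis unfolding r by (simp only: mult_ac)
      qed (simp add: rad_def)
      then have "\<bar>u z\<bar> powr (\<gamma> + 1) * (qS z * rad \<theta> z) \<le> 
         \<bar>u z\<bar> powr (\<gamma> + 1) * (C2 / T * rad (\<lambda>t. exp (- (1 / 2) * t) * hat T t ^ (2 * mm - 2)) z)"
        by (intro mult_left_mono) auto
      then show "\<bar>u z\<bar> powr (\<gamma> + 1) * (qS z * rad \<theta> z) \<le> C2 / T * (\<bar>u z\<bar> powr (\<gamma> + 1) * rad ?w z)"
        unfolding weights(2) by (simp add: mult_ac)
    qed
    also have "\<dots> = C2 / T * (LINT z|lborel. \<bar>u z\<bar> powr (\<gamma> + 1) * rad ?w z)"
      by simp
    also have "\<dots> \<le> C2 / T * (1 * ann_const TYPE('k) * (3 * T) + C3 * tail_mass T)"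
      by (intro mult_left_mono interp_integral[OF T1(1) _ _ C3(1) _ C3(2)]) (use C2 T1 \<gamma> in auto)
    also have "\<dots> = C2 * 3 * ann_const TYPE('k) + C2 * C3 / T * tail_mass T"
      using T1 by (simp add: field_simps)
    also have "\<dots> \<le> C2 * 3 * ann_const TYPE('k) + G / 2 * tail_mass T"
      using T1 tail_mass_nonneg by (intro add_left_mono mult_right_mono) auto
    finally have "G / 2 * tail_mass T \<le> C2 * 3 * ann_const TYPE('k)" by simp
    then show ?thesis using G by (simp add: field_simps)
  qed
  moreover have "2 * C2 * 3 * ann_const TYPE('k) / G \<ge> 0" using C2 G by simp
  ultimately show ?thesis by blast
qed

text \<open>The last integral, with weight lowered by \<open>1 / 2\<close> and two factors of
  \<open>hat\<close> fewer, is what Young's inequality produces from the differentiated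
  cut-off.\<close>

definition tail_energy where
  "tail_energy T = (LINT z|lborel. (hsq u z + \<bar>u z\<bar> powr (p + 1)) * rad (\<lambda>t. exp (\<sigma> * t) * hat T t ^ (2 * mm)) z)
       + (LINT z|lborel. \<bar>u z\<bar> powr 2 * rad (\<lambda>t. exp ((\<sigma> - 1 / 2) * t) * hat T t ^ (2 * mm - 2)) z)"

text \<open>The energy identity with weight \<open>W^\<sigma>\<close>. In its cross term
  \<open>qS * (dil u)^2\<close> is at most \<open>hsq u\<close>, so Young's inequality leaves half
  of the gradient term on the left and \<open>u^2\<close> on the right.\<close>

lemma grad_bound:
  assumes T: "T \<ge> 1"
  shows "(LINT z|lborel. hsq u z * rad (\<lambda>t. exp (\<sigma> * t) * hat T t ^ (2 * mm)) z) \<le>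
     2 * (LINT z|lborel. \<bar>u z\<bar> powr (p + 1) * rad (\<lambda>t. exp (\<sigma> * t) * hat T t ^ (2 * mm)) z)
     + 2 * (8 * (2 * \<sigma>\<^sup>2 + 8 * BB)) * (LINT z|lborel. \<bar>u z\<bar> powr 2 * rad (\<lambda>t. exp ((\<sigma> - 1 / 2) * t) * hat T t ^ (2 * mm - 2)) z)"
proof -
  let ?g = "\<lambda>t. exp (\<sigma> * t) * hat T t ^ (2 * mm)"
  let ?g' = "\<lambda>t. exp (\<sigma> * t) * (\<sigma> * hat T t ^ (2 * mm) + 2 * (eta n T t * eta' n T t))"
  let ?q = "\<lambda>t. exp ((\<sigma> - 1 / 2) * t) * hat T t ^ (2 * mm - 2)"
  define C4 where "C4 = 2 * \<sigma>\<^sup>2 + 8 * BB"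
  have T0: "T > 0" using T by simp
  have e2: "eta n T t * eta n T t = hat T t ^ (2 * mm)" for t
    unfolding power_add[symmetric] by (rule arg_cong[of _ _ "power (hat T t)"]) simp
  have "bump (3 / 2 * T) (7 / 2 * T) (\<lambda>t. hat T t ^ (2 * mm)) (\<lambda>t. 2 * (eta n T t * eta' n T t))"
    using bump_mult[OF bump_eta(1)[OF T, of n] bump_eta(1)[OF T, of n]] unfolding e2
    by (simp add: mult.commute)
  from bump_exp[OF this] have g: "bump (3 / 2 * T) (7 / 2 * T) ?g ?g'" .
  note c = cutoff_bump[OF g]
  have iH: "integrable lborel (\<lambda>z. hsq u z * rad ?g z)"
    by (intro integrable_rad[OF _ c(1)] continuous_hdot C1u)
  have iP: "integrable lborel (\<lambda>z. \<bar>u z\<bar> powr (p + 1) * rad ?g z)"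
    using T0 p by (intro integrable_u_hat) auto
  have iU: "integrable lborel (\<lambda>z. \<bar>u z\<bar> powr 2 * rad ?q z)"
    using T0 by (intro integrable_u_hat) auto
  have iC: "integrable lborel (\<lambda>z. u z * dil u z * (qS z * rad ?g' z))"
    by (intro integrable_qS_rad[OF _ c(2)] continuous_on_mult continuous_u continuous_dil C1u)
  have "(LINT z|lborel. hsq u z * rad ?g z) + 4 * (LINT z|lborel. u z * dil u z * (qS z * rad ?g' z)) = 
      (LINT z|lborel. \<bar>u z\<bar> powr (p + 1) * rad ?g z)"
    using energy_identity[OF g] iH iC by simp
  moreover have "- (4 * (LINT z|lborel. u z * dil u z * (qS z * rad ?g' z))) \<le> 
      (LINT z|lborel. hsq u z * rad ?g z) / 2 + 8 * C4 * (LINT z|lborel. \<bar>u z\<bar> powr 2 * rad ?q z)"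
  proof -
    have "(LINT z|lborel. (- 4) * (u z * dil u z * (qS z * rad ?g' z))) \<le> 
      (LINT z|lborel. 1 / 2 * (hsq u z * rad ?g z) + 8 * C4 * (\<bar>u z\<bar> powr 2 * rad ?q z))"
    proof (rule integral_mono)
      show "integrable lborel (\<lambda>z. (- 4) * (u z * dil u z * (qS z * rad ?g' z)))"
        by (intro integrable_mult_right iC)
      show "integrable lborel (\<lambda>z. 1 / 2 * (hsq u z * rad ?g z) + 8 * C4 * (\<bar>u z\<bar> powr 2 * rad ?q z))"
        by (intro Bochner_Integration.integrable_add integrable_mult_right iH iU)
      fix z :: "'k heis"
      show "(- 4) * (u z * dil u z * (qS z * rad ?g' z)) \<le> 1 / 2 * (hsq u z * rad ?g z) + 8 * C4 * (\<bar>u z\<bar> powr 2 * rad ?q z)"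
      proof (cases "z = 0")
        case False
        define t where "t = ln (W z)"
        have r: "rad f z = f t" for f using False by (simp add: rad_def t_def)
        define d where "d = dil u z"
        define x where "x = eta n T t"
        \<comment> \<open>Up to \<open>exp (\<sigma> * t)\<close> the derivative of the weight is
          \<open>x * y\<close>, while the weight itself is \<open>x^2\<close>; hence
          \<open>x\<close> is paired with \<open>dil u\<close> and \<open>y\<close> with
          \<open>u\<close>.\<close>
        define y where "y = \<sigma> * x + 2 * eta' n T t"
        have H: "hat T t ^ (2 * mm) = x\<^sup>2" using e2[of t] by (simp add: x_def power2_eq_square)
        have e: "exp ((\<sigma> - 1 / 2) * t) = exp (- t / 2) * exp (\<sigma> * t)"
          by (simp add: algebra_simps flip: exp_add)
        have h1: "hat T t \<ge> 0" "hat T t \<le> 1" by (rule hat_range)+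
        have "x\<^sup>2 \<le> hat T t ^ (2 * mm - 2)" unfolding H[symmetric] using h1 by (intro power_decreasing) auto
        moreover have "BB / T * hat T t ^ (2 * mm - 2) \<le> BB / 1 * hat T t ^ (2 * mm - 2)"
          using T h1 by (intro mult_right_mono divide_left_mono) auto
        then have "(eta' n T t)\<^sup>2 \<le> BB * hat T t ^ (2 * mm - 2)"
          using eta_bounds(2)[OF T, of n t] by simp
        moreover have "y\<^sup>2 \<le> 2 * \<sigma>\<^sup>2 * x\<^sup>2 + 8 * (eta' n T t)\<^sup>2"
          using zero_le_power2[of "\<sigma> * x - 2 * eta' n T t"] unfolding y_def by (simp add: power2_eq_square algebra_simps)
        moreover have "2 * \<sigma>\<^sup>2 * x\<^sup>2 \<le> 2 * \<sigma>\<^sup>2 * hat T t ^ (2 * mm - 2)" using calculation(1) by (intro mult_left_mono) auto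
        ultimately have y: "y\<^sup>2 \<le> C4 * hat T t ^ (2 * mm - 2)" by (simp add: C4_def algebra_simps)
        have amgm: "- 4 * (u z * d * (x * y)) \<le> 1 / 2 * (d\<^sup>2 * x\<^sup>2) + 8 * ((u z)\<^sup>2 * y\<^sup>2)"
          using zero_le_power2[of "d * x + 4 * (u z * y)"] by (simp add: power2_eq_square algebra_simps)
        have "?g' t = exp (\<sigma> * t) * (x * y)"
          unfolding H y_def x_def by (simp add: power2_eq_square algebra_simps)
        then have "(- 4) * (u z * dil u z * (qS z * rad ?g' z)) = qS z * exp (\<sigma> * t) * (- 4 * (u z * d * (x * y)))"
          using False by (simp add: rad_def t_def[symmetric] d_def)
        also have "\<dots> \<le> qS z * exp (\<sigma> * t) * (1 / 2 * (d\<^sup>2 * x\<^sup>2) + 8 * ((u z)\<^sup>2 * y\<^sup>2))"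
          by (intro mult_left_mono amgm) auto
        also have "\<dots> = 1 / 2 * (qS z * d\<^sup>2) * (exp (\<sigma> * t) * x\<^sup>2) + 8 * (u z)\<^sup>2 * (qS z * exp (\<sigma> * t) * y\<^sup>2)"
          by (simp add: algebra_simps)
        also have "\<dots> \<le> 1 / 2 * hsq u z * (exp (\<sigma> * t) * x\<^sup>2) + 8 * (u z)\<^sup>2 * (exp (- t / 2) * exp (\<sigma> * t) * (C4 * hat T t ^ (2 * mm - 2)))"
          using qS_dil_le[OF C1u cyl, of z] qS_le[OF False] y
          by (intro add_mono mult_right_mono mult_left_mono mult_mono) (auto simp: d_def t_def)
        also have "8 * (u z)\<^sup>2 * (exp (- t / 2) * exp (\<sigma> * t) * (C4 * hat T t ^ (2 * mm - 2))) =
            8 * C4 * (\<bar>u z\<bar> powr 2 * rad ?q z)"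
          unfolding r e by (simp add: powr_numeral)
        also have "1 / 2 * hsq u z * (exp (\<sigma> * t) * x\<^sup>2) = 1 / 2 * (hsq u z * rad ?g z)"
          unfolding r H by simp
        finally show ?thesis .
      qed (simp add: rad_def)
    qed
    then show ?thesis using iC iH iU by simp
  qed
  ultimately show ?thesis unfolding C4_def[symmetric] by linarith
qed

end

section \<open>Vanishing of the flux and conclusion\<close>

text \<open>A continuously differentiable step from 0 to 1 on the unit interval; both truncations
  are squared, which smooths the two corners.\<close>

definition sstep :: "real \<Rightarrow> real" where
  "sstep x = 1 - (max 0 (1 - (max 0 x)\<^sup>2))\<^sup>2"

definition sstep' :: "real \<Rightarrow> real" where
  "sstep' x = 4 * max 0 x * max 0 (1 - (max 0 x)\<^sup>2)"

lemma DERIV_sstep: "(sstep has_real_derivative sstep' x) (at x)"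
proof -
  have pp: "((\<lambda>x :: real. (max 0 x)\<^sup>2) has_real_derivative 2 * max 0 x) (at x)" for x
    using DERIV_pos_part_power[of 0 x] by (simp add: numeral_2_eq_2)
  have "((\<lambda>x. 1 - (max 0 x)\<^sup>2) has_real_derivative - (2 * max 0 x)) (at x)"
    using DERIV_diff[OF DERIV_const[of 1] pp] by simp
  from DERIV_diff[OF DERIV_const[of 1] DERIV_chain2[OF pp this]]
  show ?thesis unfolding sstep_def sstep'_def by (simp add: mult_ac)
qed

lemma sstep_range: "0 \<le> sstep x" "sstep x \<le> 1"
proof -
  have "(max 0 (1 - (max 0 x)\<^sup>2))\<^sup>2 \<le> 1"
    by (rule power_le_one) auto
  then show "0 \<le> sstep x" by (simp add: sstep_def)
qed (simp add: sstep_def)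

lemma pos_part_sq_ge_1: "x \<ge> 1 \<Longrightarrow> max 0 (1 - (max 0 x)\<^sup>2) = (0 :: real)"
  using one_le_power[of x 2] by (auto simp: max_def intro: antisym)

lemma sstep_values: "x \<le> 0 \<Longrightarrow> sstep x = 0" "x \<ge> 1 \<Longrightarrow> sstep x = 1"
  "x \<le> 0 \<Longrightarrow> sstep' x = 0" "x \<ge> 1 \<Longrightarrow> sstep' x = 0"
  by (auto simp: sstep_def sstep'_def pos_part_sq_ge_1)

lemma sstep'_range: "0 \<le> sstep' x" "sstep' x \<le> 4"
proof -
  have "max 0 x * max 0 (1 - (max 0 x)\<^sup>2) \<le> 1" 
  proof (cases "x \<ge> 1")
    case False
    then show ?thesis by (intro mult_le_one) (auto simp: max_def)
  qed (simp add: pos_part_sq_ge_1)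
  then show "sstep' x \<le> 4" by (simp add: sstep'_def mult.assoc)
qed (auto simp: sstep'_def)

lemma continuous_sstep': "continuous_on S sstep'"
  unfolding sstep'_def[abs_def] by (intro continuous_intros)

text \<open>Equal to 1 for \<open>|t| \<le> 2 T\<close> and zero for \<open>|t| \<ge> 3 T\<close>.
  Large negative \<open>t\<close> corresponds to the origin, so both ends of the \<open>t\<close>
  line are cut.\<close>

definition plateau :: "real \<Rightarrow> real \<Rightarrow> real" where
  "plateau T t = sstep (3 - t / T) * sstep (3 + t / T)"

definition plateau' :: "real \<Rightarrow> real \<Rightarrow> real" where
  "plateau' T t = sstep (3 - t / T) * (sstep' (3 + t / T) / T) - sstep' (3 - t / T) / T * sstep (3 + t / T)"

lemma bump_plateau:
  assumes T: "T > 0"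
  shows "bump (- (3 * T)) (3 * T) (plateau T) (plateau' T)"
  unfolding bump_def
proof (intro conjI allI impI)
  fix t
  have 1: "((\<lambda>t. sstep (3 - t / T)) has_real_derivative sstep' (3 - t / T) * (- 1 / T)) (at t)"
    by (rule DERIV_chain2[OF DERIV_sstep]) (use T in \<open>auto intro!: derivative_eq_intros\<close>)
  have 2: "((\<lambda>t. sstep (3 + t / T)) has_real_derivative sstep' (3 + t / T) * (1 / T)) (at t)"
    by (rule DERIV_chain2[OF DERIV_sstep]) (use T in \<open>auto intro!: derivative_eq_intros\<close>)
  show "(plateau T has_real_derivative plateau' T t) (at t)"
    unfolding plateau_def[abs_def] by (rule DERIV_cong[OF DERIV_mult'[OF 1 2]]) (simp add: plateau'_def)
next
  have s: "continuous_on UNIV sstep" using DERIV_sstep DERIV_isCont by (blast intro: continuous_at_imp_continuous_on)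
  show "continuous_on UNIV (plateau' T)"
    unfolding plateau'_def[abs_def] using T
    by (intro continuous_intros continuous_on_compose2[OF s] continuous_on_compose2[OF continuous_sstep'[of UNIV]]) auto
next
  fix t assume "t \<notin> {- (3 * T)..3 * T}"
  then have "3 - t / T \<le> 0 \<or> 3 + t / T \<le> 0" using T by (auto simp: field_simps)
  then show "plateau T t = 0" by (auto simp: plateau_def sstep_values)
qed

lemma plateau_range: "0 \<le> plateau T t" "plateau T t \<le> 1"
  unfolding plateau_def using sstep_range by (auto intro: mult_le_one)

lemma plateau_eq_1: "T > 0 \<Longrightarrow> \<bar>t\<bar> \<le> 2 * T \<Longrightarrow> plateau T t = 1"
  unfolding plateau_def by (subst (1 2) sstep_values(2)) (auto simp: field_simps abs_le_iff)

lemma plateau'_le: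
  assumes "T > 0"
  shows "\<bar>plateau' T t\<bar> \<le> 8 / T"
proof -
  have a: "\<bar>sstep x * (sstep' y / T)\<bar> \<le> 1 * (4 / T)" for x y
    unfolding abs_mult using sstep_range[of x] sstep'_range[of y] assms
    by (intro mult_mono) (auto simp: divide_right_mono)
  have "\<bar>plateau' T t\<bar> \<le> \<bar>sstep (3 - t / T) * (sstep' (3 + t / T) / T)\<bar> + \<bar>sstep (3 + t / T) * (sstep' (3 - t / T) / T)\<bar>"
    unfolding plateau'_def mult.commute[of "sstep' _ / T"] by (rule abs_triangle_ineq4)
  also have "\<dots> \<le> 1 * (4 / T) + 1 * (4 / T)" by (intro add_mono a)
  finally show ?thesis by simp
qed

lemma plateau'_nonzero:
  assumes "T > 0" "plateau' T t \<noteq> 0"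
  shows "t \<in> {- (3 * T)..- (2 * T)} \<or> t \<in> {2 * T..3 * T}"
proof -
  have "sstep' (3 + t / T) \<noteq> 0 \<or> sstep' (3 - t / T) \<noteq> 0"
    using assms by (auto simp: plateau'_def)
  then have "(0 < 3 + t / T \<and> 3 + t / T < 1) \<or> (0 < 3 - t / T \<and> 3 - t / T < 1)"
    using sstep_values(3,4) by (meson not_le)
  then show ?thesis using assms(1) by (auto simp: field_simps)
qed

section \<open>Errors caused by the slopes of the plateau\<close>

context stable_tail
begin

text \<open>Interpolation with an arbitrarily small constant: that constant is charged to an annulus
  of invariant measure \<open>O(T)\<close>, and the remainder is a multiple of the tail mass, which
  is bounded in \<open>T\<close>.\<close>

lemma tail_energy_small:
  assumes "\<epsilon> > 0"
  shows "\<exists>T0. \<forall>T\<ge>T0. tail_energy T \<le> \<epsilon> * T"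
proof -
  define K where "K = 2 * (8 * (2 * \<sigma>\<^sup>2 + 8 * BB))"
  have K: "K \<ge> 0" by (simp add: K_def)
  \<comment> \<open>The energy will be bounded by \<open>3 * P + (1 + K) * U\<close>, so
    \<open>\<epsilon>1\<close> enters \<open>4 + K\<close> times; this uses up half of
    \<open>\<epsilon>\<close>.\<close>
  define \<epsilon>1 where "\<epsilon>1 = \<epsilon> / (2 * (4 + K) * ann_const TYPE('k) * 3)"
  have "0 < \<epsilon> / (2 * L * A * 3) \<and> L * (\<epsilon> / (2 * L * A * 3) * A * 3) = \<epsilon> / 2" if "L > 0" "A > 0" for L A :: real
    using assms that by simp
  from this[of "4 + K" "ann_const TYPE('k)"] have \<epsilon>1: "\<epsilon>1 > 0" "(4 + K) * (\<epsilon>1 * ann_const TYPE('k) * 3) = \<epsilon> / 2"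
    using K unfolding \<epsilon>1_def by simp_all
  have b: "p + \<gamma> > 0" using p \<gamma> by simp
  obtain C1 where C1: "C1 \<ge> 0" "\<And>v. v \<ge> 0 \<Longrightarrow> v powr (p + 1) \<le> \<epsilon>1 + C1 * v powr (p + \<gamma>)"
    using powr_interpolate[of "p + 1" "p + \<gamma>" \<epsilon>1] \<epsilon>1 p \<gamma> by auto
  have C1': "v powr (p + 1) * X ^ (2 * mm) \<le> \<epsilon>1 + C1 * (v powr (p + \<gamma>) * X ^ (2 * mm))"
    if "v \<ge> 0" "0 \<le> X" "X \<le> 1" for v X
  proof -
    have "v powr (p + 1) * X ^ (2 * mm) \<le> (\<epsilon>1 + C1 * v powr (p + \<gamma>)) * X ^ (2 * mm)"
      using C1(2) that by (intro mult_right_mono) auto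
    also have "\<dots> = \<epsilon>1 * X ^ (2 * mm) + C1 * (v powr (p + \<gamma>) * X ^ (2 * mm))" by (simp add: algebra_simps)
    also have "\<epsilon>1 * X ^ (2 * mm) \<le> \<epsilon>1 * 1" using \<epsilon>1 that by (intro mult_left_mono power_le_one) auto
    finally show ?thesis by simp
  qed
  have "real mm * 2 \<le> (real mm - 1) * (p + \<gamma>)"
  proof -
    have "real mm * 2 \<le> real mm * (\<gamma> + 1)" using \<gamma> by (intro mult_left_mono) auto
    then show ?thesis using n by linarith
  qed
  then obtain C2 where C2: "C2 \<ge> 0" "\<And>v X. v \<ge> 0 \<Longrightarrow> 0 \<le> X \<Longrightarrow> X \<le> 1 \<Longrightarrow>
      v powr 2 * X ^ (2 * mm - 2) \<le> \<epsilon>1 + C2 * (v powr (p + \<gamma>) * X ^ (2 * mm))"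
    using powr_interpolate_cutoff[of 2 "p + \<gamma>" \<epsilon>1 mm] \<epsilon>1 p \<gamma> by auto
  obtain C T0 where C: "C \<ge> 0" "\<And>T. T \<ge> T0 \<Longrightarrow> tail_mass T \<le> C" using tail_bound by blast
  define C3 where "C3 = 3 * C1 + (1 + K) * C2"
  have C3: "C3 \<ge> 0" using C1 C2 K by (simp add: C3_def)
  define T1 where "T1 = max (max 1 T0) (2 * (C3 * C) / \<epsilon>)"
  have "tail_energy T \<le> \<epsilon> * T" if T: "T \<ge> T1" for T
  proof -
    let ?g = "\<lambda>t. exp (\<sigma> * t) * hat T t ^ (2 * mm)"
    have T: "T \<ge> 1" "T \<ge> T0" "C3 * C \<le> \<epsilon> / 2 * T"
      using T assms by (auto simp: T1_def field_simps)
    define P where "P = (LINT z|lborel. \<bar>u z\<bar> powr (p + 1) * rad ?g z)"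
    define U where "U = (LINT z|lborel. \<bar>u z\<bar> powr 2 * rad (\<lambda>t. exp ((\<sigma> - 1 / 2) * t) * hat T t ^ (2 * mm - 2)) z)"
    have P: "P \<le> \<epsilon>1 * ann_const TYPE('k) * (3 * T) + C1 * tail_mass T"
      using interp_integral[OF T(1) _ _ C1(1) _ C1'] p \<epsilon>1 unfolding weights(3) P_def by simp
    have U: "U \<le> \<epsilon>1 * ann_const TYPE('k) * (3 * T) + C2 * tail_mass T"
      using interp_integral[OF T(1) _ _ C2(1) _ C2(2)] \<epsilon>1 unfolding weights(4) U_def by simp
    have iP: "integrable lborel (\<lambda>z. \<bar>u z\<bar> powr (p + 1) * rad ?g z)"
      using T p by (intro integrable_u_hat) auto
    have iH: "integrable lborel (\<lambda>z. hsq u z * rad ?g z)"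
      using T by (intro integrable_rad[OF _ cutoff_hat_power] continuous_hdot C1u continuous_intros) auto
    have "tail_energy T = (LINT z|lborel. hsq u z * rad ?g z) + P + U"
      using iP iH unfolding tail_energy_def P_def U_def by (simp add: distrib_right)
    also have "\<dots> \<le> 3 * P + (1 + K) * U"
      using grad_bound[OF T(1)] unfolding P_def[symmetric] U_def[symmetric] K_def[symmetric] by (simp add: distrib_right)
    also have "\<dots> \<le> 3 * (\<epsilon>1 * ann_const TYPE('k) * (3 * T) + C1 * tail_mass T) + (1 + K) * (\<epsilon>1 * ann_const TYPE('k) * (3 * T) + C2 * tail_mass T)"
      using P U K by (intro add_mono mult_left_mono) auto
    also have "\<dots> = (4 + K) * (\<epsilon>1 * ann_const TYPE('k) * 3) * T + C3 * tail_mass T"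
      by (simp add: C3_def algebra_simps)
    also have "\<dots> \<le> \<epsilon> / 2 * T + C3 * C"
      unfolding \<epsilon>1(2) using C(2)[OF T(2)] C3 by (intro add_left_mono mult_left_mono) auto
    also have "\<dots> \<le> \<epsilon> * T" using T(3) by simp
    finally show ?thesis .
  qed
  then show ?thesis by blast
qed

text \<open>Dominates all error terms produced by differentiating the plateau.\<close>

definition cut_energy where
  "cut_energy T z = (hsq u z + \<bar>u z\<bar> powr (p + 1)) * rad (\<lambda>t. exp (\<sigma> * t) * \<bar>plateau' T t\<bar>) z
     + \<bar>u z\<bar> powr 2 * rad (\<lambda>t. exp ((\<sigma> - 1 / 2) * t) * \<bar>plateau' T t\<bar>) z"

lemma cutoff_plateau':
  assumes "T > 0"
  shows "cutoff (- (3 * T)) (3 * T) (\<lambda>t. exp (w * t) * \<bar>plateau' T t\<bar>)"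
  using cutoff_bump(2)[OF bump_plateau[OF assms]] by (auto simp: cutoff_def intro!: continuous_intros)

lemma integrable_cut_energy: "T > 0 \<Longrightarrow> integrable lborel (cut_energy T)"
  unfolding cut_energy_def[abs_def]
  by (intro Bochner_Integration.integrable_add integrable_rad[OF _ cutoff_plateau'] continuous_on_add continuous_hdot C1u continuous_u_powr)
     (use p in auto)

text \<open>The slopes have size \<open>1 / T\<close>. On the outer one they meet a tail energy that
  is \<open>o(T)\<close>; on the inner one \<open>u\<close> and its horizontal gradient are bounded,
  and the weight decays exponentially in \<open>T\<close> relative to the invariant density.\<close>

lemma cut_energy_small:
  assumes "\<epsilon> > 0"
  shows "\<exists>T0. \<forall>T\<ge>T0. (LINT z|lborel. cut_energy T z) \<le> \<epsilon>"
proof -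
  have "continuous_on UNIV (\<lambda>z. hsq u z + \<bar>u z\<bar> powr (p + 1) + \<bar>u z\<bar> powr 2)"
    by (intro continuous_on_add continuous_hdot C1u continuous_u_powr) (use p in auto)
  then have "compact ((\<lambda>z. hsq u z + \<bar>u z\<bar> powr (p + 1) + \<bar>u z\<bar> powr 2) ` {z. W z \<le> 1})"
    by (rule compact_continuous_image[OF continuous_on_subset[OF _ subset_UNIV] compact_W_le])
  then have "bounded ((\<lambda>z. hsq u z + \<bar>u z\<bar> powr (p + 1) + \<bar>u z\<bar> powr 2) ` {z. W z \<le> 1})"
    by (rule compact_imp_bounded)
  then obtain B where B0: "B > 0" "\<forall>x\<in>(\<lambda>z. hsq u z + \<bar>u z\<bar> powr (p + 1) + \<bar>u z\<bar> powr 2) ` {z. W z \<le> 1}. norm x \<le> B"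
    unfolding bounded_pos by blast
  have B: "hsq u z + \<bar>u z\<bar> powr (p + 1) + \<bar>u z\<bar> powr 2 \<le> B" if "W z \<le> 1" for z
  proof -
    have "norm (hsq u z + \<bar>u z\<bar> powr (p + 1) + \<bar>u z\<bar> powr 2) \<le> B"
      by (rule B0(2)[rule_format, OF imageI]) (use that in simp)
    then show ?thesis
      unfolding real_norm_def by (rule order_trans[OF abs_ge_self])
  qed
  \<comment> \<open>Chosen so that the bound 8 for \<open>T * |plateau'|\<close> is at most
    \<open>M * hat^(2 mm)\<close> wherever \<open>hat \<ge> 3/4\<close>.\<close>
  define M where "M = 8 * (4 / 3 :: real) ^ (2 * mm)"
  have M: "M > 0" by (simp add: M_def)
  \<comment> \<open>The surplus exponent near the origin: \<open>W^(\<sigma> - 1/2)\<close> is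
    \<open>W^\<delta>\<close> times the invariant density.\<close>
  define \<delta> where "\<delta> = \<beta> + \<alpha>"
  have \<delta>: "\<delta> > 0" using \<beta> by (simp add: \<delta>_def)
  obtain T1 where T1: "\<And>T. T \<ge> T1 \<Longrightarrow> tail_energy T \<le> \<epsilon> / (2 * M) * T"
    using tail_energy_small[of "\<epsilon> / (2 * M)"] assms M by auto
  define T0 where "T0 = max (max 1 T1) (8 * B * ann_const TYPE('k) / (\<delta> * \<epsilon>) * 2)"
  have "(LINT z|lborel. cut_energy T z) \<le> \<epsilon>" if T: "T \<ge> T0" for T
  proof -
    have T: "T \<ge> 1" "T \<ge> T1" "8 * B * ann_const TYPE('k) * 2 \<le> T * (\<delta> * \<epsilon>)"
      using T assms \<delta> by (auto simp: T0_def field_simps)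
    have T0: "T > 0" using T by simp
    let ?A = "ann (- (3 * T)) (- (2 * T)) :: 'k heis set"
    let ?g1 = "\<lambda>t. exp (\<sigma> * t) * hat T t ^ (2 * mm)"
    let ?g2 = "\<lambda>t. exp ((\<sigma> - 1 / 2) * t) * hat T t ^ (2 * mm - 2)"
    define c where "c = 8 / T * B * exp (- (2 * \<delta> * T))"
    have c: "c \<ge> 0" using B0 T0 by (simp add: c_def)
    have i1: "integrable lborel (\<lambda>z. (hsq u z + \<bar>u z\<bar> powr (p + 1)) * rad ?g1 z)"
      using T p by (intro integrable_rad[OF _ cutoff_hat_power] continuous_hdot C1u continuous_u_powr continuous_on_add continuous_intros) auto
    have i2: "integrable lborel (\<lambda>z. \<bar>u z\<bar> powr 2 * rad ?g2 z)"
      using T0 by (intro integrable_u_hat) auto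
    have "(LINT z|lborel. cut_energy T z) \<le> (LINT z|lborel. M / T * ((hsq u z + \<bar>u z\<bar> powr (p + 1)) * rad ?g1 z 
       + \<bar>u z\<bar> powr 2 * rad ?g2 z) + c * (indicator ?A z * ann_weight z))"
    proof (rule integral_mono[OF integrable_cut_energy[OF T0]])
      show "integrable lborel (\<lambda>z. M / T * ((hsq u z + \<bar>u z\<bar> powr (p + 1)) * rad ?g1 z 
          + \<bar>u z\<bar> powr 2 * rad ?g2 z) + c * (indicator ?A z * ann_weight z))"
        by (intro Bochner_Integration.integrable_add integrable_mult_right i1 i2 integrable_ann_weight)
      fix z :: "'k heis"
      define E1 where "E1 = hsq u z + \<bar>u z\<bar> powr (p + 1)"
      define E2 where "E2 = \<bar>u z\<bar> powr 2"
      have E: "E1 \<ge> 0" "E2 \<ge> 0" by (auto simp: E1_def E2_def)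
      define t where "t = ln (W z)"
      have r: "rad f z = f t" if "z \<noteq> 0" for f using that by (simp add: rad_def t_def)
      have pos: "0 \<le> M / T * (E1 * rad ?g1 z + E2 * rad ?g2 z)"
        using E M T0 hat_range by (intro mult_nonneg_nonneg add_nonneg_nonneg) (auto simp: rad_def)
      have pos2: "0 \<le> c * (indicator ?A z * ann_weight z)" using c by simp
      have h0: "\<bar>plateau' T t\<bar> \<le> 8 / T" by (rule plateau'_le[OF T0])
      have "E1 * rad (\<lambda>t. exp (\<sigma> * t) * \<bar>plateau' T t\<bar>) z + E2 * rad (\<lambda>t. exp ((\<sigma> - 1 / 2) * t) * \<bar>plateau' T t\<bar>) z
        \<le> M / T * (E1 * rad ?g1 z + E2 * rad ?g2 z) + c * (indicator ?A z * ann_weight z)"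
      proof (cases "z = 0 \<or> plateau' T t = 0")
        case True
        then have "E1 * rad (\<lambda>t. exp (\<sigma> * t) * \<bar>plateau' T t\<bar>) z + E2 * rad (\<lambda>t. exp ((\<sigma> - 1 / 2) * t) * \<bar>plateau' T t\<bar>) z = 0"
          by (auto simp: rad_def t_def)
        then show ?thesis using pos pos2 by linarith
      next
        case False
        then have z: "z \<noteq> 0" and "plateau' T t \<noteq> 0" by auto
        from plateau'_nonzero[OF T0 this(2)] show ?thesis
        proof
          assume t: "t \<in> {2 * T..3 * T}"
          have h: "3 / 4 \<le> hat T t" "hat T t \<le> 1" using hat_ge[OF T0 t] hat_range by auto
          have "(3 / 4) ^ (2 * mm) \<le> hat T t ^ (2 * mm)" using h by (intro power_mono) auto
          then have k1: "8 \<le> M * hat T t ^ (2 * mm)"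
            using mult_left_mono[of "(3 / 4) ^ (2 * mm)" "hat T t ^ (2 * mm)" M] M
            by (simp add: M_def flip: power_mult_distrib)
          have "hat T t ^ (2 * mm) \<le> hat T t ^ (2 * mm - 2)" using h by (intro power_decreasing) auto
          then have k2: "8 \<le> M * hat T t ^ (2 * mm - 2)"
            using k1 M mult_left_mono[of "hat T t ^ (2 * mm)" "hat T t ^ (2 * mm - 2)" M] by linarith
          have "E1 * (exp (\<sigma> * t) * \<bar>plateau' T t\<bar>) + E2 * (exp ((\<sigma> - 1 / 2) * t) * \<bar>plateau' T t\<bar>)
            \<le> E1 * (exp (\<sigma> * t) * (M * hat T t ^ (2 * mm) / T)) + E2 * (exp ((\<sigma> - 1 / 2) * t) * (M * hat T t ^ (2 * mm - 2) / T))"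
            using E T0 k1 k2 by (intro add_mono mult_left_mono order_trans[OF h0] divide_right_mono) auto
          also have "\<dots> = M / T * (E1 * rad ?g1 z + E2 * rad ?g2 z)"
            unfolding r[OF z] by (simp add: distrib_left mult_ac)
          finally show ?thesis unfolding r[OF z] using pos2[unfolded r[OF z]] by linarith
        next
          assume t: "t \<in> {- (3 * T)..- (2 * T)}"
          then have zA: "z \<in> ?A" using z by (auto simp: ann_iff t_def)
          have t0: "t \<le> 0" using t T0 by auto
          have "W z \<le> 1" using t0 W_pos[OF z] by (simp add: t_def)
          then have EB: "E1 + E2 \<le> B" using B[of z] by (simp add: E1_def E2_def)
          \<comment> \<open>For \<open>t \<le> 0\<close> the second weight is the larger one, so it
            serves for both terms.\<close>
          have "exp (\<sigma> * t) \<le> exp ((\<sigma> - 1 / 2) * t)" using t0 by (simp add: algebra_simps)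
          then have "E1 * (exp (\<sigma> * t) * \<bar>plateau' T t\<bar>) + E2 * (exp ((\<sigma> - 1 / 2) * t) * \<bar>plateau' T t\<bar>)
             \<le> E1 * (exp ((\<sigma> - 1 / 2) * t) * (8 / T)) + E2 * (exp ((\<sigma> - 1 / 2) * t) * (8 / T))"
            using E h0 by (intro add_mono mult_left_mono mult_mono) auto
          also have "\<dots> = (E1 + E2) * (exp ((\<sigma> - 1 / 2) * t) * (8 / T))" by (simp only: distrib_right)
          also have "\<dots> \<le> B * (exp ((\<sigma> - 1 / 2) * t) * (8 / T))"
            using EB T0 by (intro mult_right_mono) auto
          also have "B * (exp ((\<sigma> - 1 / 2) * t) * (8 / T)) = B * (exp (\<delta> * t) * ann_weight z * (8 / T))"
          proof -
            have "exp ((\<sigma> - 1 / 2) * t) = exp (\<delta> * t) * ann_weight z"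
              unfolding weights(4)[symmetric] \<omega>_def \<delta>_def t_def[symmetric] by (simp add: algebra_simps flip: exp_add)
            then show ?thesis by (simp only:)
          qed
          also have "B * (exp (\<delta> * t) * ann_weight z * (8 / T)) \<le> B * (exp (- (2 * \<delta> * T)) * ann_weight z * (8 / T))"
          proof -
            have "\<delta> * t \<le> \<delta> * (- (2 * T))" using \<delta> t by (intro mult_left_mono) auto
            then have "exp (\<delta> * t) \<le> exp (- (2 * \<delta> * T))" by (simp add: mult_ac)
            then show ?thesis using B0(1) T0 by (intro mult_left_mono mult_right_mono) auto
          qed
          also have "\<dots> = c * (indicator ?A z * ann_weight z)" using zA by (simp add: c_def)
          finally show ?thesis using pos unfolding r[OF z] by linarith
        qed
      qed
      then show "cut_energy T z \<le> M / T * ((hsq u z + \<bar>u z\<bar> powr (p + 1)) * rad ?g1 z 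
          + \<bar>u z\<bar> powr 2 * rad ?g2 z) + c * (indicator ?A z * ann_weight z)"
        by (simp add: cut_energy_def E1_def E2_def)
    qed
    also have "\<dots> = M / T * tail_energy T + c * (LINT z|lborel. indicator ?A z * ann_weight z)"
      using i1 i2 integrable_ann_weight[where 'k = 'k, of "- (3 * T)" "- (2 * T)"] by (simp add: tail_energy_def)
    also have "\<dots> \<le> M / T * (\<epsilon> / (2 * M) * T) + c * (ann_const TYPE('k) * (2 * T))"
    proof (intro add_mono mult_left_mono T1 T(2))
      show "(LINT z|lborel. indicator ?A z * ann_weight z) \<le> ann_const TYPE('k) * (2 * T)"
        using integral_ann_weight_le[of "- (3 * T)" "- (2 * T)", where 'k = 'k] T
        by (rule_tac order_trans) (auto intro!: mult_left_mono)
    qed (use M T0 c in auto)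
    also have "M / T * (\<epsilon> / (2 * M) * T) = \<epsilon> / 2" using M T0 by simp
    also have "c * (ann_const TYPE('k) * (2 * T)) = 8 * B * ann_const TYPE('k) * 2 * exp (- (2 * \<delta> * T))"
      using T0 by (simp add: c_def)
    also have "\<dots> \<le> T * (\<delta> * \<epsilon>) * (1 / (2 * \<delta> * T))"
    proof (rule mult_mono[OF T(3)])
      have "2 * \<delta> * T \<le> exp (2 * \<delta> * T)" using exp_ge_add_one_self[of "2 * \<delta> * T"] by linarith
      then show "exp (- (2 * \<delta> * T)) \<le> 1 / (2 * \<delta> * T)"
        using \<delta> T0 by (simp add: exp_minus inverse_eq_divide frac_le)
    qed (use \<delta> T0 assms in auto)
    also have "\<dots> = \<epsilon> / 2" using \<delta> T0 by simp
    finally show ?thesis by simp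
  qed
  then show ?thesis by blast
qed

end

lemma zero_if_zero_off_axis:
  fixes u :: "'k::finite heis \<Rightarrow> real"
  assumes "continuous_on UNIV u" "\<And>z. fst z \<noteq> 0 \<Longrightarrow> u z = 0"
  shows "u z = 0"
proof (cases "fst z = 0")
  case True
  define a :: "real ^ ('k + 'k)" where "a = axis undefined 1"
  have a: "a \<noteq> 0" by (simp add: a_def axis_eq_0_iff)
  have "(\<lambda>n. ((1 / real (Suc n)) *\<^sub>R a, snd z)) \<longlonglongrightarrow> (0 *\<^sub>R a, snd z)"
    using LIMSEQ_inverse_real_of_nat by (intro tendsto_intros) (simp add: inverse_eq_divide)
  moreover have "(0 *\<^sub>R a, snd z) = z" using True by (simp add: prod_eq_iff)
  moreover have "isCont u z" using continuous_on_interior[OF assms(1), of z] by simp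
  ultimately have "(\<lambda>n. u ((1 / real (Suc n)) *\<^sub>R a, snd z)) \<longlonglongrightarrow> u z"
    by (metis isCont_tendsto_compose)
  moreover have "u ((1 / real (Suc n)) *\<^sub>R a, snd z) = 0" for n
    using a by (intro assms(2)) simp
  ultimately show ?thesis by (simp add: LIMSEQ_const_iff)
qed (rule assms(2))

text \<open>A positive value of \<open>f\<close> gives a positive integral over a small ball at one
  fixed scale, and the integrals at much larger scales are no smaller.\<close>

lemma vanish_if_plateau_integral_small:
  fixes f :: "'k::finite heis \<Rightarrow> real"
  assumes f: "continuous_on UNIV f" "\<And>z. f z \<ge> 0"
    and small: "\<And>\<epsilon>. \<epsilon> > 0 \<Longrightarrow> \<exists>T0. \<forall>T\<ge>T0. (LINT z|lborel. f z * rad (\<lambda>t. exp (s * t) * plateau T t) z) \<le> \<epsilon>"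
    and z: "z0 \<noteq> 0"
  shows "f z0 = 0"
proof (rule ccontr)
  assume "f z0 \<noteq> 0"
  define T1 where "T1 = max 1 \<bar>ln (W z0)\<bar>"
  have T1: "T1 \<ge> 1" "\<bar>ln (W z0)\<bar> \<le> 2 * T1" by (auto simp: T1_def)
  let ?G = "\<lambda>T z. f z * rad (\<lambda>t. exp (s * t) * plateau T t) z"
  have cut: "cutoff (- (3 * T)) (3 * T) (\<lambda>t. exp (s * t) * plateau T t)" if "T > 0" for T
    by (rule cutoff_exp[OF cutoff_bump(1)[OF bump_plateau[OF that]]])
  have i: "integrable lborel (?G T)" if "T > 0" for T
    by (rule integrable_rad[OF f(1) cut[OF that]])
  have "?G T1 z0 > 0"
    using \<open>f z0 \<noteq> 0\<close> f(2)[of z0] z plateau_eq_1[OF _ T1(2)] T1(1) by (simp add: rad_def)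
  moreover have cG: "continuous_on UNIV (?G T1)"
    using T1 by (intro continuous_on_mult f continuous_rad[OF cut]) auto
  define \<delta> where "\<delta> = ?G T1 z0 / 2"
  ultimately have \<delta>: "\<delta> > 0" "\<delta> < ?G T1 z0" by auto
  have "open {z. \<delta> < ?G T1 z}"
    by (intro open_Collect_less continuous_on_const cG)
  then obtain r where r: "r > 0" "ball z0 r \<subseteq> {z. \<delta> < ?G T1 z}"
    using \<delta>(2) open_contains_ball by blast
  have nn: "?G T z \<ge> 0" for T z using f(2) plateau_range by (auto simp: rad_def)
  have "\<delta> * measure lborel (ball z0 r) = (LINT z|lborel. indicator (ball z0 r) z * \<delta>)"
    by simp
  also have "\<dots> \<le> (LINT z|lborel. ?G T1 z)"
  proof (rule integral_mono)
    show "integrable lborel (\<lambda>z. indicator (ball z0 r) z * \<delta>)"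
      using emeasure_lborel_ball_finite[of z0 r] by (intro integrable_mult_left) (simp add: integrable_indicator_iff less_top)
    show "integrable lborel (?G T1)" using i T1 by auto
    show "indicator (ball z0 r) z * \<delta> \<le> ?G T1 z" for z
      using r(2) nn[of z T1] by (auto simp: indicator_def intro: less_imp_le)
  qed
  finally have m: "\<delta> * measure lborel (ball z0 r) \<le> (LINT z|lborel. ?G T1 z)" .
  have p: "\<delta> * measure lborel (ball z0 r) > 0"
    using \<delta>(1) content_ball_pos[OF r(1), of z0] by simp
  from small[of "\<delta> * measure lborel (ball z0 r) / 2"] p
  obtain T0 where T0: "\<And>T. T \<ge> T0 \<Longrightarrow> (LINT z|lborel. ?G T z) \<le> \<delta> * measure lborel (ball z0 r) / 2"
    by auto
  \<comment> \<open>With \<open>3 * T1 \<le> 2 * T\<close> the new plateau equals 1 on the whole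
    support of the old one.\<close>
  define T where "T = max T0 (3 / 2 * T1)"
  have T: "T \<ge> T0" "3 * T1 \<le> 2 * T" "T > 0" using T1 by (auto simp: T_def)
  have "(LINT z|lborel. ?G T1 z) \<le> (LINT z|lborel. ?G T z)"
  proof (rule integral_mono)
    show "integrable lborel (?G T1)" "integrable lborel (?G T)" using i T1 T by auto
    fix z
    have "plateau T1 t \<le> plateau T t" for t
    proof (cases "\<bar>t\<bar> \<le> 3 * T1")
      case True
      then have "plateau T t = 1" using T by (intro plateau_eq_1) auto
      then show ?thesis using plateau_range by simp
    next
      case False
      then have "plateau T1 t = 0" using bump_plateau[of T1] T1 by (auto simp: bump_def abs_le_iff)
      then show ?thesis using plateau_range by simp
    qed
    then show "?G T1 z \<le> ?G T z"
      by (intro mult_left_mono f(2)) (simp add: rad_def)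
  qed
  then show False using m p T0[OF T(1)] by linarith
qed

section \<open>Weighted identities in the two ranges of the exponent\<close>

context stable_tail
begin

lemma cut_energy_bound:
  assumes "T > 0" "integrable lborel f" "\<And>z. \<bar>f z\<bar> \<le> cut_energy T z"
  shows "\<bar>LINT z|lborel. f z\<bar> \<le> (LINT z|lborel. cut_energy T z)"
proof -
  have "\<bar>LINT z|lborel. f z\<bar> \<le> (LINT z|lborel. \<bar>f z\<bar>)" by (rule integral_abs_bound)
  also have "\<dots> \<le> (LINT z|lborel. cut_energy T z)"
    by (rule integral_mono[OF _ integrable_cut_energy]) (use assms in auto)
  finally show ?thesis .
qed

definition wplateau' where "wplateau' T t = exp (\<sigma> * t) * plateau' T t"
definition wplateau where "wplateau T t = exp (\<sigma> * t) * plateau T t"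

lemma bump_wplateau: "T > 0 \<Longrightarrow> bump (- (3 * T)) (3 * T) (wplateau T) (\<lambda>t. \<sigma> * wplateau T t + wplateau' T t)"
  using bump_exp[OF bump_plateau, of T \<sigma>] by (simp add: wplateau_def[abs_def] wplateau'_def[abs_def] algebra_simps)

lemma cutoff_wplateau: "T > 0 \<Longrightarrow> cutoff (- (3 * T)) (3 * T) (wplateau T)" "T > 0 \<Longrightarrow> cutoff (- (3 * T)) (3 * T) (wplateau' T)"
  unfolding wplateau_def[abs_def] wplateau'_def[abs_def] by (intro cutoff_exp cutoff_bump[OF bump_plateau]; assumption)+

abbreviation IA where "IA g \<equiv> (LINT z|lborel. hsq u z * rad g z)"
abbreviation IB where "IB g \<equiv> (LINT z|lborel. \<bar>u z\<bar> powr (p + 1) * rad g z)"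
abbreviation ID where "ID g \<equiv> (LINT z|lborel. (dil u z)\<^sup>2 * (qS z * rad g z))"
abbreviation IE where "IE g \<equiv> (LINT z|lborel. (u z * dil u z) * (qS z * rad g z))"
abbreviation IF where "IF g \<equiv> (LINT z|lborel. (u z)\<^sup>2 * (qS z * rad g z))"

lemma integrable_energies:
  assumes "cutoff a b g"
  shows "integrable lborel (\<lambda>z. hsq u z * rad g z)" "integrable lborel (\<lambda>z. \<bar>u z\<bar> powr (p + 1) * rad g z)"
    "integrable lborel (\<lambda>z. (dil u z)\<^sup>2 * (qS z * rad g z))" "integrable lborel (\<lambda>z. (u z * dil u z) * (qS z * rad g z))"
    "integrable lborel (\<lambda>z. (u z)\<^sup>2 * (qS z * rad g z))"
  using assms p
  by (auto intro!: integrable_rad integrable_qS_rad continuous_hdot C1u continuous_u_powr continuous_on_mult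
      continuous_on_power continuous_dil continuous_u)

text \<open>The terms with \<open>qS\<close> are reduced to \<open>cut_energy\<close> by
  \<open>qS * (dil u)^2 \<le> hsq u\<close> and \<open>qS \<le> W^(-1/2)\<close>, and the mixed one
  by the arithmetic-geometric mean inequality.\<close>

lemma error_bounds:
  assumes T: "T > 0"
  defines "E \<equiv> (LINT z|lborel. cut_energy T z)"
  shows "\<bar>IA (wplateau' T)\<bar> \<le> E" "\<bar>IB (wplateau' T)\<bar> \<le> E" "\<bar>ID (wplateau' T)\<bar> \<le> E" "\<bar>IE (wplateau' T)\<bar> \<le> E" "\<bar>IF (wplateau' T)\<bar> \<le> E"
proof -
  note i = integrable_energies[OF cutoff_wplateau(2)[OF T]]
  have *: "\<bar>hsq u z * rad (wplateau' T) z\<bar> \<le> cut_energy T z \<and> \<bar>\<bar>u z\<bar> powr (p + 1) * rad (wplateau' T) z\<bar> \<le> cut_energy T z \<and>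
    \<bar>(dil u z)\<^sup>2 * (qS z * rad (wplateau' T) z)\<bar> \<le> cut_energy T z \<and> \<bar>(u z * dil u z) * (qS z * rad (wplateau' T) z)\<bar> \<le> cut_energy T z \<and>
    \<bar>(u z)\<^sup>2 * (qS z * rad (wplateau' T) z)\<bar> \<le> cut_energy T z" for z
  proof (cases "z = 0")
    case True
    then show ?thesis by (simp add: rad_def cut_energy_def)
  next
    case False
    define t where "t = ln (W z)"
    have r: "rad f z = f t" for f using False by (simp add: rad_def t_def)
    define w where "w = exp (\<sigma> * t) * \<bar>plateau' T t\<bar>"
    have w: "w \<ge> 0" "\<bar>wplateau' T t\<bar> = w" by (auto simp: w_def wplateau'_def abs_mult)
    have e: "exp ((\<sigma> - 1 / 2) * t) * \<bar>plateau' T t\<bar> = exp (- t / 2) * w"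
      by (simp add: w_def algebra_simps flip: exp_add mult.assoc)
    have en: "cut_energy T z = hsq u z * w + \<bar>u z\<bar> powr (p + 1) * w + (u z)\<^sup>2 * (exp (- t / 2) * w)"
      unfolding cut_energy_def r e by (simp add: w_def[symmetric] distrib_right powr_numeral)
    have n: "0 \<le> hsq u z * w" "0 \<le> \<bar>u z\<bar> powr (p + 1) * w" "0 \<le> (u z)\<^sup>2 * (exp (- t / 2) * w)"
      using w by auto
    have d: "(dil u z)\<^sup>2 * (qS z * w) \<le> hsq u z * w"
      using mult_right_mono[OF qS_dil_le[OF C1u cyl, of z] w(1)] by (simp add: mult_ac)
    have f: "(u z)\<^sup>2 * (qS z * w) \<le> (u z)\<^sup>2 * (exp (- t / 2) * w)"
      using qS_le[OF False] w(1) by (intro mult_left_mono mult_right_mono) (auto simp: t_def)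
    have "\<bar>u z * dil u z\<bar> \<le> (dil u z)\<^sup>2 + (u z)\<^sup>2"
    proof -
      have "2 * (\<bar>u z\<bar> * \<bar>dil u z\<bar>) \<le> \<bar>u z\<bar>\<^sup>2 + \<bar>dil u z\<bar>\<^sup>2" using sum_squares_bound[of "\<bar>u z\<bar>" "\<bar>dil u z\<bar>"] by simp
      moreover have "\<bar>u z\<bar> * \<bar>dil u z\<bar> \<ge> 0" by simp
      ultimately show ?thesis unfolding abs_mult power2_abs by linarith
    qed
    then have "\<bar>u z * dil u z\<bar> * (qS z * w) \<le> ((dil u z)\<^sup>2 + (u z)\<^sup>2) * (qS z * w)"
      using w by (intro mult_right_mono) auto
    then have ee: "\<bar>u z * dil u z\<bar> * (qS z * w) \<le> hsq u z * w + (u z)\<^sup>2 * (exp (- t / 2) * w)"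
      using d f by (simp add: distrib_right)
    have a: "\<bar>x * (qS z * rad (wplateau' T) z)\<bar> = \<bar>x\<bar> * (qS z * w)" for x
      unfolding r abs_mult w(2) by simp
    show ?thesis unfolding a en using n d f ee by (simp add: r abs_mult w(2))
  qed
  show "\<bar>IA (wplateau' T)\<bar> \<le> E" "\<bar>IB (wplateau' T)\<bar> \<le> E" "\<bar>ID (wplateau' T)\<bar> \<le> E" "\<bar>IE (wplateau' T)\<bar> \<le> E" "\<bar>IF (wplateau' T)\<bar> \<le> E"
    unfolding E_def using * by (auto intro!: cut_energy_bound[OF T] i)
qed

text \<open>Energy and Pohozaev identities for the weight \<open>W^\<sigma>\<close>, with the slopes
  separated. The third one, integration by parts of \<open>dil (u^2)\<close>, serves to complete the
  square in the supercritical range.\<close>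

lemma plateau_identities:
  assumes T: "T > 0"
  defines "g \<equiv> wplateau T" and "g1 \<equiv> wplateau' T" and "k \<equiv> real CARD('k)"
  shows "IA g + 4 * (\<sigma> * IE g + IE g1) = IB g"
    and "(k + 2 * \<sigma>) * IA g + 2 * IA g1 - 4 * (\<sigma> * ID g + ID g1) = ((4 * \<sigma> + (2 * k + 2)) * IB g + 4 * IB g1) / (p + 1)"
    and "2 * IE g = - ((4 * \<sigma> + 2 * k) * IF g + 4 * IF g1)"
proof -
  note b = bump_wplateau[OF T, folded g_def g1_def]
  note i = integrable_energies[OF cutoff_wplateau(1)[OF T, folded g_def]]
  note i1 = integrable_energies[OF cutoff_wplateau(2)[OF T, folded g1_def]]
  have r: "rad (\<lambda>t. \<sigma> * g t + g1 t) z = \<sigma> * rad g z + rad g1 z" for z :: "'k heis" by (simp add: rad_def)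
  have "IB g = (LINT z|lborel. hsq u z * rad g z + 4 * (\<sigma> * ((u z * dil u z) * (qS z * rad g z)) + (u z * dil u z) * (qS z * rad g1 z)))"
    unfolding energy_identity[OF b, symmetric] r by (simp add: algebra_simps)
  then show "IA g + 4 * (\<sigma> * IE g + IE g1) = IB g"
    using i i1 by simp
  have "(LINT z|lborel. ((k + 2 * \<sigma>) * (hsq u z * rad g z) + 2 * (hsq u z * rad g1 z)) 
      - 4 * (\<sigma> * ((dil u z)\<^sup>2 * (qS z * rad g z)) + (dil u z)\<^sup>2 * (qS z * rad g1 z))) =
     (LINT z|lborel. hsq u z * rad (\<lambda>t. real CARD('k) * g t + 2 * (\<sigma> * g t + g1 t)) z - 4 * ((dil u z)\<^sup>2 * (qS z * rad (\<lambda>t. \<sigma> * g t + g1 t) z)))"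
    by (rule Bochner_Integration.integral_cong) (simp_all add: rad_def k_def algebra_simps)
  also have "\<dots> = (LINT z|lborel. \<bar>u z\<bar> powr (p + 1) / (p + 1) * rad (\<lambda>t. 4 * (\<sigma> * g t + g1 t) + hom_dim TYPE('k) * g t) z)"
    by (rule pohozaev[OF b])
  also have "\<dots> = (LINT z|lborel. ((4 * \<sigma> + (2 * k + 2)) * (\<bar>u z\<bar> powr (p + 1) * rad g z) + 4 * (\<bar>u z\<bar> powr (p + 1) * rad g1 z)) / (p + 1))"
    by (rule Bochner_Integration.integral_cong) (simp_all add: rad_def k_def algebra_simps)
  finally show "(k + 2 * \<sigma>) * IA g + 2 * IA g1 - 4 * (\<sigma> * ID g + ID g1) = ((4 * \<sigma> + (2 * k + 2)) * IB g + 4 * IB g1) / (p + 1)"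
    using i i1 by simp
  have u2: "C1 (\<lambda>z. (u z)\<^sup>2)" "dil (\<lambda>z. (u z)\<^sup>2) z = 2 * (u z * dil u z)" for z
    using C1_mult(1)[OF C1u C1u] dil_mult[OF C1u C1u] by (simp_all add: power2_eq_square)
  have "(LINT z|lborel. 2 * ((u z * dil u z) * (qS z * rad g z))) = (LINT z|lborel. dil (\<lambda>z. (u z)\<^sup>2) z * (qS z * rad g z))"
    by (simp add: u2(2) mult_ac)
  also have "\<dots> = - (LINT z|lborel. (u z)\<^sup>2 * (qS z * rad (\<lambda>t. 4 * (\<sigma> * g t + g1 t) + 2 * real CARD('k) * g t) z))"
    by (rule integral_dil_qS_rad[OF u2(1) b])
  also have "(\<lambda>z. (u z)\<^sup>2 * (qS z * rad (\<lambda>t. 4 * (\<sigma> * g t + g1 t) + 2 * real CARD('k) * g t) z)) =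
     (\<lambda>z. (4 * \<sigma> + 2 * k) * ((u z)\<^sup>2 * (qS z * rad g z)) + 4 * ((u z)\<^sup>2 * (qS z * rad g1 z)))"
    by (rule ext) (simp add: rad_def k_def algebra_simps)
  finally show "2 * IE g = - ((4 * \<sigma> + 2 * k) * IF g + 4 * IF g1)"
    using i i1 by simp
qed

text \<open>
  The combination of the first two plateau identities that eliminates the gradient term is the
  Pohozaev identity.
\<close>

lemma subcritical_zero:
  assumes "\<sigma> = 0" and sub: "real CARD('k) * (p - 1) < 2"
  shows "u = (\<lambda>z. 0)"
proof -
  let ?k = "real CARD('k)"
  \<comment> \<open>Positivity of this coefficient is exactly \<open>k (p - 1) < 2\<close>.\<close>
  define c where "c = (2 * ?k + 2) / (p + 1) - ?k"
  have c: "c > 0"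
  proof -
    have "?k * (p + 1) < 2 * ?k + 2" using sub by (simp add: algebra_simps)
    then have "?k < (2 * ?k + 2) / (p + 1)" using p by (simp add: less_divide_eq)
    then show ?thesis by (simp add: c_def)
  qed
  define K where "K = 2 + 4 + 4 / (p + 1) + 4 * ?k"
  have K: "K > 0" using p by (simp add: K_def add_pos_nonneg)
  have bound: "c * IB (wplateau T) \<le> K * (LINT z|lborel. cut_energy T z)" if T: "T > 0" for T
  proof -
    define E where "E = (LINT z|lborel. cut_energy T z)"
    note e = error_bounds[OF T, folded E_def]
    note id = plateau_identities[OF T, unfolded \<open>\<sigma> = 0\<close>]
    have split: "(X * x + 4 * y) / (p + 1) = X / (p + 1) * x + 4 / (p + 1) * y" for X x y :: real
      by (simp add: add_divide_distrib)
    have "?k * (IA (wplateau T) + 4 * IE (wplateau' T)) = ?k * IB (wplateau T)"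
      using id(1) by simp
    then have "?k * IA (wplateau T) + 4 * (?k * IE (wplateau' T)) = ?k * IB (wplateau T)"
      by (simp only: distrib_left mult.left_commute)
    moreover have "?k * IA (wplateau T) + 2 * IA (wplateau' T) - 4 * ID (wplateau' T) = (2 * ?k + 2) / (p + 1) * IB (wplateau T) + 4 / (p + 1) * IB (wplateau' T)"
      using id(2)[unfolded split] by simp
    moreover have "c * IB (wplateau T) = (2 * ?k + 2) / (p + 1) * IB (wplateau T) - ?k * IB (wplateau T)"
      by (simp add: c_def left_diff_distrib)
    ultimately have "c * IB (wplateau T) = 2 * IA (wplateau' T) - 4 * ID (wplateau' T) - 4 / (p + 1) * IB (wplateau' T) - 4 * (?k * IE (wplateau' T))"
      by linarith
    also have "\<dots> \<le> 2 * E + 4 * E + 4 / (p + 1) * E + 4 * (?k * E)"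
    proof -
      have "- (4 / (p + 1) * IB (wplateau' T)) \<le> 4 / (p + 1) * E"
        using mult_left_mono[of "- IB (wplateau' T)" E "4 / (p + 1)"] e(2) p by (simp add: abs_le_iff)
      moreover have "- (?k * IE (wplateau' T)) \<le> ?k * E"
        using mult_left_mono[of "- IE (wplateau' T)" E ?k] e(4) by (simp add: abs_le_iff)
      moreover have "IA (wplateau' T) \<le> E" "- ID (wplateau' T) \<le> E" using e(1,3) by linarith+
      ultimately show ?thesis by linarith
    qed
    also have "\<dots> = K * E" by (simp add: K_def distrib_right)
    finally show ?thesis unfolding E_def .
  qed
  have "\<bar>u z0\<bar> powr (p + 1) = 0" if "z0 \<noteq> 0" for z0
  proof (rule vanish_if_plateau_integral_small[OF continuous_u_powr _ _ that, where s = 0])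
    fix \<epsilon> :: real assume \<epsilon>: "\<epsilon> > 0"
    then obtain T0 where T0: "\<And>T. T \<ge> T0 \<Longrightarrow> (LINT z|lborel. cut_energy T z) \<le> c * \<epsilon> / K"
      using cut_energy_small[of "c * \<epsilon> / K"] c K by auto
    have "IB (\<lambda>t. exp (0 * t) * plateau T t) \<le> \<epsilon>" if "T \<ge> max T0 1" for T
    proof -
      have "c * IB (wplateau T) \<le> K * (LINT z|lborel. cut_energy T z)" using that by (intro bound) auto
      also have "\<dots> \<le> K * (c * \<epsilon> / K)" using K that by (intro mult_left_mono T0) auto
      also have "\<dots> = c * \<epsilon>" using K by simp
      finally have "IB (wplateau T) \<le> \<epsilon>" using c by simp
      then show ?thesis by (simp add: wplateau_def[abs_def] \<open>\<sigma> = 0\<close>)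
    qed
    then show "\<exists>T0. \<forall>T\<ge>T0. IB (\<lambda>t. exp (0 * t) * plateau T t) \<le> \<epsilon>" by blast
  qed (use p in auto)
  then have nz: "u z = 0" if "z \<noteq> 0" for z using that by simp
  have "u z = 0" if "fst z \<noteq> 0" for z by (rule nz) (use that in auto)
  then show ?thesis using zero_if_zero_off_axis[OF continuous_u] by blast
qed

text \<open>
  Here the weight \<open>W\<^bsup>\<sigma>\<^esup>\<close> makes the potential terms cancel as well, and what remains is the derivative of
  the monotone energy, a multiple of the integral of \<open>(dil u + 2 \<alpha> u)\<^sup>2\<close>.
\<close>

lemma supercritical_homogeneous:
  assumes "\<beta> = 0" and super: "real CARD('k) * (p - 1) > 2" and z: "fst z \<noteq> 0"
  shows "dil u z + 2 * \<alpha> * u z = 0"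
proof -
  let ?k = "real CARD('k)"
  have \<sigma>: "\<sigma> = \<alpha> - ?k / 2" using assms by (simp add: \<sigma>_def)
  have "2 * \<alpha> < ?k" using super p by (simp add: \<alpha>_def divide_less_eq)
  then have \<sigma>0: "\<sigma> < 0" by (simp add: \<sigma>)
  have k\<sigma>: "?k + 2 * \<sigma> = 2 * \<alpha>" by (simp add: \<sigma>)
  define S where "S T = (LINT z|lborel. (dil u z + 2 * \<alpha> * u z)\<^sup>2 * (qS z * rad (wplateau T) z))" for T
  define K where "K = (16 * \<alpha> * (- \<sigma>) + 8 * \<alpha> + 2 + 4 + 4 / (p + 1)) / (4 * (- \<sigma>))"
  have K: "K > 0"
    unfolding K_def using \<sigma>0 \<alpha> p by (intro divide_pos_pos add_nonneg_pos add_nonneg_nonneg mult_nonneg_nonneg) auto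
  have bound: "S T \<le> K * (LINT z|lborel. cut_energy T z)" if T: "T > 0" for T
  proof -
    define E where "E = (LINT z|lborel. cut_energy T z)"
    note e = error_bounds[OF T, folded E_def]
    note id = plateau_identities[OF T]
    have split: "(X * x + 4 * y) / (p + 1) = X / (p + 1) * x + 4 / (p + 1) * y" for X x y :: real
      by (simp add: add_divide_distrib)
    note i = integrable_energies[OF cutoff_wplateau(1)[OF T]]
    have "S T = (LINT z|lborel. (dil u z)\<^sup>2 * (qS z * rad (wplateau T) z) + 4 * \<alpha> * ((u z * dil u z) * (qS z * rad (wplateau T) z))
        + 4 * \<alpha>\<^sup>2 * ((u z)\<^sup>2 * (qS z * rad (wplateau T) z)))"
      unfolding S_def by (intro Bochner_Integration.integral_cong refl) (simp add: power2_eq_square algebra_simps)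
    then have S: "S T = ID (wplateau T) + 4 * \<alpha> * IE (wplateau T) + 4 * \<alpha>\<^sup>2 * IF (wplateau T)"
      using i by simp
    \<comment> \<open>Up to a slope term the \<open>u^2\<close> part of the square is
      \<open>- 2 * \<alpha>\<close> times the mixed part, so \<open>S T\<close> reduces to
      \<open>ID + 2 * \<alpha> * IE\<close>.\<close>
    have z: "4 * \<alpha>\<^sup>2 * IF (wplateau T) = - 2 * \<alpha> * IE (wplateau T) - 4 * \<alpha> * IF (wplateau' T)"
    proof -
      have "4 * \<sigma> + 2 * ?k = 4 * \<alpha>" using k\<sigma> by linarith
      then have "4 * \<alpha> * IF (wplateau T) = - 2 * IE (wplateau T) - 4 * IF (wplateau' T)" using id(3) by simp
      then have "\<alpha> * (4 * \<alpha> * IF (wplateau T)) = \<alpha> * (- 2 * IE (wplateau T) - 4 * IF (wplateau' T))" by simp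
      then show ?thesis by (simp add: power2_eq_square algebra_simps)
    qed
    \<comment> \<open>The gradient coefficient is \<open>2 * \<alpha>\<close> by
      \<open>k\<sigma>\<close>, and here the potential coefficient is seen to agree with it;
      subtracting \<open>2 * \<alpha>\<close> times the energy identity then removes both.\<close>
    have c: "(4 * \<sigma> + (2 * ?k + 2)) / (p + 1) = 2 * \<alpha>"
    proof -
      have "4 * \<sigma> + (2 * ?k + 2) = 4 * \<alpha> + 2" by (simp add: \<sigma>)
      also have "\<dots> = 2 * \<alpha> * (p + 1)" using \<alpha>(2) by (simp add: algebra_simps)
      finally show ?thesis using p by simp
    qed
    have 1: "2 * \<alpha> * IA (wplateau T) + 8 * \<alpha> * \<sigma> * IE (wplateau T) + 8 * \<alpha> * IE (wplateau' T) = 2 * \<alpha> * IB (wplateau T)"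
      unfolding id(1)[symmetric] by (simp add: algebra_simps)
    have "2 * \<alpha> * IA (wplateau T) + 2 * IA (wplateau' T) - 4 * (\<sigma> * ID (wplateau T) + ID (wplateau' T)) = 
        (4 * \<sigma> + (2 * ?k + 2)) / (p + 1) * IB (wplateau T) + 4 / (p + 1) * IB (wplateau' T)"
      using id(2)[unfolded split] unfolding k\<sigma> .
    then have 2: "2 * \<alpha> * IA (wplateau T) + 2 * IA (wplateau' T) - 4 * (\<sigma> * ID (wplateau T)) - 4 * ID (wplateau' T) = 2 * \<alpha> * IB (wplateau T) + 4 / (p + 1) * IB (wplateau' T)"
      unfolding c by simp
    have "S T = ID (wplateau T) + 2 * \<alpha> * IE (wplateau T) - 4 * \<alpha> * IF (wplateau' T)"
      unfolding S z by simp
    moreover have "4 * (- \<sigma>) * (a + 2 * \<alpha> * b - 4 * \<alpha> * c) = - 4 * (\<sigma> * a) - 8 * \<alpha> * \<sigma> * b + 16 * \<alpha> * \<sigma> * c" for a b c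
      by (simp add: algebra_simps)
    ultimately have "4 * (- \<sigma>) * S T = - 4 * (\<sigma> * ID (wplateau T)) - 8 * \<alpha> * \<sigma> * IE (wplateau T) + 16 * \<alpha> * \<sigma> * IF (wplateau' T)"
      by (simp only:)
    also have "\<dots> = 16 * \<alpha> * \<sigma> * IF (wplateau' T) + 8 * \<alpha> * IE (wplateau' T) - 2 * IA (wplateau' T) + 4 * ID (wplateau' T) + 4 / (p + 1) * IB (wplateau' T)"
      using 1 2 by linarith
    also have "\<dots> \<le> 16 * \<alpha> * (- \<sigma>) * E + 8 * \<alpha> * E + 2 * E + 4 * E + 4 / (p + 1) * E"
    proof -
      have "16 * \<alpha> * (- \<sigma>) * (- IF (wplateau' T)) \<le> 16 * \<alpha> * (- \<sigma>) * E"
        using e(5) \<sigma>0 \<alpha> by (intro mult_left_mono) (auto intro: mult_nonneg_nonpos)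
      moreover have "8 * \<alpha> * IE (wplateau' T) \<le> 8 * \<alpha> * E" using e(4) \<alpha> by (intro mult_left_mono) auto
      moreover have "4 / (p + 1) * IB (wplateau' T) \<le> 4 / (p + 1) * E" using e(2) p by (intro mult_left_mono) auto
      moreover have "- IA (wplateau' T) \<le> E" "ID (wplateau' T) \<le> E" using e(1,3) by linarith+
      moreover have "16 * \<alpha> * (- \<sigma>) * (- IF (wplateau' T)) = 16 * \<alpha> * \<sigma> * IF (wplateau' T)" by simp
      ultimately show ?thesis by linarith
    qed
    also have "\<dots> = (16 * \<alpha> * (- \<sigma>) + 8 * \<alpha> + 2 + 4 + 4 / (p + 1)) * E" by (simp only: distrib_right)
    finally have "S T * (4 * (- \<sigma>)) \<le> (16 * \<alpha> * (- \<sigma>) + 8 * \<alpha> + 2 + 4 + 4 / (p + 1)) * E"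
      by (simp only: mult.commute[of "S T"])
    then have "S T \<le> (16 * \<alpha> * (- \<sigma>) + 8 * \<alpha> + 2 + 4 + 4 / (p + 1)) * E / (4 * (- \<sigma>))"
      using \<sigma>0 by (intro mult_imp_le_div_pos) auto
    then show ?thesis unfolding K_def E_def by (simp only: times_divide_eq_left)
  qed
  \<comment> \<open>\<open>qS\<close> is not continuous at the origin, so its factor
    \<open>1 / W\<close> is moved into the exponential weight, which turns \<open>\<sigma>\<close>
    into \<open>\<sigma> - 1\<close>.\<close>
  have "xsq z * (dil u z + 2 * \<alpha> * u z)\<^sup>2 = 0"
  proof (rule vanish_if_plateau_integral_small[where s = "\<sigma> - 1" and f = "\<lambda>z. xsq z * (dil u z + 2 * \<alpha> * u z)\<^sup>2"])
    show "continuous_on UNIV (\<lambda>z. xsq z * (dil u z + 2 * \<alpha> * u z)\<^sup>2)"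
      by (intro continuous_on_mult continuous_on_power continuous_on_add continuous_dil continuous_xsq C1u continuous_u continuous_on_const)
    show "z \<noteq> 0" using z by auto
    fix \<epsilon> :: real assume \<epsilon>: "\<epsilon> > 0"
    then obtain T0 where T0: "\<And>T. T \<ge> T0 \<Longrightarrow> (LINT z|lborel. cut_energy T z) \<le> \<epsilon> / K"
      using cut_energy_small[of "\<epsilon> / K"] K by auto
    have "(LINT z|lborel. xsq z * (dil u z + 2 * \<alpha> * u z)\<^sup>2 * rad (\<lambda>t. exp ((\<sigma> - 1) * t) * plateau T t) z) \<le> \<epsilon>" if "T \<ge> max T0 1" for T
    proof -
      have "exp ((\<sigma> - 1) * t) * plateau T t = exp (- t) * wplateau T t" for t
        by (simp add: wplateau_def algebra_simps flip: exp_add mult.assoc)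
      then have "(LINT z|lborel. xsq z * (dil u z + 2 * \<alpha> * u z)\<^sup>2 * rad (\<lambda>t. exp ((\<sigma> - 1) * t) * plateau T t) z) = S T"
        unfolding S_def qS_rad by (simp add: mult_ac)
      also have "\<dots> \<le> K * (LINT z|lborel. cut_energy T z)" using that by (intro bound) auto
      also have "\<dots> \<le> K * (\<epsilon> / K)" using K that by (intro mult_left_mono T0) auto
      finally show ?thesis using K by simp
    qed
    then show "\<exists>T0. \<forall>T\<ge>T0. (LINT z|lborel. xsq z * (dil u z + 2 * \<alpha> * u z)\<^sup>2 * rad (\<lambda>t. exp ((\<sigma> - 1) * t) * plateau T t) z) \<le> \<epsilon>"
      by blast
  qed auto
  then show ?thesis using z by (simp add: xsq_def)
qed

end

text \<open>Along the dilation orbit contracting \<open>z\<close> to the origin, homogeneity makes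
  \<open>exp (- s * t) * u\<close> constant, while boundedness of \<open>u\<close> near the origin
  makes it tend to zero.\<close>

lemma zero_if_homogeneous:
  fixes u :: "'k::finite heis \<Rightarrow> real"
  assumes u: "C1 u" and s: "s > 0" and hom: "\<And>z. fst z \<noteq> 0 \<Longrightarrow> dil u z + s * u z = 0" and z: "fst z \<noteq> 0"
  shows "u z = 0"
proof -
  define \<gamma> :: "real \<Rightarrow> 'k heis" where "\<gamma> t = (exp (- t) *\<^sub>R fst z, exp (- 2 * t) * snd z)" for t
  define w where "w t = exp (- s * t) * u (\<gamma> t)" for t
  have "(w has_real_derivative 0) (at t)" for t
  proof -
    have "(\<gamma> has_derivative (\<lambda>h. (- h) *\<^sub>R Zvec (\<gamma> t))) (at t)"
      unfolding \<gamma>_def[abs_def] Zvec_def by (auto intro!: derivative_eq_intros simp: algebra_simps)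
    from has_derivative_compose[OF this C1_D[OF u]]
    have "((\<lambda>t. u (\<gamma> t)) has_real_derivative - dil u (\<gamma> t)) (at t)"
      unfolding D_linear(2)[OF u] has_field_derivative_def dil_def
      by (rule back_subst[where P = "\<lambda>f. (_ has_derivative f) (at t)"]) (simp add: fun_eq_iff)
    then have "(w has_real_derivative (exp (- s * t) * (- dil u (\<gamma> t)) + exp (- s * t) * (- s) * u (\<gamma> t))) (at t)"
      unfolding w_def[abs_def] by (auto intro!: derivative_eq_intros)
    moreover have "dil u (\<gamma> t) + s * u (\<gamma> t) = 0"
      by (rule hom) (use z in \<open>simp add: \<gamma>_def\<close>)
    then have "exp (- s * t) * (- dil u (\<gamma> t)) + exp (- s * t) * (- s) * u (\<gamma> t) = 0"
      by (simp add: eq_neg_iff_add_eq_0[symmetric])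
    ultimately show ?thesis by simp
  qed
  then have const: "w t = w 0" for t using DERIV_isconst_all by blast
  have e: "((\<lambda>t. exp (- c * t)) \<longlongrightarrow> 0) at_top" if "c > 0" for c :: real
  proof -
    have "filterlim (\<lambda>t. c * t) at_top at_top"
      by (rule filterlim_tendsto_pos_mult_at_top[OF tendsto_const that filterlim_ident])
    then have "filterlim (\<lambda>t. - c * t) at_bot at_top"
      by (simp add: filterlim_uminus_at_bot)
    then show ?thesis by (rule filterlim_compose[OF exp_at_bot])
  qed
  have "(\<gamma> \<longlongrightarrow> (0 *\<^sub>R fst z, 0 * snd z)) at_top"
    unfolding \<gamma>_def[abs_def] using e[of 1] e[of 2] by (intro tendsto_intros) simp_all
  then have "((\<lambda>t. u (\<gamma> t)) \<longlongrightarrow> u (0 *\<^sub>R fst z, 0 * snd z)) at_top"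
    using C1_continuous[OF u, of UNIV] by (auto simp: continuous_on_eq_continuous_at intro: isCont_tendsto_compose)
  then have lim: "(w \<longlongrightarrow> 0 * u (0 *\<^sub>R fst z, 0 * snd z)) at_top"
    unfolding w_def[abs_def] by (intro tendsto_mult e s)
  have "((\<lambda>_ :: real. w 0) \<longlongrightarrow> 0 * u (0 *\<^sub>R fst z, 0 * snd z)) at_top"
    by (rule tendsto_cong[THEN iffD1, OF _ lim]) (intro always_eventually allI const)
  then have "w 0 = 0" by (simp add: tendsto_const_iff)
  then show ?thesis by (simp add: w_def \<gamma>_def)
qed

text \<open>
  This is \<open>(\<gamma> + 1)\<^sup>2 < 4 \<gamma> p\<close> for \<open>\<gamma> = k (p - 1) - 1\<close>.
\<close>

lemma joseph_lundgren_condition: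
  fixes k :: nat and p :: real
  assumes k: "k \<ge> 1" and super: "real k * (p - 1) > 2" and JL: "ereal p < p_JL (2 * k + 2)"
  shows "(real k * (p - 1))\<^sup>2 < 4 * p * (real k * (p - 1) - 1)"
proof -
  define q where "q = p - 1"
  define x where "x = real k"
  have x: "x \<ge> 1" "x * q > 2" using k super by (simp_all add: x_def q_def)
  then have q: "q > 0" by (smt (verit) mult_nonneg_nonpos)
  have "0 < (4 * x - x\<^sup>2) * q\<^sup>2 + 4 * (x - 1) * q - 4"
  \<comment> \<open>\<open>k \<le> 4\<close> means dimension at most 10: there \<open>p_JL\<close>
    is infinite, the quadratic in \<open>q\<close> has a nonnegative leading coefficient, and
    \<open>x * q > 2\<close> alone suffices.\<close>
  proof (cases "k \<le> 4")
    case True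
    have "2 * ((4 - x) * q) \<le> (x * q) * ((4 - x) * q)"
      using x q True by (intro mult_right_mono) (auto simp: x_def)
    moreover have "(4 * x - x\<^sup>2) * q\<^sup>2 = (x * q) * ((4 - x) * q)" by (simp add: power2_eq_square algebra_simps)
    moreover have "2 * ((4 - x) * q) + 4 * (x - 1) * q - 4 = 4 * q + 2 * (x * q) - 4" by (simp add: algebra_simps)
    ultimately show ?thesis using x q by linarith
  next
    case False
    define R where "R = sqrt (2 * x + 1)"
    define a where "a = x * (x - 4)"
    have x5: "x \<ge> 5" using False by (simp add: x_def)
    have a: "a > 0" using x5 by (simp add: a_def)
    have R: "R\<^sup>2 = 2 * x + 1" "R \<ge> 3"
      using x5 by (auto simp: R_def intro!: real_le_rsqrt)
    have "p < (4 * x\<^sup>2 - 8 * x - 8 + 8 * R) / (4 * a)"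
    proof -
      have "p < ((real (2 * k + 2) - 2)\<^sup>2 - 4 * real (2 * k + 2) + 8 * sqrt (real (2 * k + 2) - 1))
                 / ((real (2 * k + 2) - 2) * (real (2 * k + 2) - 10))"
        using JL False by (simp add: p_JL_def)
      also have "\<dots> = (4 * x\<^sup>2 - 8 * x - 8 + 8 * R) / (4 * a)"
        by (simp add: x_def[symmetric] R_def a_def power2_eq_square algebra_simps)
      finally show ?thesis .
    qed
    then have "p * (4 * a) < 4 * x\<^sup>2 - 8 * x - 8 + 8 * R" using a by (simp add: pos_less_divide_eq)
    then have up: "a * q - 2 * (x - 1) < 2 * R" by (simp add: q_def a_def power2_eq_square algebra_simps)
    \<comment> \<open>The condition holds strictly between two roots in \<open>q\<close>. The upper
      one comes from \<open>p_JL\<close>; supercriticality already lies beyond the lower one, since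
      \<open>R \<ge> 3\<close>.\<close>
    have "(x - 4) * 2 < (x - 4) * (x * q)" using x x5 by (intro mult_strict_left_mono) auto
    then have "2 * (x - 4) < a * q" by (simp add: a_def mult_ac)
    moreover have "- (2 * R) < y - 2 * (x - 1)" if "2 * (x - 4) < y" for y
      using that R(2) by (simp add: algebra_simps)
    ultimately have "- (2 * R) < a * q - 2 * (x - 1)" by blast
    moreover have "y\<^sup>2 < r\<^sup>2" if "- r < y" "y < r" for y r :: real
      using mult_pos_pos[of "r - y" "r + y"] that by (simp add: power2_eq_square algebra_simps)
    ultimately have "(a * q - 2 * (x - 1))\<^sup>2 < (2 * R)\<^sup>2" using up by blast
    then have "(a * q - 2 * (x - 1))\<^sup>2 < 4 * (2 * x + 1)" by (simp add: power_mult_distrib R(1))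
    \<comment> \<open>Completing the square: multiplied by \<open>a\<close>, the quadratic becomes a
      difference of squares with discriminant term \<open>(2 * R)^2\<close>.\<close>
    moreover have "a * ((4 * x - x\<^sup>2) * q\<^sup>2 + 4 * (x - 1) * q - 4) = 4 * (2 * x + 1) - (a * q - 2 * (x - 1))\<^sup>2"
      by (simp add: a_def power2_eq_square algebra_simps)
    ultimately have "a * ((4 * x - x\<^sup>2) * q\<^sup>2 + 4 * (x - 1) * q - 4) > 0" by linarith
    then show ?thesis using a by (simp add: zero_less_mult_iff)
  qed
  then have "(x * q)\<^sup>2 < 4 * (q + 1) * (x * q - 1)"
    by (simp add: power2_eq_square algebra_simps)
  then show ?thesis by (simp add: x_def q_def)
qed

section \<open>Assembling the equivalence\<close>

lemma zero_solution:
  fixes u :: "'k::finite heis \<Rightarrow> real"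
  defines "u \<equiv> \<lambda>z. 0"
  shows "C2_solution p u" "cylindrical u" "stable_outside_compact p u"
  unfolding u_def
proof -
  have X: "heis_X j (\<lambda>z :: 'k heis. 0) = (\<lambda>z. 0)" for j
    by (cases j) (auto simp: partial_x_def partial_y_def)
  show "C2_solution p (\<lambda>z :: 'k heis. 0)"
    by (simp add: C2_solution_def numeral_2_eq_2 C_n.simps heis_laplacian_def X)
  show "cylindrical (\<lambda>z :: 'k heis. 0)" by (simp add: cylindrical_def)
  have "(LINT z|lborel. (\<Sum>j\<in>UNIV. \<bar>heis_X j \<phi> z\<bar>\<^sup>2)) \<ge> 0" for \<phi> :: "'k heis \<Rightarrow> real"
    by (intro Bochner_Integration.integral_nonneg sum_nonneg) auto
  then show "stable_outside_compact p (\<lambda>z :: 'k heis. 0)"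
    unfolding stable_outside_compact_def by (intro exI[of _ "{}"]) simp
qed

lemma stable_outside_compact_ann:
  assumes "stable_outside_compact p u"
  obtains a0 where "\<And>\<phi> a b. a0 \<le> a \<Longrightarrow> C1 \<phi> \<Longrightarrow> (\<And>z. z \<notin> ann a b \<Longrightarrow> \<phi> z = 0) \<Longrightarrow>
      (LINT z|lborel. p * \<bar>u z\<bar> powr (p - 1) * (\<phi> z)\<^sup>2) \<le> (LINT z|lborel. hsq \<phi> z)"
proof -
  obtain K where K: "compact K" "\<And>\<phi>. \<phi> \<in> C_n_compact_support 1 (- K) \<Longrightarrow>
          (LINT z|lborel. (\<Sum>j\<in>UNIV. \<bar>heis_X j \<phi> z\<bar>\<^sup>2))
            \<ge> (LINT z|lborel. p * \<bar>u z\<bar> powr (p - 1) * (\<phi> z)\<^sup>2)"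
    using assms unfolding stable_outside_compact_def by blast
  have "bounded (W ` K)"
    by (intro compact_imp_bounded compact_continuous_image continuous_W K)
  then obtain B where B: "B > 0" "\<forall>x\<in>W ` K. norm x \<le> B" unfolding bounded_pos by blast
  \<comment> \<open>Beyond this level of \<open>ln W\<close> every annulus misses the compact set
    \<open>K\<close>.\<close>
  define a0 where "a0 = ln (B + 1)"
  have a0: "W z < exp a" if "z \<in> K" "a0 \<le> a" for z a
  proof -
    have "W z \<le> B" using B(2) that(1) by fastforce
    also have "B < exp a0" using B(1) by (simp add: a0_def)
    also have "\<dots> \<le> exp a" using that by simp
    finally show ?thesis .
  qed
  show thesis
  proof (rule that)
    fix \<phi> :: "'a heis \<Rightarrow> real" and a b
    assume a: "a0 \<le> a" and \<phi>: "C1 \<phi>" "\<And>z. z \<notin> ann a b \<Longrightarrow> \<phi> z = 0"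
    have cl: "closure {z. \<phi> z \<noteq> 0} \<subseteq> ann a b"
      using \<phi>(2) by (intro closure_minimal compact_imp_closed compact_ann) auto
    have "compact (closure {z. \<phi> z \<noteq> 0})"
      using bounded_subset[OF compact_imp_bounded[OF compact_ann] cl]
      by (simp only: compact_eq_bounded_closed closed_closure simp_thms)
    moreover have "ann a b \<subseteq> - K"
      using a0[OF _ a] by (auto simp: ann_def not_le[symmetric])
    ultimately have "\<phi> \<in> C_n_compact_support 1 (- K)"
      using \<phi>(1) cl by (auto simp: C_n_compact_support_def)
    from K(2)[OF this]
    show "(LINT z|lborel. p * \<bar>u z\<bar> powr (p - 1) * (\<phi> z)\<^sup>2) \<le> (LINT z|lborel. hsq \<phi> z)"
      by (simp add: hdot_def power2_eq_square)
  qed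
qed

text \<open>The inequality is equivalent to \<open>\<gamma> + 1 \<le> (n + 2) * (p - 1)\<close>, so
  any large \<open>n\<close> works.\<close>

lemma exists_cutoff_power:
  fixes p \<gamma> :: real
  assumes "p > 1"
  obtains n :: nat where "real (n + 3) * (\<gamma> + 1) \<le> (real (n + 3) - 1) * (p + \<gamma>)"
proof -
  obtain n :: nat where "(\<gamma> + 1) / (p - 1) \<le> real n" using real_arch_simple by blast
  then have "\<gamma> + 1 \<le> real n * (p - 1)" using assms by (simp add: divide_le_eq)
  moreover have "0 \<le> 2 * (p - 1)" using assms by simp
  ultimately have "\<gamma> + 1 \<le> (real n + 2) * (p - 1)" by (simp add: distrib_right)
  then show thesis by (intro that[of n]) (simp add: algebra_simps)
qed

theorem corollary1p1:
  fixes p :: real and u :: "'k::finite heis \<Rightarrow> real"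
  assumes "ereal p \<in> {1 <..< ereal (p_S (2 * CARD('k) + 2))}
                   \<union> {ereal (p_S (2 * CARD('k) + 2)) <..< p_JL (2 * CARD('k) + 2)}"
  shows "(C2_solution p u \<and> cylindrical u \<and> stable_outside_compact p u) \<longleftrightarrow> u = (\<lambda>z. 0)"
proof
  assume "u = (\<lambda>z. 0)"
  then show "C2_solution p u \<and> cylindrical u \<and> stable_outside_compact p u"
    using zero_solution[where 'k = 'k] by simp
next
  assume u: "C2_solution p u \<and> cylindrical u \<and> stable_outside_compact p u"
  let ?k = "real CARD('k)"
  have k: "?k > 0" "CARD('k) \<ge> 1" by (simp_all add: Suc_leI)
  have pS: "p_S (2 * CARD('k) + 2) = 1 + 2 / ?k"
    using k by (simp add: p_S_def field_simps)
  have one: "ereal p \<in> {1<..<ereal x} \<longleftrightarrow> 1 < p \<and> p < x" for x by (simp add: one_ereal_def)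
  have p: "p > 1"
    using assms k unfolding pS one by (auto simp: add_pos_pos intro: less_trans[of 1 "1 + 2 / ?k"])
  obtain a0 where st: "\<And>\<phi> a b. a0 \<le> a \<Longrightarrow> C1 \<phi> \<Longrightarrow> (\<And>z. z \<notin> ann a b \<Longrightarrow> \<phi> z = 0) \<Longrightarrow>
      (LINT z|lborel. p * \<bar>u z\<bar> powr (p - 1) * (\<phi> z)\<^sup>2) \<le> (LINT z|lborel. hsq \<phi> z)"
    using stable_outside_compact_ann u by blast
  \<comment> \<open>Since \<open>p_S (2 * k + 2) = 1 + 2 / k\<close>, the two ranges are told apart
    by comparing \<open>k * (p - 1)\<close> with 2.\<close>
  consider "?k * (p - 1) < 2" | "?k * (p - 1) > 2" "ereal p < p_JL (2 * CARD('k) + 2)"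
    using assms k unfolding pS one by (auto simp: field_simps)
  then show "u = (\<lambda>z. 0)"
  proof cases
    case 1
    obtain n :: nat where n: "real (n + 3) * (1 + 1) \<le> (real (n + 3) - 1) * (p + 1)"
      using exists_cutoff_power[OF p] by blast
    interpret stable_tail u p 1 a0 n
    proof unfold_locales
      show "(LINT z|lborel. p * \<bar>u z\<bar> powr (p - 1) * (\<phi> z)\<^sup>2) \<le> (LINT z|lborel. hsq \<phi> z)"
        if "a0 \<le> a" "C1 \<phi>" "\<And>z. z \<notin> ann a b \<Longrightarrow> \<phi> z = 0" for \<phi> a b
        by (rule st[OF that])
    qed (use u p n 1 in \<open>auto simp: pos_le_divide_eq\<close>)
    show ?thesis
    proof (rule subcritical_zero[OF _ 1])
      have "(1 + 1) / (p - 1) = 2 * (1 / (p - 1))" by simp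
      moreover have "(k - 2 * x) / 2 + x - k / 2 = 0" for k x :: real by (simp add: field_simps)
      ultimately show "\<sigma> = 0" unfolding \<sigma>_def \<beta>_def \<alpha>_def by (simp only:)
    qed
  next
    case 2
    \<comment> \<open>The exponent with \<open>\<beta> = 0\<close>; \<open>g \<ge> 1\<close> holds
      because \<open>p\<close> is supercritical.\<close>
    define g where "g = ?k * (p - 1) - 1"
    have g: "g \<ge> 1" "(g + 1) / (p - 1) = ?k" "(g - 1) / (p - 1) < ?k"
      using 2 p by (auto simp: g_def pos_divide_less_eq)
    have \<Gamma>: "(g + 1)\<^sup>2 / (4 * g) < p"
      using joseph_lundgren_condition[OF k(2) 2] g(1)
      by (simp add: pos_divide_less_eq g_def mult_ac)
    obtain n :: nat where n: "real (n + 3) * (g + 1) \<le> (real (n + 3) - 1) * (p + g)"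
      using exists_cutoff_power[OF p] by blast
    interpret stable_tail u p g a0 n
    proof unfold_locales
      show "(LINT z|lborel. p * \<bar>u z\<bar> powr (p - 1) * (\<phi> z)\<^sup>2) \<le> (LINT z|lborel. hsq \<phi> z)"
        if "a0 \<le> a" "C1 \<phi>" "\<And>z. z \<notin> ann a b \<Longrightarrow> \<phi> z = 0" for \<phi> a b
        by (rule st[OF that])
    qed (use u p n g \<Gamma> in auto)
    have "\<beta> = 0" by (simp add: \<beta>_def g(2))
    then have "u z = 0" if "fst z \<noteq> 0" for z
      using zero_if_homogeneous[OF C1u _ supercritical_homogeneous that] 2(1) \<alpha>(1) by simp
    then have "u z = 0" for z
      by (rule zero_if_zero_off_axis[OF continuous_u])
    then show ?thesis by blast
  qed
qed

end
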